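(* Let $Z$ be a central ideal of a finite-dimensional diassociative algebra $L$ over a field $\mathbb{F}$. Let $\delta:M(L)\to (L/L'\otimes Z\oplus Z\otimes L/L')^2$ and the natural map $\beta:M(L)\to M(L/Z)$ be as defined in the context. Then the following are equivalent: 1. $\delta$ is the trivial (zero) map; 2. the natural map $\beta$ is injective; 3. $M(L)\cong \dfrac{M(L/Z)}{L'\cap Z}$; 4. $Z\subseteq Z^*(L)$.
   Context: A diassociative algebra over a field $\mathbb{F}$ is an $\mathbb{F}$-vector space with two associative bilinear products $\dashv,\vdash$ satisfying $x\dashv(y\dashv z)=x\dashv(y\vdash z)$, $(x\vdash y)\dashv z=x\vdash(y\dashv z)$, $(x\dashv y)\vdash z=(x\vdash y)\vdash z$. For subspaces $X,Y$, $X\dashv Y$ and $X\vdash Y$ denote spans of products, and $X\lozenge Y=X\dashv Y+X\vdash Y$. $K'=K\lozenge K$; $Z(K)$ is the set of $z\in K$ with $z\dashv x=x\dashv z=z\vdash x=x\vdash z=0$ for all $x\in K$. A central ideal is an ideal contained in the center. Multiplier: a pair $(K,M)$ is a defining pair for $L$ if $L\cong K/M$ and $M\subseteq Z(K)\cap K'$; if $\dim K$ is maximal among such pairs, $M$ is the multiplier $M(L)$ (zero products, unique up to isomorphism). For finite-dimensional $L$ and any free presentation $0\to R\to F\to L\to0$ ($F$ a free diassociative algebra) one identifies $M(L)=\frac{F'\cap R}{F\lozenge R+R\lozenge F}\cong\mathcal{H}^2(L,\mathbb{F})$. Here $\mathcal{H}^2(L,\mathbb{F})=\mathcal{Z}^2(L,\mathbb{F})/\mathcal{B}^2(L,\mathbb{F})$,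 where $\mathcal{Z}^2(L,\mathbb{F})$ consists of pairs $(f_\dashv,f_\vdash)$ of bilinear forms $L\times L\to\mathbb{F}$ such that for all $i,j,k\in L$: $f_\dashv(i,j\dashv k)=f_\dashv(i,j\vdash k)$; $f_\dashv(i\vdash j,k)=f_\vdash(i,j\dashv k)$; $f_\vdash(i\dashv j,k)=f_\vdash(i\vdash j,k)$; $f_\dashv(i,j\dashv k)=f_\dashv(i\dashv j,k)$; $f_\vdash(i,j\vdash k)=f_\vdash(i\vdash j,k)$; and $\mathcal{B}^2(L,\mathbb{F})$ consists of the pairs $f_\dashv(i,j)=-\varepsilon(i\dashv j)$, $f_\vdash(i,j)=-\varepsilon(i\vdash j)$ with $\varepsilon:L\to\mathbb{F}$ linear. The map $\delta$: with $M(L)$ identified with $\mathcal{H}^2(L,\mathbb{F})$, $\delta$ sends the class of $(f'_\dashv,f'_\vdash)$ to $(f''_\dashv,g''_\dashv,f''_\vdash,g''_\vdash)$, where $f''_\dashv(x+L',z)=f'_\dashv(x,z)$, $f''_\vdash(x+L',z)=f'_\vdash(x,z)$, $g''_\dashv(z,x+L')=f'_\dashv(z,x)$, $g''_\vdash(z,x+L')=f'_\vdash(z,x)$ for $x\in L$, $z\in Z$; this lies in $(\mathrm{Bil}(L/L'\times Z,\mathbb{F})\oplus \mathrm{Bil}(Z\times L/L',\mathbb{F}))^2$, the spaces of bilinear forms, which is identified (finite dimension) with $(L/L'\otimes Z\oplus Z\otimes L/L')^2$. The natural map $\beta$: choose a free diassociative algebra $F$ and ideals $R\subseteq T$ with $L=F/R$,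 $Z=T/R$, so $M(L)=\frac{R\cap F'}{F\lozenge R+R\lozenge F}$ and $M(L/Z)=\frac{T\cap F'}{F\lozenge T+T\lozenge F}$; $\beta$ is induced by the inclusion $R\cap F'\subseteq T\cap F'$. In statement 3 the isomorphism is of vector spaces, and $L'\cap Z$ is identified with the subspace of $M(L/Z)\cong\mathcal{H}^2(L/Z,\mathbb{F})$ that is the image of the transgression map $\mathrm{Tra}:\mathrm{Hom}(Z,\mathbb{F})\to\mathcal{H}^2(L/Z,\mathbb{F})$ (this image is isomorphic to $L'\cap Z$). Here, for a linear section $\mu$ of $L\to L/Z$, $\mathrm{Tra}(\chi)$ is the class of $(\chi\circ f_\dashv,\chi\circ f_\vdash)$ with $f_*(\bar x,\bar y)=\mu(\bar x)*\mu(\bar y)-\mu(\bar x*\bar y)$ for $*\in\{\dashv,\vdash\}$. $Z^*(L)$ is the intersection of all images $\omega(Z(E))$ over all central extensions $0\to\ker\omega\to E\xrightarrow{\omega}L\to0$ of $L$, i.e. short exact sequences of diassociative algebras with $\ker\omega\subseteq Z(E)$. *)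

theory Defs
  imports "HOL-Algebra.AbelCoset" "Jordan_Normal_Form.Missing_VectorSpace"
begin

section \<open>Diassociative algebras\<close>

text \<open>Vector spaces are the \<open>vectorspace K V\<close> of the entry VectorSpace, i.e. modules over a field
  in the sense of HOL-Algebra. The fields \<open>mult\<close> and \<open>one\<close>, which the record \<open>module\<close> inherits
  from \<open>ring\<close>, play no role anywhere below.\<close>

record ('k, 'a) dialgebra = "('k, 'a) module" +
  ldia :: "'a \<Rightarrow> 'a \<Rightarrow> 'a" (infixl \<open>\<stileturn>\<index>\<close> 70)
  rdia :: "'a \<Rightarrow> 'a \<Rightarrow> 'a" (infixl \<open>\<turnstile>\<index>\<close> 70)

definition bilinear_map ::
  "('k, 'r) ring_scheme \<Rightarrow> ('k, 'u, 'm) module_scheme \<Rightarrow> ('k, 'v, 'n) module_scheme \<Rightarrow>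
   ('k, 'w, 'p) module_scheme \<Rightarrow> ('u \<Rightarrow> 'v \<Rightarrow> 'w) \<Rightarrow> bool" where
  "bilinear_map K U V W b \<longleftrightarrow>
     (\<forall>x\<in>carrier U. b x \<in> module_hom K V W) \<and>
     (\<forall>y\<in>carrier V. (\<lambda>x. b x y) \<in> module_hom K U W)"

locale diassociative_algebra = vectorspace K L
  for K and L :: "('k, 'a, 'l) dialgebra_scheme" (structure) +
  assumes ldia_bilinear: "bilinear_map K L L L (\<lambda>x y. x \<stileturn> y)"
    and rdia_bilinear: "bilinear_map K L L L (\<lambda>x y. x \<turnstile> y)"
    and ldia_assoc: "\<lbrakk>x \<in> carrier L; y \<in> carrier L; z \<in> carrier L\<rbrakk>
      \<Longrightarrow> (x \<stileturn> y) \<stileturn> z = x \<stileturn> (y \<stileturn> z)"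
    and rdia_assoc: "\<lbrakk>x \<in> carrier L; y \<in> carrier L; z \<in> carrier L\<rbrakk>
      \<Longrightarrow> (x \<turnstile> y) \<turnstile> z = x \<turnstile> (y \<turnstile> z)"
    and ldia_ldia_rdia: "\<lbrakk>x \<in> carrier L; y \<in> carrier L; z \<in> carrier L\<rbrakk>
      \<Longrightarrow> x \<stileturn> (y \<stileturn> z) = x \<stileturn> (y \<turnstile> z)"
    and rdia_ldia: "\<lbrakk>x \<in> carrier L; y \<in> carrier L; z \<in> carrier L\<rbrakk>
      \<Longrightarrow> (x \<turnstile> y) \<stileturn> z = x \<turnstile> (y \<stileturn> z)"
    and ldia_rdia_rdia: "\<lbrakk>x \<in> carrier L; y \<in> carrier L; z \<in> carrier L\<rbrakk>
      \<Longrightarrow> (x \<stileturn> y) \<turnstile> z = (x \<turnstile> y) \<turnstile> z"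

definition dia_hom ::
  "('k, 'r) ring_scheme \<Rightarrow> ('k, 'a, 'l) dialgebra_scheme \<Rightarrow> ('k, 'b, 'm) dialgebra_scheme \<Rightarrow>
   ('a \<Rightarrow> 'b) \<Rightarrow> bool" where
  "dia_hom K A B h \<longleftrightarrow> linear_map K A B h \<and>
     (\<forall>x\<in>carrier A. \<forall>y\<in>carrier A.
        h (x \<stileturn>\<^bsub>A\<^esub> y) = h x \<stileturn>\<^bsub>B\<^esub> h y \<and> h (x \<turnstile>\<^bsub>A\<^esub> y) = h x \<turnstile>\<^bsub>B\<^esub> h y)"

definition lozenge ::
  "('k, 'r) ring_scheme \<Rightarrow> ('k, 'a, 'l) dialgebra_scheme \<Rightarrow> 'a set \<Rightarrow> 'a set \<Rightarrow> 'a set" where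
  "lozenge K L X Y =
     set_add L (module.span K L {x \<stileturn>\<^bsub>L\<^esub> y | x y. x \<in> X \<and> y \<in> Y})
               (module.span K L {x \<turnstile>\<^bsub>L\<^esub> y | x y. x \<in> X \<and> y \<in> Y})"

definition derived_ideal :: "('k, 'r) ring_scheme \<Rightarrow> ('k, 'a, 'l) dialgebra_scheme \<Rightarrow> 'a set" where
  "derived_ideal K L = lozenge K L (carrier L) (carrier L)"

definition center :: "('k, 'a, 'l) dialgebra_scheme \<Rightarrow> 'a set" where
  "center L = {z \<in> carrier L. \<forall>x\<in>carrier L.
     z \<stileturn>\<^bsub>L\<^esub> x = \<zero>\<^bsub>L\<^esub> \<and> x \<stileturn>\<^bsub>L\<^esub> z = \<zero>\<^bsub>L\<^esub> \<and> z \<turnstile>\<^bsub>L\<^esub> x = \<zero>\<^bsub>L\<^esub> \<and> x \<turnstile>\<^bsub>L\<^esub> z = \<zero>\<^bsub>L\<^esub>}"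

definition dia_ideal ::
  "('k, 'r) ring_scheme \<Rightarrow> ('k, 'a, 'l) dialgebra_scheme \<Rightarrow> 'a set \<Rightarrow> bool" where
  "dia_ideal K L I \<longleftrightarrow> subspace K I L \<and>
     (\<forall>x\<in>carrier L. \<forall>a\<in>I.
        x \<stileturn>\<^bsub>L\<^esub> a \<in> I \<and> a \<stileturn>\<^bsub>L\<^esub> x \<in> I \<and> x \<turnstile>\<^bsub>L\<^esub> a \<in> I \<and> a \<turnstile>\<^bsub>L\<^esub> x \<in> I)"

definition central_ideal ::
  "('k, 'r) ring_scheme \<Rightarrow> ('k, 'a, 'l) dialgebra_scheme \<Rightarrow> 'a set \<Rightarrow> bool" where
  "central_ideal K L I \<longleftrightarrow> dia_ideal K L I \<and> I \<subseteq> center L"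


section \<open>Quotients, linear and bilinear forms\<close>

text \<open>Elements of quotients are cosets, and operations are defined by the union of the cosets
  obtained from all representatives, as \<open>rcoset_mult\<close> does for quotient rings.\<close>

definition quot_space :: "('k, 'v, 'm) module_scheme \<Rightarrow> 'v set \<Rightarrow> ('k, 'v set) module" where
  "quot_space V W =
     \<lparr>carrier = a_rcosets\<^bsub>V\<^esub> W, mult = (\<lambda>_ _. W), one = W, zero = W, add = set_add V,
      smult = (\<lambda>c C. \<Union>x\<in>C. W +>\<^bsub>V\<^esub> (c \<odot>\<^bsub>V\<^esub> x))\<rparr>"

definition quot_dia :: "('k, 'a, 'l) dialgebra_scheme \<Rightarrow> 'a set \<Rightarrow> ('k, 'a set) dialgebra" where
  "quot_dia L I =
     \<lparr>carrier = a_rcosets\<^bsub>L\<^esub> I, mult = (\<lambda>_ _. I), one = I, zero = I, add = set_add L,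
      smult = (\<lambda>c C. \<Union>x\<in>C. I +>\<^bsub>L\<^esub> (c \<odot>\<^bsub>L\<^esub> x)),
      ldia = (\<lambda>C D. \<Union>x\<in>C. \<Union>y\<in>D. I +>\<^bsub>L\<^esub> (x \<stileturn>\<^bsub>L\<^esub> y)),
      rdia = (\<lambda>C D. \<Union>x\<in>C. \<Union>y\<in>D. I +>\<^bsub>L\<^esub> (x \<turnstile>\<^bsub>L\<^esub> y))\<rparr>"

definition vs_isomorphic ::
  "('k, 'r) ring_scheme \<Rightarrow> ('k, 'v, 'm) module_scheme \<Rightarrow> ('k, 'w, 'n) module_scheme \<Rightarrow> bool" where
  "vs_isomorphic K V W \<longleftrightarrow> (\<exists>f. linear_map K V W f \<and> bij_betw f (carrier V) (carrier W))"

definition self_space :: "('k, 'r) ring_scheme \<Rightarrow> ('k, 'k) module" where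
  "self_space K =
     \<lparr>carrier = carrier K, mult = mult K, one = one K, zero = zero K, add = add K, smult = mult K\<rparr>"

definition linear_forms :: "('k, 'r) ring_scheme \<Rightarrow> ('k, 'v, 'm) module_scheme \<Rightarrow> ('v \<Rightarrow> 'k) set" where
  "linear_forms K V = module_hom K V (self_space K)"

text \<open>Bilinear forms are extensional functions on \<open>carrier V \<times> carrier W\<close>, so that equal forms
  are equal functions.\<close>

definition bil_space ::
  "('k, 'r) ring_scheme \<Rightarrow> ('k, 'v, 'm) module_scheme \<Rightarrow> ('k, 'w, 'n) module_scheme \<Rightarrow>
   ('k, 'v \<times> 'w \<Rightarrow> 'k) module" where
  "bil_space K V W = (ring.func_space K (carrier V \<times> carrier W))
     \<lparr>carrier := {f \<in> carrier V \<times> carrier W \<rightarrow>\<^sub>E carrier K.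
        bilinear_map K V W (self_space K) (\<lambda>x y. f (x, y))}\<rparr>"


section \<open>Second cohomology with coefficients in the field\<close>

definition cocycles ::
  "('k, 'r) ring_scheme \<Rightarrow> ('k, 'a, 'l) dialgebra_scheme \<Rightarrow>
   (('a \<times> 'a \<Rightarrow> 'k) \<times> ('a \<times> 'a \<Rightarrow> 'k)) set" where
  "cocycles K L = {(fl, fr). fl \<in> carrier (bil_space K L L) \<and> fr \<in> carrier (bil_space K L L) \<and>
     (\<forall>i\<in>carrier L. \<forall>j\<in>carrier L. \<forall>k\<in>carrier L.
        fl (i, j \<stileturn>\<^bsub>L\<^esub> k) = fl (i, j \<turnstile>\<^bsub>L\<^esub> k) \<and>
        fl (i \<turnstile>\<^bsub>L\<^esub> j, k) = fr (i, j \<stileturn>\<^bsub>L\<^esub> k) \<and>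
        fr (i \<stileturn>\<^bsub>L\<^esub> j, k) = fr (i \<turnstile>\<^bsub>L\<^esub> j, k) \<and>
        fl (i, j \<stileturn>\<^bsub>L\<^esub> k) = fl (i \<stileturn>\<^bsub>L\<^esub> j, k) \<and>
        fr (i, j \<turnstile>\<^bsub>L\<^esub> k) = fr (i \<turnstile>\<^bsub>L\<^esub> j, k))}"

definition cocycle_space ::
  "('k, 'r) ring_scheme \<Rightarrow> ('k, 'a, 'l) dialgebra_scheme \<Rightarrow>
   ('k, ('a \<times> 'a \<Rightarrow> 'k) \<times> ('a \<times> 'a \<Rightarrow> 'k)) module" where
  "cocycle_space K L =
     (direct_sum (bil_space K L L) (bil_space K L L))\<lparr>carrier := cocycles K L\<rparr>"

definition coboundaries ::
  "('k, 'r) ring_scheme \<Rightarrow> ('k, 'a, 'l) dialgebra_scheme \<Rightarrow>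
   (('a \<times> 'a \<Rightarrow> 'k) \<times> ('a \<times> 'a \<Rightarrow> 'k)) set" where
  "coboundaries K L =
     {(\<lambda>(i, j)\<in>carrier L \<times> carrier L. \<ominus>\<^bsub>K\<^esub> e (i \<stileturn>\<^bsub>L\<^esub> j),
       \<lambda>(i, j)\<in>carrier L \<times> carrier L. \<ominus>\<^bsub>K\<^esub> e (i \<turnstile>\<^bsub>L\<^esub> j)) | e. e \<in> linear_forms K L}"

definition H2 ::
  "('k, 'r) ring_scheme \<Rightarrow> ('k, 'a, 'l) dialgebra_scheme \<Rightarrow>
   ('k, (('a \<times> 'a \<Rightarrow> 'k) \<times> ('a \<times> 'a \<Rightarrow> 'k)) set) module" where
  "H2 K L = quot_space (cocycle_space K L) (coboundaries K L)"

text \<open>The codomain of \<open>\<delta>\<close>, ordered as \<open>((f\<^sub>\<stileturn>, g\<^sub>\<stileturn>), (f\<^sub>\<turnstile>, g\<^sub>\<turnstile>))\<close>.\<close>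

definition delta_codomain ::
  "('k, 'r) ring_scheme \<Rightarrow> ('k, 'a, 'l) dialgebra_scheme \<Rightarrow> 'a set \<Rightarrow>
   ('k, (('a set \<times> 'a \<Rightarrow> 'k) \<times> ('a \<times> 'a set \<Rightarrow> 'k)) \<times>
        (('a set \<times> 'a \<Rightarrow> 'k) \<times> ('a \<times> 'a set \<Rightarrow> 'k))) module" where
  "delta_codomain K L Z =
     (let A = quot_space L (derived_ideal K L);
          B = direct_sum (bil_space K A (L\<lparr>carrier := Z\<rparr>)) (bil_space K (L\<lparr>carrier := Z\<rparr>) A)
      in direct_sum B B)"

text \<open>The value at \<open>(x + L', z)\<close> is the common value of \<open>f (x, z)\<close> for all cocycles representing
  the cohomology class \<open>C\<close> and all representatives \<open>x\<close> of the coset \<open>P\<close>; similarly on the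
  other side.\<close>

definition delta ::
  "('k, 'r) ring_scheme \<Rightarrow> ('k, 'a, 'l) dialgebra_scheme \<Rightarrow> 'a set \<Rightarrow>
   (('a \<times> 'a \<Rightarrow> 'k) \<times> ('a \<times> 'a \<Rightarrow> 'k)) set \<Rightarrow>
   (('a set \<times> 'a \<Rightarrow> 'k) \<times> ('a \<times> 'a set \<Rightarrow> 'k)) \<times> (('a set \<times> 'a \<Rightarrow> 'k) \<times> ('a \<times> 'a set \<Rightarrow> 'k))" where
  "delta K L Z C =
     (let A = carrier (quot_space L (derived_ideal K L)) in
      ((\<lambda>(P, z)\<in>A \<times> Z. the_elem {fst c (x, z) | c x. c \<in> C \<and> x \<in> P},
        \<lambda>(z, P)\<in>Z \<times> A. the_elem {fst c (z, x) | c x. c \<in> C \<and> x \<in> P}),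
       (\<lambda>(P, z)\<in>A \<times> Z. the_elem {snd c (x, z) | c x. c \<in> C \<and> x \<in> P},
        \<lambda>(z, P)\<in>Z \<times> A. the_elem {snd c (z, x) | c x. c \<in> C \<and> x \<in> P})))"

definition linear_section ::
  "('k, 'r) ring_scheme \<Rightarrow> ('k, 'a, 'l) dialgebra_scheme \<Rightarrow> 'a set \<Rightarrow> ('a set \<Rightarrow> 'a) \<Rightarrow> bool" where
  "linear_section K L Z s \<longleftrightarrow>
     linear_map K (quot_dia L Z) L s \<and> (\<forall>C\<in>carrier (quot_dia L Z). s C \<in> C)"

definition transgression ::
  "('k, 'r) ring_scheme \<Rightarrow> ('k, 'a, 'l) dialgebra_scheme \<Rightarrow> 'a set \<Rightarrow> ('a set \<Rightarrow> 'a) \<Rightarrow>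
   ('a \<Rightarrow> 'k) \<Rightarrow> (('a set \<times> 'a set \<Rightarrow> 'k) \<times> ('a set \<times> 'a set \<Rightarrow> 'k)) set" where
  "transgression K L Z s \<chi> =
     (let Q = quot_dia L Z in
      coboundaries K Q +>\<^bsub>cocycle_space K Q\<^esub>
        (\<lambda>(P, P')\<in>carrier Q \<times> carrier Q. \<chi> ((s P \<stileturn>\<^bsub>L\<^esub> s P') \<ominus>\<^bsub>L\<^esub> s (P \<stileturn>\<^bsub>Q\<^esub> P')),
         \<lambda>(P, P')\<in>carrier Q \<times> carrier Q. \<chi> ((s P \<turnstile>\<^bsub>L\<^esub> s P') \<ominus>\<^bsub>L\<^esub> s (P \<turnstile>\<^bsub>Q\<^esub> P'))))"


section \<open>Free diassociative algebras and the multiplier\<close>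

text \<open>Loday's construction of the free diassociative algebra on a set \<open>X\<close>: a basis is given by the
  words over \<open>X\<close> with one distinguished letter, \<open>(u, x, v)\<close> standing for the word \<open>u x v\<close> with
  \<open>x\<close> distinguished. Both products concatenate words; \<open>\<stileturn>\<close> keeps the distinguished letter of
  the left factor and \<open>\<turnstile>\<close> that of the right factor. The generator \<open>x\<close> is \<open>([], x, [])\<close>.\<close>

type_synonym 'x dword = "'x list \<times> 'x \<times> 'x list"

definition dwords :: "'x set \<Rightarrow> 'x dword set" where
  "dwords X = lists X \<times> X \<times> lists X"

fun dword_l :: "'x dword \<Rightarrow> 'x dword \<Rightarrow> 'x dword" where
  "dword_l (u, x, v) (u', x', v') = (u, x, v @ u' @ x' # v')"

fun dword_r :: "'x dword \<Rightarrow> 'x dword \<Rightarrow> 'x dword" where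
  "dword_r (u, x, v) (u', x', v') = (u @ x # v @ u', x', v')"

definition support :: "('k, 'r) ring_scheme \<Rightarrow> ('w \<Rightarrow> 'k) \<Rightarrow> 'w set" where
  "support K f = {w. f w \<noteq> \<zero>\<^bsub>K\<^esub>}"

text \<open>The bilinear extension of a binary operation on basis elements.\<close>

definition convolution ::
  "('k, 'r) ring_scheme \<Rightarrow> ('w \<Rightarrow> 'w \<Rightarrow> 'w) \<Rightarrow> ('w \<Rightarrow> 'k) \<Rightarrow> ('w \<Rightarrow> 'k) \<Rightarrow> 'w \<Rightarrow> 'k" where
  "convolution K m f g w =
     finsum K (\<lambda>(p, q). f p \<otimes>\<^bsub>K\<^esub> g q) {(p, q) \<in> support K f \<times> support K g. m p q = w}"

definition free_dia :: "('k, 'r) ring_scheme \<Rightarrow> 'x set \<Rightarrow> ('k, 'x dword \<Rightarrow> 'k) dialgebra" where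
  "free_dia K X =
     \<lparr>carrier = {f. range f \<subseteq> carrier K \<and> finite (support K f) \<and> support K f \<subseteq> dwords X},
      mult = (\<lambda>_ _ _. \<zero>\<^bsub>K\<^esub>), one = (\<lambda>_. \<zero>\<^bsub>K\<^esub>), zero = (\<lambda>_. \<zero>\<^bsub>K\<^esub>),
      add = (\<lambda>f g w. f w \<oplus>\<^bsub>K\<^esub> g w), smult = (\<lambda>c f w. c \<otimes>\<^bsub>K\<^esub> f w),
      ldia = convolution K dword_l, rdia = convolution K dword_r\<rparr>"

definition free_presentation ::
  "('k, 'r) ring_scheme \<Rightarrow> 'x set \<Rightarrow> ('k, 'a, 'l) dialgebra_scheme \<Rightarrow>
   (('x dword \<Rightarrow> 'k) \<Rightarrow> 'a) \<Rightarrow> bool" where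
  "free_presentation K X L p \<longleftrightarrow>
     dia_hom K (free_dia K X) L p \<and> p ` carrier (free_dia K X) = carrier L"

definition commutator_part ::
  "('k, 'r) ring_scheme \<Rightarrow> ('k, 'f, 'm) dialgebra_scheme \<Rightarrow> 'f set \<Rightarrow> 'f set" where
  "commutator_part K F R = set_add F (lozenge K F (carrier F) R) (lozenge K F R (carrier F))"

definition multiplier ::
  "('k, 'r) ring_scheme \<Rightarrow> ('k, 'f, 'm) dialgebra_scheme \<Rightarrow> 'f set \<Rightarrow> ('k, 'f set) module" where
  "multiplier K F R = quot_space (F\<lparr>carrier := derived_ideal K F \<inter> R\<rparr>) (commutator_part K F R)"

text \<open>\<open>beta K F T\<close> sends the class of \<open>x \<in> R \<inter> F'\<close> modulo \<open>F \<lozenge> R + R \<lozenge> F\<close> to its class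
  modulo \<open>F \<lozenge> T + T \<lozenge> F\<close>.\<close>

definition beta ::
  "('k, 'r) ring_scheme \<Rightarrow> ('k, 'f, 'm) dialgebra_scheme \<Rightarrow> 'f set \<Rightarrow> 'f set \<Rightarrow> 'f set" where
  "beta K F T C = (\<Union>x\<in>C. commutator_part K F T +>\<^bsub>F\<^esub> x)"


section \<open>Central extensions\<close>

definition central_extension ::
  "('k, 'r) ring_scheme \<Rightarrow> ('k, 'e, 'm) dialgebra_scheme \<Rightarrow> ('e \<Rightarrow> 'a) \<Rightarrow>
   ('k, 'a, 'l) dialgebra_scheme \<Rightarrow> bool" where
  "central_extension K E w L \<longleftrightarrow> diassociative_algebra K E \<and> dia_hom K E L w \<and>
     w ` carrier E = carrier L \<and> a_kernel E L w \<subseteq> center E"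

text \<open>\<open>Z\<^sup>*(L)\<close>, intersecting over the central extensions of \<open>L\<close> whose elements have type
  \<open>'e\<close>. HOL cannot quantify over \<open>'e\<close> inside a formula. By the lemma below, enlarging the type
  only adds extensions. All extensions of interest are therefore covered by
  \<open>Zstar TYPE((nat \<Rightarrow> 'k) + 'e)\<close> with \<open>'e\<close> arbitrary: it accounts for every central extension on
  \<open>'e\<close>, and the left summand makes sure that the type has room for the extensions of countable
  dimension however small \<open>'e\<close> is.\<close>

definition Zstar ::
  "'e itself \<Rightarrow> ('k, 'r) ring_scheme \<Rightarrow> ('k, 'a, 'l) dialgebra_scheme \<Rightarrow> 'a set" where
  "Zstar _ K L = {z \<in> carrier L. \<forall>(E :: ('k, 'e) dialgebra) w.
     central_extension K E w L \<longrightarrow> z \<in> w ` center E}"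

lemma Zstar_antimono:
  fixes K :: "('k, 'r) ring_scheme" and L :: "('k, 'a, 'l) dialgebra_scheme" and h :: "'e \<Rightarrow> 'u"
  assumes h: "inj h"
  shows "Zstar TYPE('u) K L \<subseteq> Zstar TYPE('e) K L"
proof
  fix z assume z: "z \<in> Zstar TYPE('u) K L"
  have "z \<in> w ` center E" if ext: "central_extension K E w L" for E :: "('k, 'e) dialgebra" and w
  proof -
    define g where "g = inv_into UNIV h"
    have gh [simp]: "g (h x) = x" for x
      by (simp add: g_def h)
    define E' :: "('k, 'u) dialgebra" where "E' =
      \<lparr>carrier = h ` carrier E, mult = (\<lambda>_ _. h \<zero>\<^bsub>E\<^esub>), one = h \<zero>\<^bsub>E\<^esub>, zero = h \<zero>\<^bsub>E\<^esub>,
       add = (\<lambda>a b. h (g a \<oplus>\<^bsub>E\<^esub> g b)), smult = (\<lambda>c a. h (c \<odot>\<^bsub>E\<^esub> g a)),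
       ldia = (\<lambda>a b. h (g a \<stileturn>\<^bsub>E\<^esub> g b)), rdia = (\<lambda>a b. h (g a \<turnstile>\<^bsub>E\<^esub> g b))\<rparr>"
    have E: "diassociative_algebra K E" and w: "dia_hom K E L w" and surj: "w ` carrier E = carrier L"
      and ker: "a_kernel E L w \<subseteq> center E"
      using ext by (auto simp: central_extension_def)
    interpret E: diassociative_algebra K E by (fact E)
    interpret w: linear_map K E L w using w by (simp add: dia_hom_def)
    have dia_closed: "x \<stileturn>\<^bsub>E\<^esub> y \<in> carrier E" "x \<turnstile>\<^bsub>E\<^esub> y \<in> carrier E"
      if "x \<in> carrier E" "y \<in> carrier E" for x y
      using E.ldia_bilinear E.rdia_bilinear that
      by (auto simp: bilinear_map_def module_hom_def Pi_iff)
    have "abelian_group E'"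
    proof (rule abelian_groupI, goal_cases)
      case (6 x)
      then obtain a where "a \<in> carrier E" "x = h a" by (auto simp: E'_def)
      then show ?case
        by (intro bexI[of _ "h (\<ominus>\<^bsub>E\<^esub> a)"]) (auto simp: E'_def E.M.l_neg)
    qed (auto simp: E'_def E.M.a_ac)
    then have "module K E'"
      by (intro moduleI)
        (auto simp: E'_def E.R.is_cring E.smult_l_distr E.smult_r_distr E.smult_assoc1)
    then have vs: "vectorspace K E'"
      by (simp add: vectorspace_def E.field_axioms)
    have E': "diassociative_algebra K E'"
    proof (intro diassociative_algebra.intro vs diassociative_algebra_axioms.intro)
      show "bilinear_map K E' E' E' (\<lambda>x y. x \<stileturn>\<^bsub>E'\<^esub> y)"
        using E.ldia_bilinear by (auto simp: E'_def bilinear_map_def module_hom_def dia_closed)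
      show "bilinear_map K E' E' E' (\<lambda>x y. x \<turnstile>\<^bsub>E'\<^esub> y)"
        using E.rdia_bilinear by (auto simp: E'_def bilinear_map_def module_hom_def dia_closed)
    qed (auto simp: E'_def dia_closed E.ldia_assoc E.rdia_assoc E.ldia_ldia_rdia E.rdia_ldia
           E.ldia_rdia_rdia)
    have w': "dia_hom K E' L (w \<circ> g)"
      using w vs w.W.vectorspace_axioms
      by (auto simp: dia_hom_def linear_map_def mod_hom_def mod_hom_axioms_def module_hom_def
            vectorspace_def E'_def Pi_iff)
    have cen: "center E' = h ` center E"
      using h by (auto simp: center_def E'_def inj_eq)
    have "central_extension K E' (w \<circ> g) L"
      unfolding central_extension_def cen
      using E' w' surj ker by (auto simp: E'_def a_kernel_def kernel_def image_image)
    then have "z \<in> (w \<circ> g) ` center E'"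
      using z unfolding Zstar_def by blast
    then show ?thesis
      by (auto simp: cen)
  qed
  then show "z \<in> Zstar TYPE('e) K L"
    using z by (auto simp: Zstar_def)
qed

end

theory Submission
  imports Defs
begin

text \<open>A linear form \<open>\<phi>\<close> on the free algebra \<open>F\<close> that vanishes on \<open>[F, R] = F \<lozenge> R + R \<lozenge> F\<close> is the same
  thing, up to its values outside \<open>F'\<close>, as a cocycle \<open>c\<close> of \<open>L = F/R\<close>: the correspondence is
  \<open>\<phi> (a * b) = c (p a, p b)\<close>, and the cocycle gives back \<open>\<phi>\<close> by lifting \<open>p\<close> to the extension of \<open>L\<close> by
  the field that \<open>c\<close> defines. Since linear forms separate points, statements 1 and 2 both say that
  \<open>[F, T] \<subseteq> [F, R]\<close>.

  If this inclusion holds, then a lift of \<open>p\<close> to any central extension of \<open>L\<close> sends \<open>T\<close> into the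
  center, which is statement 4. Conversely, statement 4 for the extension defined by a cocycle
  \<open>c\<close> says that \<open>c\<close> vanishes on \<open>L \<times> Z\<close> and \<open>Z \<times> L\<close>, which is statement 1.

  For statement 3, evaluation \<open>\<langle>c, m\<rangle> = \<phi> m\<close> of the forms belonging to the cocycles \<open>c\<close> of \<open>L/Z = F/T\<close>
  is a pairing between these cocycles and \<open>F' \<inter> R\<close>. Its left kernel is the preimage of the image of the
  transgression, its right kernel is \<open>[F, T]\<close>. The quotient of \<open>H\<^sup>2(L/Z)\<close> in statement 3 is therefore
  dual to \<open>(F' \<inter> R)/[F, T]\<close>, and by finite dimension it is isomorphic to \<open>M(L) = (F' \<inter> R)/[F, R]\<close> if and
  only if \<open>[F, T] = [F, R]\<close>.\<close>

section \<open>Linear algebra\<close>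

text \<open>The free algebra F and its ideals may have infinite dimension, so nothing is argued
  through bases of F: linear forms on F come from Zorn's lemma, and finite dimension enters only
  through L. A cocycle of L is determined by its values on a finite spanning set of L, so finitely
  many forms decide membership in [F, R] inside F', and M(L) has finite dimension. Statement 3 is
  the delicate one. It asserts an abstract isomorphism, not the bijectivity of a given map, so it
  can be exploited only by counting dimensions. Centrality of Z gives [F, T] \<subseteq> F' \<inter>
  R. Hence [F, T] / [F, R] is a subspace of M(L), and each of the four statements says that it
  vanishes. For statement 4 the size of types matters: the extension defined by a cocycle lives on
  pairs from L and the field, and its carrier must fit into
  \<open>(nat \<Rightarrow> 'k) + 'e\<close>. It does, because a finite-dimensional L can be encoded
  by coordinates.\<close>

lemma subspaceI:
  assumes "vectorspace K V" "W \<subseteq> carrier V" "\<zero>\<^bsub>V\<^esub> \<in> W"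
    and "\<And>v w. v \<in> W \<Longrightarrow> w \<in> W \<Longrightarrow> v \<oplus>\<^bsub>V\<^esub> w \<in> W"
    and "\<And>c v. c \<in> carrier K \<Longrightarrow> v \<in> W \<Longrightarrow> c \<odot>\<^bsub>V\<^esub> v \<in> W"
  shows "subspace K W V"
  using assms by (simp add: subspace_def submodule_def vectorspace_def)

lemma subspaceD:
  assumes "subspace K W V"
  shows "vectorspace K V" "W \<subseteq> carrier V" "\<zero>\<^bsub>V\<^esub> \<in> W"
    and "\<And>v w. v \<in> W \<Longrightarrow> w \<in> W \<Longrightarrow> v \<oplus>\<^bsub>V\<^esub> w \<in> W"
    and "\<And>c v. c \<in> carrier K \<Longrightarrow> v \<in> W \<Longrightarrow> c \<odot>\<^bsub>V\<^esub> v \<in> W"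
  using assms by (auto simp: subspace_def submodule_def vectorspace_def)

lemma (in vectorspace) subspace_minus_closed:
  assumes W: "subspace K W V" and "v \<in> W" "w \<in> W"
  shows "\<ominus>\<^bsub>V\<^esub> v \<in> W" "v \<ominus>\<^bsub>V\<^esub> w \<in> W"
proof -
  have *: "\<ominus>\<^bsub>V\<^esub> v \<in> W" if "v \<in> W" for v
    using subspaceD(5)[OF W, of "\<ominus>\<^bsub>K\<^esub> \<one>\<^bsub>K\<^esub>" v] subspaceD(2)[OF W] that
    by (auto simp: smult_minus_1)
  show "\<ominus>\<^bsub>V\<^esub> v \<in> W" "v \<ominus>\<^bsub>V\<^esub> w \<in> W"
    using assms * subspaceD(4)[OF W] by (auto simp: a_minus_def)
qed

lemma linear_mapI:
  assumes "vectorspace K V" "vectorspace K W" "f \<in> module_hom K V W"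
  shows "linear_map K V W f"
  using assms
  by (simp add: linear_map_def mod_hom_def mod_hom_axioms_def vectorspace_def)

lemma self_space_vectorspace:
  assumes "field K"
  shows "vectorspace K (self_space K)"
proof -
  interpret field K by fact
  show ?thesis
  proof (rule vs_criteria)
    show "\<forall>v\<in>carrier (self_space K). \<exists>neg_v\<in>carrier (self_space K).
      v \<oplus>\<^bsub>self_space K\<^esub> neg_v = \<zero>\<^bsub>self_space K\<^esub>"
    proof
      fix v assume "v \<in> carrier (self_space K)"
      then show "\<exists>neg_v\<in>carrier (self_space K). v \<oplus>\<^bsub>self_space K\<^esub> neg_v = \<zero>\<^bsub>self_space K\<^esub>"
        by (intro bexI[of _ "\<ominus>\<^bsub>K\<^esub> v"]) (simp_all add: self_space_def r_neg)
    qed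
  qed (use assms in \<open>simp_all add: self_space_def a_ac m_assoc l_distr r_distr\<close>)
qed

text \<open>Only the carrier, addition and scalar multiplication occur, and no vector space axiom is
  assumed. The criterion therefore applies to restricted records such as
  \<open>V\<lparr>carrier := U\<rparr>\<close>, the form in which subspaces appear here.\<close>

lemma linear_forms_iff:
  "f \<in> linear_forms K V \<longleftrightarrow> f \<in> carrier V \<rightarrow> carrier K \<and>
     (\<forall>x\<in>carrier V. \<forall>y\<in>carrier V. f (x \<oplus>\<^bsub>V\<^esub> y) = f x \<oplus>\<^bsub>K\<^esub> f y) \<and>
     (\<forall>c\<in>carrier K. \<forall>x\<in>carrier V. f (c \<odot>\<^bsub>V\<^esub> x) = c \<otimes>\<^bsub>K\<^esub> f x)"
  by (auto simp: linear_forms_def module_hom_def self_space_def)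

lemma (in vectorspace) linear_form_simps:
  assumes "f \<in> linear_forms K V"
  shows "x \<in> carrier V \<Longrightarrow> f x \<in> carrier K"
    and "x \<in> carrier V \<Longrightarrow> y \<in> carrier V \<Longrightarrow> f (x \<oplus>\<^bsub>V\<^esub> y) = f x \<oplus>\<^bsub>K\<^esub> f y"
    and "c \<in> carrier K \<Longrightarrow> x \<in> carrier V \<Longrightarrow> f (c \<odot>\<^bsub>V\<^esub> x) = c \<otimes>\<^bsub>K\<^esub> f x"
    and "f \<zero>\<^bsub>V\<^esub> = \<zero>\<^bsub>K\<^esub>"
    and "x \<in> carrier V \<Longrightarrow> f (\<ominus>\<^bsub>V\<^esub> x) = \<ominus>\<^bsub>K\<^esub> f x"
    and "x \<in> carrier V \<Longrightarrow> y \<in> carrier V \<Longrightarrow> f (x \<ominus>\<^bsub>V\<^esub> y) = f x \<ominus>\<^bsub>K\<^esub> f y"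
proof -
  show 1: "x \<in> carrier V \<Longrightarrow> f x \<in> carrier K" for x
    using assms by (auto simp: linear_forms_iff)
  show 2: "x \<in> carrier V \<Longrightarrow> y \<in> carrier V \<Longrightarrow> f (x \<oplus>\<^bsub>V\<^esub> y) = f x \<oplus>\<^bsub>K\<^esub> f y" for x y
    using assms by (auto simp: linear_forms_iff)
  show 3: "c \<in> carrier K \<Longrightarrow> x \<in> carrier V \<Longrightarrow> f (c \<odot>\<^bsub>V\<^esub> x) = c \<otimes>\<^bsub>K\<^esub> f x" for c x
    using assms by (auto simp: linear_forms_iff)
  show "f \<zero>\<^bsub>V\<^esub> = \<zero>\<^bsub>K\<^esub>"
    using 3[of "\<zero>\<^bsub>K\<^esub>" "\<zero>\<^bsub>V\<^esub>"] 1[of "\<zero>\<^bsub>V\<^esub>"] by simp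
  show 5: "f (\<ominus>\<^bsub>V\<^esub> x) = \<ominus>\<^bsub>K\<^esub> f x" if "x \<in> carrier V" for x
    using 3[of "\<ominus>\<^bsub>K\<^esub> \<one>\<^bsub>K\<^esub>" x] 1[of x] that by (simp add: smult_minus_1 R.l_minus)
  show "x \<in> carrier V \<Longrightarrow> y \<in> carrier V \<Longrightarrow> f (x \<ominus>\<^bsub>V\<^esub> y) = f x \<ominus>\<^bsub>K\<^esub> f y"
    using 2 5 by (simp add: a_minus_def)
qed

text \<open>Every element of Q has the form \<open>q x\<close>, so each axiom pulls back to the same
  axiom of V. Injectivity of \<open>q\<close> is not assumed: one argument covers quotients and,
  with \<open>q\<close> the identity, a new record on an old carrier.\<close>

lemma linear_map_image_structure:
  assumes V: "vectorspace K V" and carrier: "carrier Q = q ` carrier V"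
    and add: "\<And>x y. x \<in> carrier V \<Longrightarrow> y \<in> carrier V \<Longrightarrow> q x \<oplus>\<^bsub>Q\<^esub> q y = q (x \<oplus>\<^bsub>V\<^esub> y)"
    and smult: "\<And>c x. c \<in> carrier K \<Longrightarrow> x \<in> carrier V \<Longrightarrow> c \<odot>\<^bsub>Q\<^esub> q x = q (c \<odot>\<^bsub>V\<^esub> x)"
    and zero: "\<zero>\<^bsub>Q\<^esub> = q \<zero>\<^bsub>V\<^esub>"
  shows "linear_map K V Q q"
proof -
  interpret vectorspace K V by fact
  have "vectorspace K Q"
  proof (rule vs_criteria)
    show "\<forall>v\<in>carrier Q. \<exists>neg_v\<in>carrier Q. v \<oplus>\<^bsub>Q\<^esub> neg_v = \<zero>\<^bsub>Q\<^esub>"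
      unfolding carrier
    proof clarify
      fix x assume "x \<in> carrier V"
      then show "\<exists>neg_v\<in>q ` carrier V. q x \<oplus>\<^bsub>Q\<^esub> neg_v = \<zero>\<^bsub>Q\<^esub>"
        by (intro bexI[of _ "q (\<ominus>\<^bsub>V\<^esub> x)"]) (auto simp: add zero M.r_neg)
    qed
  qed (auto simp: field_axioms carrier add smult zero M.a_ac smult_assoc1 smult_l_distr smult_r_distr)
  then show ?thesis
    by (intro linear_mapI V) (auto simp: module_hom_def carrier add smult)
qed

section \<open>Cosets, quotient spaces and the extension of linear forms\<close>

context vectorspace
begin

context
  fixes W assumes W: "subspace K W V"
begin

interpretation W: abelian_subgroup W V
  using W by (intro abelian_subgroupI3 additive_subgroup.intro M.abelian_group_axioms)
    (auto intro!: group.subgroupI[OF M.a_group] simp: subspaceD[OF W] subspace_minus_closed[OF W]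
      subspaceD(2)[OF W, THEN subsetD] simp flip: a_inv_def dest: subspaceD(3))

lemma coset_self: "x \<in> carrier V \<Longrightarrow> x \<in> W +>\<^bsub>V\<^esub> x"
  by (rule W.a_rcos_self)

lemma coset_mem_iff:
  assumes x: "x \<in> carrier V"
  shows "y \<in> W +>\<^bsub>V\<^esub> x \<longleftrightarrow> y \<in> carrier V \<and> y \<ominus>\<^bsub>V\<^esub> x \<in> W"
proof
  assume "y \<in> W +>\<^bsub>V\<^esub> x"
  then show "y \<in> carrier V \<and> y \<ominus>\<^bsub>V\<^esub> x \<in> W"
    using x subspaceD(2)[OF W] by (auto simp: a_r_coset_def' a_minus_def M.a_assoc M.r_neg subset_iff)
next
  assume "y \<in> carrier V \<and> y \<ominus>\<^bsub>V\<^esub> x \<in> W"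
  then show "y \<in> W +>\<^bsub>V\<^esub> x"
    using x by (auto simp: a_r_coset_def' a_minus_def M.a_assoc M.l_neg intro!: bexI[of _ "y \<ominus>\<^bsub>V\<^esub> x"])
qed

lemma coset_eq_iff:
  assumes x: "x \<in> carrier V" and y: "y \<in> carrier V"
  shows "W +>\<^bsub>V\<^esub> x = W +>\<^bsub>V\<^esub> y \<longleftrightarrow> x \<ominus>\<^bsub>V\<^esub> y \<in> W"
  using W.a_repr_independence'[of x y] coset_self[OF x] assms by (auto simp: coset_mem_iff)

text \<open>Operations on quotients are defined as unions over all representatives. Such a union
  collapses to one value once that value is independent of the representative; the quotient
  operations and \<open>beta\<close> are evaluated in this way.\<close>

lemma UN_coset:
  assumes "x \<in> carrier V" and "\<And>y. y \<in> carrier V \<Longrightarrow> y \<ominus>\<^bsub>V\<^esub> x \<in> W \<Longrightarrow> g y = g x"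
  shows "(\<Union>y\<in>W +>\<^bsub>V\<^esub> x. g y) = g x"
proof (rule SUP_eq_const)
  show "W +>\<^bsub>V\<^esub> x \<noteq> {}" using coset_self[OF assms(1)] by blast
  show "g y = g x" if "y \<in> W +>\<^bsub>V\<^esub> x" for y
    using that assms(2)[of y] coset_mem_iff[OF assms(1)] by blast
qed

lemma quot_space_linear_map: "linear_map K V (quot_space V W) (\<lambda>x. W +>\<^bsub>V\<^esub> x)"
proof (rule linear_map_image_structure)
  show "c \<odot>\<^bsub>quot_space V W\<^esub> (W +>\<^bsub>V\<^esub> x) = W +>\<^bsub>V\<^esub> (c \<odot>\<^bsub>V\<^esub> x)"
    if c: "c \<in> carrier K" and x: "x \<in> carrier V" for c x
  proof -
    have "c \<odot>\<^bsub>V\<^esub> y \<ominus>\<^bsub>V\<^esub> c \<odot>\<^bsub>V\<^esub> x \<in> W" if "y \<in> carrier V" "y \<ominus>\<^bsub>V\<^esub> x \<in> W" for y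
      using subspaceD(5)[OF W c that(2)] c x that
      by (simp add: a_minus_def smult_r_distr smult_r_minus)
    then show ?thesis
      using c x by (simp add: quot_space_def UN_coset coset_eq_iff)
  qed
qed (use subspaceD(2)[OF W] in \<open>auto simp: vectorspace_axioms quot_space_def A_RCOSETS_def' W.a_rcos_sum M.a_coset_add_zero\<close>)

lemma quot_space_surj: "(\<lambda>x. W +>\<^bsub>V\<^esub> x) ` carrier V = carrier (quot_space V W)"
  by (auto simp: quot_space_def A_RCOSETS_def')

lemma quot_space_zero_iff:
  assumes "x \<in> carrier V"
  shows "W +>\<^bsub>V\<^esub> x = \<zero>\<^bsub>quot_space V W\<^esub> \<longleftrightarrow> x \<in> W"
proof -
  have "\<ominus>\<^bsub>V\<^esub> \<zero>\<^bsub>V\<^esub> = \<zero>\<^bsub>V\<^esub>" using M.r_neg[of "\<zero>\<^bsub>V\<^esub>"] by simp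
  then show ?thesis
  using coset_eq_iff[OF assms, of "\<zero>\<^bsub>V\<^esub>"] assms subspaceD(2)[OF W]
  by (simp add: quot_space_def a_minus_def M.a_coset_add_zero \<open>\<ominus>\<^bsub>V\<^esub> \<zero>\<^bsub>V\<^esub> = \<zero>\<^bsub>V\<^esub>\<close>)
qed

end

text \<open>Values are prescribed on U and on W at once, and the assumption on U \<inter> W is the
  compatibility condition. Instead of the domain of \<open>f\<close>, the future kernel is enlarged:
  once V = M + U with \<open>f\<close> zero on U \<inter> M, the form \<open>g (m + u) = f u\<close>
  is the one wanted. No dimension is bounded, since V will be a free algebra.\<close>

lemma linear_form_extension:
  assumes U: "subspace K U V" and W: "subspace K W V"
    and f: "f \<in> linear_forms K (V\<lparr>carrier := U\<rparr>)" and 0: "\<And>x. x \<in> U \<Longrightarrow> x \<in> W \<Longrightarrow> f x = \<zero>\<^bsub>K\<^esub>"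
  shows "\<exists>g\<in>linear_forms K V. (\<forall>x\<in>U. g x = f x) \<and> (\<forall>x\<in>W. g x = \<zero>\<^bsub>K\<^esub>)"
proof -
  have fD: "\<And>x. x \<in> U \<Longrightarrow> f x \<in> carrier K"
    "\<And>x y. x \<in> U \<Longrightarrow> y \<in> U \<Longrightarrow> f (x \<oplus>\<^bsub>V\<^esub> y) = f x \<oplus>\<^bsub>K\<^esub> f y"
    "\<And>c x. c \<in> carrier K \<Longrightarrow> x \<in> U \<Longrightarrow> f (c \<odot>\<^bsub>V\<^esub> x) = c \<otimes>\<^bsub>K\<^esub> f x"
    using f by (auto simp: linear_forms_iff)
  \<comment> \<open>A maximal \<open>M \<supseteq> W\<close> such that \<open>f\<close> vanishes on \<open>U \<inter> M\<close> satisfies \<open>M + U = V\<close>.\<close>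
  define \<A> where "\<A> = {M. subspace K M V \<and> W \<subseteq> M \<and> (\<forall>x\<in>U \<inter> M. f x = \<zero>\<^bsub>K\<^esub>)}"
  have "\<exists>M\<in>\<A>. \<forall>M'\<in>\<A>. M \<subseteq> M' \<longrightarrow> M' = M"
  proof (rule subset_Zorn_nonempty)
    show "\<A> \<noteq> {}" using W 0 by (auto simp: \<A>_def)
    fix C assume ne: "C \<noteq> {}" and C: "subset.chain \<A> C"
    have CA: "\<And>M. M \<in> C \<Longrightarrow> M \<in> \<A>" and cmp: "\<And>M N. M \<in> C \<Longrightarrow> N \<in> C \<Longrightarrow> M \<subseteq> N \<or> N \<subseteq> M"
      using C by (auto simp: subset_chain_def)
    have "subspace K (\<Union>C) V"
    proof (rule subspaceI[OF vectorspace_axioms])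
      show "\<Union>C \<subseteq> carrier V" using CA by (fastforce simp: \<A>_def dest: subspaceD(2))
      show "\<zero>\<^bsub>V\<^esub> \<in> \<Union>C" using CA ne by (fastforce simp: \<A>_def dest: subspaceD(3))
      show "v \<oplus>\<^bsub>V\<^esub> w \<in> \<Union>C" if vw: "v \<in> \<Union>C" "w \<in> \<Union>C" for v w
      proof -
        obtain M N where MN: "M \<in> C" "N \<in> C" "v \<in> M" "w \<in> N" using vw by auto
        then obtain P where "P \<in> C" "v \<in> P" "w \<in> P" using cmp[of M N] by auto
        then show ?thesis using CA[of P] by (auto simp: \<A>_def dest: subspaceD(4))
      qed
      show "c \<odot>\<^bsub>V\<^esub> v \<in> \<Union>C" if cv: "c \<in> carrier K" "v \<in> \<Union>C" for c v
      proof -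
        obtain M where M: "M \<in> C" "v \<in> M" using cv by auto
        then have "c \<odot>\<^bsub>V\<^esub> v \<in> M" using cv(1) CA[of M] by (auto simp: \<A>_def dest: subspaceD(5))
        then show ?thesis using M by auto
      qed
    qed
    then show "\<Union>C \<in> \<A>" using CA ne by (auto simp: \<A>_def)
  qed
  obtain M where M: "subspace K M V" "W \<subseteq> M" and M0: "\<And>x. x \<in> U \<Longrightarrow> x \<in> M \<Longrightarrow> f x = \<zero>\<^bsub>K\<^esub>"
    and max: "\<And>M'. subspace K M' V \<Longrightarrow> M \<subseteq> M' \<Longrightarrow> (\<And>x. x \<in> U \<Longrightarrow> x \<in> M' \<Longrightarrow> f x = \<zero>\<^bsub>K\<^esub>) \<Longrightarrow> M' = M"
  proof -
    obtain M where M: "M \<in> \<A>" "\<And>M'. M' \<in> \<A> \<Longrightarrow> M \<subseteq> M' \<Longrightarrow> M' = M"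
      using \<open>\<exists>M\<in>\<A>. \<forall>M'\<in>\<A>. M \<subseteq> M' \<longrightarrow> M' = M\<close> by blast
    show thesis
    proof (rule that[of M])
      show "M' = M" if "subspace K M' V" "M \<subseteq> M'" "\<And>x. x \<in> U \<Longrightarrow> x \<in> M' \<Longrightarrow> f x = \<zero>\<^bsub>K\<^esub>" for M'
        using M that by (auto simp: \<A>_def)
    qed (use M in \<open>auto simp: \<A>_def\<close>)
  qed
  note MV = subspaceD(2)[OF M(1), THEN subsetD] and UV = subspaceD(2)[OF U, THEN subsetD]
  have decomp: "\<exists>m\<in>M. \<exists>u\<in>U. x = m \<oplus>\<^bsub>V\<^esub> u" if x: "x \<in> carrier V" for x
  proof (cases "x \<in> M")
    case True
    then show ?thesis using subspaceD(3)[OF U] x by (intro bexI[of _ x] bexI[of _ "\<zero>\<^bsub>V\<^esub>"]) auto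
  next
    case False
    \<comment> \<open>\<open>M'\<close> is spanned by M and x. Being strictly larger than M, it must
      violate the vanishing condition, which yields a vector of U that involves x.\<close>
    define M' where "M' = {m \<oplus>\<^bsub>V\<^esub> c \<odot>\<^bsub>V\<^esub> x | m c. m \<in> M \<and> c \<in> carrier K}"
    have M'I: "m \<oplus>\<^bsub>V\<^esub> c \<odot>\<^bsub>V\<^esub> x \<in> M'" if "m \<in> M" "c \<in> carrier K" for m c
      using that by (auto simp: M'_def)
    have "subspace K M' V"
    proof (rule subspaceI[OF vectorspace_axioms])
      show "M' \<subseteq> carrier V" using x MV by (auto simp: M'_def)
      show "\<zero>\<^bsub>V\<^esub> \<in> M'"
        using M'I[of "\<zero>\<^bsub>V\<^esub>" "\<zero>\<^bsub>K\<^esub>"] x subspaceD(3)[OF M(1)] by simp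
      show "v \<oplus>\<^bsub>V\<^esub> w \<in> M'" if vw: "v \<in> M'" "w \<in> M'" for v w
      proof -
        obtain m c m' c' where *: "m \<in> M" "m' \<in> M" "c \<in> carrier K" "c' \<in> carrier K"
          "v = m \<oplus>\<^bsub>V\<^esub> c \<odot>\<^bsub>V\<^esub> x" "w = m' \<oplus>\<^bsub>V\<^esub> c' \<odot>\<^bsub>V\<^esub> x"
          using vw by (auto simp: M'_def)
        have "v \<oplus>\<^bsub>V\<^esub> w = (m \<oplus>\<^bsub>V\<^esub> m') \<oplus>\<^bsub>V\<^esub> (c \<oplus>\<^bsub>K\<^esub> c') \<odot>\<^bsub>V\<^esub> x"
          using * x MV by (simp add: smult_l_distr M.a_ac)
        then show ?thesis using * M'I subspaceD(4)[OF M(1)] by auto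
      qed
      show "d \<odot>\<^bsub>V\<^esub> v \<in> M'" if d: "d \<in> carrier K" and v: "v \<in> M'" for d v
      proof -
        obtain m c where *: "m \<in> M" "c \<in> carrier K" "v = m \<oplus>\<^bsub>V\<^esub> c \<odot>\<^bsub>V\<^esub> x"
          using v by (auto simp: M'_def)
        have "d \<odot>\<^bsub>V\<^esub> v = d \<odot>\<^bsub>V\<^esub> m \<oplus>\<^bsub>V\<^esub> (d \<otimes>\<^bsub>K\<^esub> c) \<odot>\<^bsub>V\<^esub> x"
          using * d x MV by (simp add: smult_r_distr smult_assoc1)
        then show ?thesis using * d M'I subspaceD(5)[OF M(1)] by auto
      qed
    qed
    moreover have "M \<subseteq> M'"
    proof
      fix m assume "m \<in> M"
      then show "m \<in> M'" using M'I[of m "\<zero>\<^bsub>K\<^esub>"] x MV by simp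
    qed
    moreover have "M' \<noteq> M"
      using M'I[of "\<zero>\<^bsub>V\<^esub>" "\<one>\<^bsub>K\<^esub>"] x subspaceD(3)[OF M(1)] False by (auto simp: smult_one)
    ultimately obtain u where u: "u \<in> U" "u \<in> M'" "f u \<noteq> \<zero>\<^bsub>K\<^esub>"
      using max by blast
    then obtain m c where mc: "m \<in> M" "c \<in> carrier K" "u = m \<oplus>\<^bsub>V\<^esub> c \<odot>\<^bsub>V\<^esub> x"
      by (auto simp: M'_def)
    \<comment> \<open>With c = 0 the vector u would lie in U \<inter> M, where \<open>f\<close>
      vanishes. So u = m + c x can be solved for x.\<close>
    have c0: "c \<noteq> \<zero>\<^bsub>K\<^esub>"
      using u mc M0 x MV by auto
    have "c \<odot>\<^bsub>V\<^esub> x = \<ominus>\<^bsub>V\<^esub> m \<oplus>\<^bsub>V\<^esub> u"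
      using mc x MV by (simp add: M.r_neg1 M.r_neg2)
    then have "x = inv\<^bsub>K\<^esub> c \<odot>\<^bsub>V\<^esub> (\<ominus>\<^bsub>V\<^esub> m \<oplus>\<^bsub>V\<^esub> u)"
      using mult_inverse[OF mc(2) x _ c0] by simp
    then have "x = inv\<^bsub>K\<^esub> c \<odot>\<^bsub>V\<^esub> (\<ominus>\<^bsub>V\<^esub> m) \<oplus>\<^bsub>V\<^esub> inv\<^bsub>K\<^esub> c \<odot>\<^bsub>V\<^esub> u"
      using c0 mc u MV UV by (simp add: smult_r_distr)
    moreover have "inv\<^bsub>K\<^esub> c \<in> carrier K" using c0 mc by simp
    ultimately show ?thesis
      using subspaceD(5)[OF M(1) _ subspace_minus_closed(1)[OF M(1) mc(1) mc(1)]]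
        subspaceD(5)[OF U _ u(1)] by blast
  qed
  \<comment> \<open>The chosen U-component is not unique, but two choices differ by an element of U
    \<inter> M, on which \<open>f\<close> is zero.\<close>
  define g where "g x = f (SOME u. u \<in> U \<and> (\<exists>m\<in>M. x = m \<oplus>\<^bsub>V\<^esub> u))" for x
  have g: "g (m \<oplus>\<^bsub>V\<^esub> u) = f u" if mu: "m \<in> M" "u \<in> U" for m u
  proof -
    define u' where "u' = (SOME u'. u' \<in> U \<and> (\<exists>m'\<in>M. m \<oplus>\<^bsub>V\<^esub> u = m' \<oplus>\<^bsub>V\<^esub> u'))"
    have "u' \<in> U \<and> (\<exists>m'\<in>M. m \<oplus>\<^bsub>V\<^esub> u = m' \<oplus>\<^bsub>V\<^esub> u')"
      unfolding u'_def by (rule someI[of _ u]) (use mu in auto)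
    then obtain m' where u': "u' \<in> U" "m' \<in> M" "m \<oplus>\<^bsub>V\<^esub> u = m' \<oplus>\<^bsub>V\<^esub> u'" by auto
    have "u' = \<ominus>\<^bsub>V\<^esub> m' \<oplus>\<^bsub>V\<^esub> (m' \<oplus>\<^bsub>V\<^esub> u')"
      using u' MV UV by (simp add: M.r_neg1)
    also have "\<dots> = \<ominus>\<^bsub>V\<^esub> m' \<oplus>\<^bsub>V\<^esub> (m \<oplus>\<^bsub>V\<^esub> u)" by (simp only: u'(3))
    finally have "u' \<oplus>\<^bsub>V\<^esub> (\<ominus>\<^bsub>V\<^esub> u) = (\<ominus>\<^bsub>V\<^esub> m' \<oplus>\<^bsub>V\<^esub> (m \<oplus>\<^bsub>V\<^esub> u)) \<oplus>\<^bsub>V\<^esub> (\<ominus>\<^bsub>V\<^esub> u)"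
      by (rule arg_cong)
    also have "\<dots> = \<ominus>\<^bsub>V\<^esub> m' \<oplus>\<^bsub>V\<^esub> m"
      using u'(1,2) mu MV UV by (simp add: M.a_assoc M.r_neg)
    finally have "u' \<oplus>\<^bsub>V\<^esub> (\<ominus>\<^bsub>V\<^esub> u) = \<ominus>\<^bsub>V\<^esub> m' \<oplus>\<^bsub>V\<^esub> m" .
    then have "u' \<oplus>\<^bsub>V\<^esub> (\<ominus>\<^bsub>V\<^esub> u) \<in> M"
      using subspace_minus_closed(1)[OF M(1) u'(2) u'(2)] subspaceD(4)[OF M(1)] mu by simp
    moreover have "u' \<oplus>\<^bsub>V\<^esub> (\<ominus>\<^bsub>V\<^esub> u) \<in> U"
      using subspace_minus_closed[OF U] subspaceD(4)[OF U] u' mu by simp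
    moreover have "f (u' \<oplus>\<^bsub>V\<^esub> (\<ominus>\<^bsub>V\<^esub> u)) = f u' \<ominus>\<^bsub>K\<^esub> f u"
    proof -
      have "f (\<ominus>\<^bsub>V\<^esub> u) = \<ominus>\<^bsub>K\<^esub> f u"
        using fD(3)[of "\<ominus>\<^bsub>K\<^esub> \<one>\<^bsub>K\<^esub>" u] fD(1)[of u] mu UV by (simp add: smult_minus_1 R.l_minus)
      then show ?thesis
        using fD(2)[of u' "\<ominus>\<^bsub>V\<^esub> u"] subspace_minus_closed[OF U] u' mu by (simp add: a_minus_def)
    qed
    ultimately have "f u' \<ominus>\<^bsub>K\<^esub> f u = \<zero>\<^bsub>K\<^esub>" using M0[of "u' \<oplus>\<^bsub>V\<^esub> (\<ominus>\<^bsub>V\<^esub> u)"] by simp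
    then have "f u' = f u" using fD(1)[of u'] fD(1)[of u] u' mu by simp
    then show ?thesis by (simp add: g_def u'_def)
  qed
  show ?thesis
  proof (intro bexI conjI ballI)
    show "g x = f x" if "x \<in> U" for x
      using g[of "\<zero>\<^bsub>V\<^esub>" x] subspaceD(3)[OF M(1)] that UV by simp
    show "g x = \<zero>\<^bsub>K\<^esub>" if "x \<in> W" for x
    proof -
      have x: "x \<in> M" using that M(2) by blast
      have "f \<zero>\<^bsub>V\<^esub> = \<zero>\<^bsub>K\<^esub>" by (rule M0) (use subspaceD(3)[OF U] subspaceD(3)[OF M(1)] in auto)
      then show ?thesis using g[OF x subspaceD(3)[OF U]] MV[OF x] by simp
    qed
    show "g \<in> linear_forms K V"
      unfolding linear_forms_iff
    proof (intro conjI ballI Pi_I)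
      fix x assume "x \<in> carrier V"
      then obtain m u where x: "m \<in> M" "u \<in> U" "x = m \<oplus>\<^bsub>V\<^esub> u" using decomp by blast
      then show "g x \<in> carrier K" using g fD by simp
      show "g (c \<odot>\<^bsub>V\<^esub> x) = c \<otimes>\<^bsub>K\<^esub> g x" if "c \<in> carrier K" for c
        using g[OF x(1,2)] g[OF subspaceD(5)[OF M(1) that x(1)] subspaceD(5)[OF U that x(2)]]
          fD(3)[OF that x(2)] smult_r_distr[OF that MV[OF x(1)] UV[OF x(2)]] x(3) by (simp only:)
      fix y assume "y \<in> carrier V"
      then obtain m' u' where y: "m' \<in> M" "u' \<in> U" "y = m' \<oplus>\<^bsub>V\<^esub> u'" using decomp by blast
      have "x \<oplus>\<^bsub>V\<^esub> y = (m \<oplus>\<^bsub>V\<^esub> m') \<oplus>\<^bsub>V\<^esub> (u \<oplus>\<^bsub>V\<^esub> u')"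
        using x y MV UV by (simp add: M.a_ac)
      then have "g (x \<oplus>\<^bsub>V\<^esub> y) = f (u \<oplus>\<^bsub>V\<^esub> u')"
        using g subspaceD(4)[OF M(1)] subspaceD(4)[OF U] x(1,2) y(1,2) by (simp only:)
      then show "g (x \<oplus>\<^bsub>V\<^esub> y) = g x \<oplus>\<^bsub>K\<^esub> g y"
        using g[OF x(1,2)] g[OF y(1,2)] fD(2)[OF x(2) y(2)] x(3) y(3) by (simp only:)
    qed
  qed
qed

text \<open>The form c v \<mapsto> c on the line through v is extended with value zero on W. The two
  prescriptions are compatible, because a nonzero multiple of v in W would put v itself into
  W.\<close>

lemma separating_linear_form:
  assumes W: "subspace K W V" and v: "v \<in> carrier V" "v \<notin> W"
  shows "\<exists>g\<in>linear_forms K V. g v \<noteq> \<zero>\<^bsub>K\<^esub> \<and> (\<forall>x\<in>W. g x = \<zero>\<^bsub>K\<^esub>)"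
proof -
  define f where "f x = (THE c. c \<in> carrier K \<and> x = c \<odot>\<^bsub>V\<^esub> v)" for x
  define U where "U = (\<lambda>c. c \<odot>\<^bsub>V\<^esub> v) ` carrier K"
  have W0: "c = \<zero>\<^bsub>K\<^esub>" if "c \<odot>\<^bsub>V\<^esub> v \<in> W" "c \<in> carrier K" for c
  proof (rule ccontr)
    assume c: "c \<noteq> \<zero>\<^bsub>K\<^esub>"
    then have "v = inv\<^bsub>K\<^esub> c \<odot>\<^bsub>V\<^esub> (c \<odot>\<^bsub>V\<^esub> v)" using mult_inverse[OF that(2) v(1)] by simp
    also have "\<dots> \<in> W" using subspaceD(5)[OF W _ that(1)] c that(2) by simp
    finally show False using v by simp
  qed
  have inj: "c = d" if "c \<odot>\<^bsub>V\<^esub> v = d \<odot>\<^bsub>V\<^esub> v" "c \<in> carrier K" "d \<in> carrier K" for c d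
  proof -
    have "(c \<ominus>\<^bsub>K\<^esub> d) \<odot>\<^bsub>V\<^esub> v = \<zero>\<^bsub>V\<^esub>"
      using that v by (simp add: a_minus_def smult_l_distr smult_l_minus M.r_neg)
    then have "c \<ominus>\<^bsub>K\<^esub> d = \<zero>\<^bsub>K\<^esub>" using W0[of "c \<ominus>\<^bsub>K\<^esub> d"] subspaceD(3)[OF W] that by simp
    then show ?thesis using that by simp
  qed
  have f: "f (c \<odot>\<^bsub>V\<^esub> v) = c" if "c \<in> carrier K" for c
    unfolding f_def using that inj by (intro the_equality) auto
  have U: "subspace K U V"
  proof (rule subspaceI[OF vectorspace_axioms])
    show "\<zero>\<^bsub>V\<^esub> \<in> U" using v by (auto simp: U_def intro!: image_eqI[of _ _ "\<zero>\<^bsub>K\<^esub>"])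
    show "x \<oplus>\<^bsub>V\<^esub> y \<in> U" if xy: "x \<in> U" "y \<in> U" for x y
    proof -
      obtain c d where "c \<in> carrier K" "d \<in> carrier K" "x = c \<odot>\<^bsub>V\<^esub> v" "y = d \<odot>\<^bsub>V\<^esub> v"
        using xy by (auto simp: U_def)
      then show ?thesis
        using v by (auto simp: U_def smult_l_distr intro!: image_eqI[of _ _ "c \<oplus>\<^bsub>K\<^esub> d"])
    qed
    show "c \<odot>\<^bsub>V\<^esub> x \<in> U" if c: "c \<in> carrier K" and x: "x \<in> U" for c x
    proof -
      obtain d where "d \<in> carrier K" "x = d \<odot>\<^bsub>V\<^esub> v"
        using x by (auto simp: U_def)
      then show ?thesis
        using v c by (auto simp: U_def smult_assoc1 intro!: image_eqI[of _ _ "c \<otimes>\<^bsub>K\<^esub> d"])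
    qed
  qed (use v in \<open>auto simp: U_def\<close>)
  have "f \<in> linear_forms K (V\<lparr>carrier := U\<rparr>)"
    unfolding linear_forms_iff
  proof (intro conjI ballI Pi_I)
    fix x assume "x \<in> carrier (V\<lparr>carrier := U\<rparr>)"
    then obtain c where c: "c \<in> carrier K" "x = c \<odot>\<^bsub>V\<^esub> v" by (auto simp: U_def)
    then show "f x \<in> carrier K" using f by simp
    show "f (d \<odot>\<^bsub>V\<lparr>carrier := U\<rparr>\<^esub> x) = d \<otimes>\<^bsub>K\<^esub> f x" if "d \<in> carrier K" for d
      using f[of "d \<otimes>\<^bsub>K\<^esub> c"] f[of c] c v that by (simp add: smult_assoc1)
    fix y assume "y \<in> carrier (V\<lparr>carrier := U\<rparr>)"
    then obtain d where d: "d \<in> carrier K" "y = d \<odot>\<^bsub>V\<^esub> v" by (auto simp: U_def)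
    then show "f (x \<oplus>\<^bsub>V\<lparr>carrier := U\<rparr>\<^esub> y) = f x \<oplus>\<^bsub>K\<^esub> f y"
      using f[of "c \<oplus>\<^bsub>K\<^esub> d"] f[of c] f[of d] c v by (simp add: smult_l_distr)
  qed
  moreover have "f x = \<zero>\<^bsub>K\<^esub>" if "x \<in> U" "x \<in> W" for x
    using that W0 f by (auto simp: U_def)
  ultimately obtain g where g: "g \<in> linear_forms K V" "\<forall>x\<in>U. g x = f x" "\<forall>x\<in>W. g x = \<zero>\<^bsub>K\<^esub>"
    using linear_form_extension[OF U W] by blast
  have "v = \<one>\<^bsub>K\<^esub> \<odot>\<^bsub>V\<^esub> v" using v by (simp add: smult_one)
  then have "v \<in> U" "f v = \<one>\<^bsub>K\<^esub>" using f[of "\<one>\<^bsub>K\<^esub>"] by (auto simp: U_def)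
  then have "g v \<noteq> \<zero>\<^bsub>K\<^esub>" using g(2) by simp
  then show ?thesis using g by blast
qed

end

text \<open>Together the forms map V linearly to the functions on I, and the image has dimension at
  most \<open>card I\<close>; S lifts a spanning set of that image. The induction adds a vector only
  if the new form does not vanish on the common kernel of the previous ones.\<close>

lemma (in vectorspace) finite_forms_span:
  assumes "finite I" "\<And>i. i \<in> I \<Longrightarrow> f i \<in> linear_forms K V"
  shows "\<exists>S. finite S \<and> card S \<le> card I \<and> S \<subseteq> carrier V \<and>
    (\<forall>v\<in>carrier V. \<exists>u\<in>span S. \<forall>i\<in>I. f i u = f i v)"
  using assms
proof (induction I)
  case empty
  then show ?case using span_zero[of "{}"] by (intro exI[of _ "{}"]) auto
next
  case (insert i I)
  then obtain S where S: "finite S" "card S \<le> card I" "S \<subseteq> carrier V"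
    and span: "\<And>v. v \<in> carrier V \<Longrightarrow> \<exists>u\<in>span S. \<forall>i\<in>I. f i u = f i v" by auto
  note fi = linear_form_simps[OF insert.prems, OF insertI1]
  note fI = linear_form_simps[OF insert.prems, OF insertI2]
  show ?case
  proof (cases "\<exists>v\<in>carrier V. (\<forall>j\<in>I. f j v = \<zero>\<^bsub>K\<^esub>) \<and> f i v \<noteq> \<zero>\<^bsub>K\<^esub>")
    case True
    then obtain w where w: "w \<in> carrier V" "\<And>j. j \<in> I \<Longrightarrow> f j w = \<zero>\<^bsub>K\<^esub>" "f i w \<noteq> \<zero>\<^bsub>K\<^esub>" by blast
    show ?thesis
    proof (intro exI[of _ "insert w S"] conjI ballI)
      show "card (insert w S) \<le> card (insert i I)"
        using S insert.hyps by (simp add: card_insert_if)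
      fix v assume v: "v \<in> carrier V"
      obtain u where u: "u \<in> span S" "\<And>i. i \<in> I \<Longrightarrow> f i u = f i v" using span[OF v] by blast
      have uV: "u \<in> carrier V" using u S by simp
      \<comment> \<open>The vector w is invisible to the forms in I, so adding a multiple of it
        corrects the value of \<open>f i\<close> alone. The coefficient is the missing difference
        divided by \<open>f i w\<close>.\<close>
      define d where "d = (f i v \<ominus>\<^bsub>K\<^esub> f i u) \<otimes>\<^bsub>K\<^esub> inv\<^bsub>K\<^esub> (f i w)"
      have d: "d \<in> carrier K" using v uV w fi(1) by (simp add: d_def)
      have wS: "insert w S \<subseteq> carrier V" using w S by simp
      have "span S \<subseteq> span (insert w S)" by (rule span_is_monotone) auto
      moreover have "d \<odot>\<^bsub>V\<^esub> w \<in> span (insert w S)"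
        using subspaceD(5)[OF span_is_subspace[OF wS] d] span_mem[OF wS, of w] by simp
      ultimately have mem: "u \<oplus>\<^bsub>V\<^esub> d \<odot>\<^bsub>V\<^esub> w \<in> span (insert w S)"
        using u(1) span_add1[OF wS] by blast
      have "f j (u \<oplus>\<^bsub>V\<^esub> d \<odot>\<^bsub>V\<^esub> w) = f j v" if "j \<in> I" for j
        using that d w(1) uV u(2)[OF that] w(2)[OF that] fI[OF that] v by simp
      moreover have "f i (u \<oplus>\<^bsub>V\<^esub> d \<odot>\<^bsub>V\<^esub> w) = f i v"
      proof -
        have "d \<otimes>\<^bsub>K\<^esub> f i w = f i v \<ominus>\<^bsub>K\<^esub> f i u"
          using v uV w fi(1) by (simp add: d_def R.m_assoc field_Units R.Units_l_inv)
        then have "f i (u \<oplus>\<^bsub>V\<^esub> d \<odot>\<^bsub>V\<^esub> w) = f i u \<oplus>\<^bsub>K\<^esub> (f i v \<ominus>\<^bsub>K\<^esub> f i u)"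
          using uV d w(1) fi by simp
        also have "\<dots> = f i v"
          using fi(1)[OF uV] fi(1)[OF v] by algebra
        finally show ?thesis .
      qed
      ultimately show "\<exists>u\<in>span (insert w S). \<forall>j\<in>insert i I. f j u = f j v" using mem by blast
    qed (use S w in auto)
  next
    \<comment> \<open>Here \<open>f i\<close> vanishes wherever all forms in I do, so agreement on I
      forces agreement at i.\<close>
    case False
    show ?thesis
    proof (intro exI[of _ S] conjI ballI)
      show "card S \<le> card (insert i I)" using S insert.hyps by (simp add: card_insert_if)
      fix v assume v: "v \<in> carrier V"
      obtain u where u: "u \<in> span S" "\<And>i. i \<in> I \<Longrightarrow> f i u = f i v" using span[OF v] by blast
      have uV: "u \<in> carrier V" using u S by simp
      have "f j (u \<ominus>\<^bsub>V\<^esub> v) = \<zero>\<^bsub>K\<^esub>" if "j \<in> I" for j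
        using fI[OF that] u(2)[OF that] uV v by simp
      then have "f i (u \<ominus>\<^bsub>V\<^esub> v) = \<zero>\<^bsub>K\<^esub>" using False uV v by blast
      then have "f i u = f i v" using fi uV v by simp
      then show "\<exists>u\<in>span S. \<forall>j\<in>insert i I. f j u = f j v" using u by blast
    qed (use S in auto)
  qed
qed

text \<open>By \<open>sep\<close>, the kernel of the joint evaluation lies in the kernel of
  \<open>q\<close>. A vector and its replacement from the span of S have the same values, hence the
  same image, so the images of S generate Q even if V has infinite dimension.\<close>

lemma fin_dim_by_forms:
  assumes q: "linear_map K V Q q" and surj: "q ` carrier V = carrier Q"
    and I: "finite I" and f: "\<And>i. i \<in> I \<Longrightarrow> f i \<in> linear_forms K V"
    and sep: "\<And>v. v \<in> carrier V \<Longrightarrow> (\<And>i. i \<in> I \<Longrightarrow> f i v = \<zero>\<^bsub>K\<^esub>) \<Longrightarrow> q v = \<zero>\<^bsub>Q\<^esub>"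
  shows "vectorspace.fin_dim K Q" "vectorspace.dim K Q \<le> card I"
proof -
  interpret V: vectorspace K V using q by (simp add: linear_map_def)
  interpret Q: vectorspace K Q using q by (simp add: linear_map_def)
  interpret q: linear_map K V Q q by fact
  obtain S where S: "finite S" "card S \<le> card I" "S \<subseteq> carrier V"
    and span: "\<And>v. v \<in> carrier V \<Longrightarrow> \<exists>u\<in>V.span S. \<forall>i\<in>I. f i u = f i v"
    using V.finite_forms_span[of I f, OF I f] by blast
  have qS: "q ` S \<subseteq> carrier Q" using S by auto
  have sub: "subspace K {v \<in> carrier V. q v \<in> Q.span (q ` S)} V"
    by (rule subspaceI[OF V.vectorspace_axioms])
      (auto simp: Q.span_zero Q.span_add1[OF qS] subspaceD(5)[OF Q.span_is_subspace[OF qS]])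
  have "V.span S \<subseteq> {v \<in> carrier V. q v \<in> Q.span (q ` S)}"
    by (rule V.span_is_subset[OF _ V.is_module[OF sub]]) (use S Q.span_mem[OF qS] in auto)
  then have *: "q u \<in> Q.span (q ` S)" if "u \<in> V.span S" for u using that by blast
  have gen: "Q.span (q ` S) = carrier Q"
  proof
    show "Q.span (q ` S) \<subseteq> carrier Q" using qS by (rule Q.span_is_subset2)
    show "carrier Q \<subseteq> Q.span (q ` S)"
    proof
      fix y assume "y \<in> carrier Q"
      then obtain v where v: "v \<in> carrier V" "y = q v" using surj by blast
      obtain u where u: "u \<in> V.span S" "\<And>i. i \<in> I \<Longrightarrow> f i u = f i v" using span[OF v(1)] by blast
      have uV: "u \<in> carrier V" using u S by simp
      have "q (u \<ominus>\<^bsub>V\<^esub> v) = \<zero>\<^bsub>Q\<^esub>"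
        using u uV v V.linear_form_simps[OF f] by (intro sep) auto
      then have "q u = y" using uV v by simp
      then show "y \<in> Q.span (q ` S)" using *[OF u(1)] by simp
    qed
  qed
  show "Q.fin_dim"
    unfolding Q.fin_dim_def using S qS gen by (intro exI[of _ "q ` S"]) auto
  have "Q.dim \<le> card (q ` S)"
    by (rule Q.gen_ge_dim) (use S qS gen in auto)
  then show "Q.dim \<le> card I" using S card_image_le[of S q] by linarith
qed

section \<open>Isomorphism and dimension\<close>

lemma linear_map_comp:
  assumes "linear_map K U V f" "linear_map K V W g"
  shows "linear_map K U W (g \<circ> f)"
  using assms by (intro linear_mapI) (auto simp: linear_map_def mod_hom_def mod_hom_axioms_def module_hom_def Pi_iff)

lemma linear_map_inv_into:
  assumes f: "linear_map K V W f" and bij: "bij_betw f (carrier V) (carrier W)"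
  shows "linear_map K W V (inv_into (carrier V) f)"
proof -
  interpret linear_map K V W f by fact
  have inv: "inv_into (carrier V) f y \<in> carrier V" "f (inv_into (carrier V) f y) = y" if "y \<in> carrier W" for y
    using bij that by (auto simp: bij_betw_def inv_into_into f_inv_into_f)
  have eq: "inv_into (carrier V) f y = x" if "x \<in> carrier V" "f x = y" for x y
    using bij that by (auto simp: bij_betw_def inv_into_f_f)
  show ?thesis
    by (rule linear_mapI) (auto simp: V.vectorspace_axioms W.vectorspace_axioms module_hom_def inv intro!: eq)
qed

lemma vs_isomorphic_sym: "vs_isomorphic K V W \<Longrightarrow> vs_isomorphic K W V"
  unfolding vs_isomorphic_def using linear_map_inv_into bij_betw_inv_into by blast

lemma vs_isomorphic_trans: "vs_isomorphic K U V \<Longrightarrow> vs_isomorphic K V W \<Longrightarrow> vs_isomorphic K U W"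
  unfolding vs_isomorphic_def using linear_map_comp bij_betw_trans by blast

lemma (in vectorspace) func_space_isomorphic:
  assumes A: "finite A" "basis A"
  shows "vs_isomorphic K (func_space A) V"
proof -
  have AV: "A \<subseteq> carrier V" using A by (simp add: basis_def)
  have ex1: "\<exists>!a. a \<in> A \<rightarrow>\<^sub>E carrier K \<and> lincomb a A = v" if "v \<in> carrier V" for v
    using basis_criterion[OF A(1) AV] A(2) that by blast
  have "bij_betw (\<lambda>a. lincomb a A) (carrier (func_space A)) (carrier V)"
  proof (rule bij_betwI')
    show "lincomb a A \<in> carrier V" if "a \<in> carrier (func_space A)" for a
      using that AV by (auto simp: func_space_def)
    then show "(lincomb a A = lincomb b A) = (a = b)"
      if "a \<in> carrier (func_space A)" "b \<in> carrier (func_space A)" for a b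
      using that ex1[of "lincomb a A"] by (auto simp: func_space_def)
    show "\<exists>a\<in>carrier (func_space A). v = lincomb a A" if "v \<in> carrier V" for v
      using ex1[OF that] by (auto simp: func_space_def)
  qed
  then show ?thesis
    using lincomb_is_linear[OF A(1) AV] by (auto simp: vs_isomorphic_def)
qed

lemma (in vectorspace) func_space_reindex:
  assumes g: "bij_betw g A B"
  shows "vs_isomorphic K (func_space B) (func_space A)"
proof -
  have gB: "x \<in> A \<Longrightarrow> g x \<in> B" for x using g by (auto simp: bij_betw_def)
  have lin: "linear_map K (func_space B) (func_space A) (\<lambda>a. restrict (a \<circ> g) A)"
    by (rule linear_mapI[OF func_space_is_vs func_space_is_vs])
      (use gB in \<open>auto simp: module_hom_def func_space_def PiE_iff intro!: restrict_ext\<close>)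
  have "bij_betw (\<lambda>a. restrict (a \<circ> g) A) (carrier (func_space B)) (carrier (func_space A))"
  proof (rule bij_betw_byWitness[where f' = "\<lambda>a. restrict (a \<circ> inv_into A g) B"])
    have inv: "inv_into A g y \<in> A" "g (inv_into A g y) = y" if "y \<in> B" for y
      using g that by (auto simp: bij_betw_def inv_into_into f_inv_into_f)
    have inv': "inv_into A g (g x) = x" if "x \<in> A" for x
      using g that by (auto simp: bij_betw_def)
    show "\<forall>a\<in>carrier (func_space B). restrict (restrict (a \<circ> g) A \<circ> inv_into A g) B = a"
      using inv by (auto simp: func_space_def PiE_iff extensional_def fun_eq_iff restrict_def)
    show "\<forall>a\<in>carrier (func_space A). restrict (restrict (a \<circ> inv_into A g) B \<circ> g) A = a"
      using inv' gB by (auto simp: func_space_def PiE_iff extensional_def fun_eq_iff restrict_def)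
    show "(\<lambda>a. restrict (a \<circ> g) A) ` carrier (func_space B) \<subseteq> carrier (func_space A)"
      using gB by (auto simp: func_space_def)
    show "(\<lambda>a. restrict (a \<circ> inv_into A g) B) ` carrier (func_space A) \<subseteq> carrier (func_space B)"
      using inv by (auto simp: func_space_def)
  qed
  then show ?thesis using lin by (auto simp: vs_isomorphic_def)
qed

lemma vs_isomorphic_iff_dim:
  assumes V: "vectorspace K V" "vectorspace.fin_dim K V" and W: "vectorspace K W" "vectorspace.fin_dim K W"
  shows "vs_isomorphic K V W \<longleftrightarrow> vectorspace.dim K V = vectorspace.dim K W"
proof -
  interpret V: vectorspace K V by fact
  interpret W: vectorspace K W by fact
  show ?thesis
  proof
    assume "vs_isomorphic K V W"
    then obtain f where f: "linear_map K V W f" "bij_betw f (carrier V) (carrier W)"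
      by (auto simp: vs_isomorphic_def)
    then show "V.dim = W.dim"
      using linear_map.dim_eq[OF f(1) V(2)] by (auto simp: bij_betw_def)
  next
    assume dim: "V.dim = W.dim"
    obtain A where A: "finite A" "V.basis A" using V.finite_basis_exists V(2) by blast
    obtain B where B: "finite B" "W.basis B" using W.finite_basis_exists W(2) by blast
    have "card B = card A" using V.dim_basis[OF A] W.dim_basis[OF B] dim by simp
    then obtain g where g: "bij_betw g B A"
      using finite_same_card_bij[OF B(1) A(1)] by blast
    show "vs_isomorphic K V W"
      by (rule vs_isomorphic_trans[OF vs_isomorphic_trans[OF
              vs_isomorphic_sym[OF V.func_space_isomorphic[OF A]] V.func_space_reindex[OF g]]
            W.func_space_isomorphic[OF B]])
  qed
qed

text \<open>A form that vanishes on the kernel of \<open>r\<close> factors through the image of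
  \<open>r\<close>, where it is zero once it is zero on a spanning set. The factored form is not
  constructed: the kernel of \<open>h\<close> is shown to map onto M, so m differs from a zero of
  \<open>h\<close> by an element of the kernel of \<open>r\<close>.\<close>

lemma linear_form_zero_by_image:
  assumes r: "linear_map K N M r" and h: "h \<in> linear_forms K N"
    and ker: "\<And>m. m \<in> carrier N \<Longrightarrow> r m = \<zero>\<^bsub>M\<^esub> \<Longrightarrow> h m = \<zero>\<^bsub>K\<^esub>"
    and S: "S \<subseteq> carrier N" "module.span K M (r ` S) = carrier M" "\<And>m. m \<in> S \<Longrightarrow> h m = \<zero>\<^bsub>K\<^esub>"
    and m: "m \<in> carrier N"
  shows "h m = \<zero>\<^bsub>K\<^esub>"
proof -
  interpret N: vectorspace K N using r by (simp add: linear_map_def)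
  interpret M: vectorspace K M using r by (simp add: linear_map_def)
  interpret r: linear_map K N M r by fact
  note h' = N.linear_form_simps[OF h]
  have "subspace K {n \<in> carrier N. h n = \<zero>\<^bsub>K\<^esub>} N"
    by (rule subspaceI[OF N.vectorspace_axioms]) (auto simp: h')
  have "subspace K (r ` {n \<in> carrier N. h n = \<zero>\<^bsub>K\<^esub>}) M"
  proof (rule subspaceI[OF M.vectorspace_axioms])
    show "\<zero>\<^bsub>M\<^esub> \<in> r ` {n \<in> carrier N. h n = \<zero>\<^bsub>K\<^esub>}"
      by (rule image_eqI[of _ _ "\<zero>\<^bsub>N\<^esub>"]) (auto simp: h')
    show "v \<oplus>\<^bsub>M\<^esub> w \<in> r ` {n \<in> carrier N. h n = \<zero>\<^bsub>K\<^esub>}"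
      if "v \<in> r ` {n \<in> carrier N. h n = \<zero>\<^bsub>K\<^esub>}" "w \<in> r ` {n \<in> carrier N. h n = \<zero>\<^bsub>K\<^esub>}" for v w
      using that by (auto simp: h' simp flip: r.f_add intro!: imageI)
    show "c \<odot>\<^bsub>M\<^esub> v \<in> r ` {n \<in> carrier N. h n = \<zero>\<^bsub>K\<^esub>}"
      if "c \<in> carrier K" "v \<in> r ` {n \<in> carrier N. h n = \<zero>\<^bsub>K\<^esub>}" for c v
      using that by (auto simp: h' simp flip: r.f_smult intro!: imageI)
  qed auto
  then have "M.span (r ` S) \<subseteq> r ` {n \<in> carrier N. h n = \<zero>\<^bsub>K\<^esub>}"
    by (intro M.span_is_subset M.is_module) (use S in auto)
  then obtain n where n: "n \<in> carrier N" "h n = \<zero>\<^bsub>K\<^esub>" "r m = r n"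
    using S(2) m by (auto simp: subset_iff)
  have "h (m \<ominus>\<^bsub>N\<^esub> n) = \<zero>\<^bsub>K\<^esub>" by (rule ker) (use n m in auto)
  then show ?thesis using n m h' by simp
qed

text \<open>By \<open>left\<close>, Q is C modulo the left radical of \<open>b\<close>; by
  \<open>right\<close>, the pairing descends to M. Hence Q is dual to M modulo the image of the
  right radical, and dim Q is dim M minus the dimension of that image. The dimensions agree exactly
  if \<open>r\<close> kills the right radical. Dual spaces are avoided by counting spanning
  sets.\<close>

lemma pairing_isomorphic_iff:
  assumes q: "linear_map K C Q q" "q ` carrier C = carrier Q"
    and r: "linear_map K N M r" "r ` carrier N = carrier M"
    and b1: "\<And>m. m \<in> carrier N \<Longrightarrow> (\<lambda>c. b c m) \<in> linear_forms K C"
    and b2: "\<And>c. c \<in> carrier C \<Longrightarrow> b c \<in> linear_forms K N"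
    and left: "\<And>c. c \<in> carrier C \<Longrightarrow> q c = \<zero>\<^bsub>Q\<^esub> \<longleftrightarrow> (\<forall>m\<in>carrier N. b c m = \<zero>\<^bsub>K\<^esub>)"
    and right: "\<And>c m. c \<in> carrier C \<Longrightarrow> m \<in> carrier N \<Longrightarrow> r m = \<zero>\<^bsub>M\<^esub> \<Longrightarrow> b c m = \<zero>\<^bsub>K\<^esub>"
    and fd: "vectorspace.fin_dim K M"
  shows "vs_isomorphic K M Q \<longleftrightarrow>
    (\<forall>m\<in>carrier N. (\<forall>c\<in>carrier C. b c m = \<zero>\<^bsub>K\<^esub>) \<longrightarrow> r m = \<zero>\<^bsub>M\<^esub>)"
proof -
  interpret Q: vectorspace K Q using q by (simp add: linear_map_def)
  interpret N: vectorspace K N using r by (simp add: linear_map_def)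
  interpret M: vectorspace K M using r by (simp add: linear_map_def)
  define l where "l = inv_into (carrier N) r"
  have l: "l x \<in> carrier N" "r (l x) = x" if "x \<in> carrier M" for x
    using that r(2) by (auto simp: l_def inv_into_into f_inv_into_f)
  \<comment> \<open>An element of C is zero in Q once it vanishes on lifts of a spanning set of M.
    Vectors of T are annihilated by all of C, so only those of A count.\<close>
  have dimQ: "Q.fin_dim" "Q.dim \<le> card A"
    if A: "finite A" "A \<subseteq> carrier M" "T \<subseteq> carrier N" "M.span (A \<union> r ` T) = carrier M"
      "\<And>c m. c \<in> carrier C \<Longrightarrow> m \<in> T \<Longrightarrow> b c m = \<zero>\<^bsub>K\<^esub>" for A T
  proof -
    have "q c = \<zero>\<^bsub>Q\<^esub>" if c: "c \<in> carrier C" "\<And>x. x \<in> A \<Longrightarrow> b c (l x) = \<zero>\<^bsub>K\<^esub>" for c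
    proof -
      have rl: "r ` (l ` A \<union> T) = A \<union> r ` T"
      proof -
        have "r ` l ` A = (\<lambda>x. x) ` A"
          unfolding image_image using A(2) l(2) by (intro image_cong) auto
        then show ?thesis by (simp add: image_Un)
      qed
      have "b c m = \<zero>\<^bsub>K\<^esub>" if "m \<in> carrier N" for m
        by (rule linear_form_zero_by_image[OF r(1) b2[OF c(1)] right[OF c(1)], of "l ` A \<union> T"])
          (use A l c rl that in auto)
      then show ?thesis using left c by blast
    qed
    then show "Q.fin_dim" "Q.dim \<le> card A"
      using fin_dim_by_forms[OF q A(1), of "\<lambda>x c. b c (l x)"] b1 l A(2) by blast+
  qed
  obtain A where A: "finite A" "M.basis A" using M.finite_basis_exists fd by blast
  then have A': "A \<subseteq> carrier M" "M.span A = carrier M" "M.dim = card A"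
    using M.dim_basis by (auto simp: M.basis_def)
  have fdQ: "Q.fin_dim" and QM: "Q.dim \<le> M.dim" using dimQ[of A "{}"] A A' by auto
  show ?thesis
    unfolding vs_isomorphic_iff_dim[OF M.vectorspace_axioms fd Q.vectorspace_axioms fdQ]
  proof (intro iffI ballI impI)
    fix m assume dim: "M.dim = Q.dim" and m: "m \<in> carrier N" "\<forall>c\<in>carrier C. b c m = \<zero>\<^bsub>K\<^esub>"
    show "r m = \<zero>\<^bsub>M\<^esub>"
    proof (rule ccontr)
      assume 0: "r m \<noteq> \<zero>\<^bsub>M\<^esub>"
      have rm: "r m \<in> carrier M" using r(2) m(1) by blast
      \<comment> \<open>Steinitz exchange puts \<open>r m\<close> into a basis of M at the cost of
        one basis vector. As m lies in the right radical, the remaining vectors alone bound dim Q,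
        which would fall below dim M.\<close>
      have "M.lin_indpt {}" by (rule M.finite_lin_indpt2) auto
      then have "M.lin_indpt {r m}"
        using M.lin_dep_iff_in_span[of "{}" "r m"] rm 0 M.span_empty by auto
      then obtain B where B: "finite B" "B \<subseteq> carrier M" "int (card B) \<le> int (card A) - int (card {r m})"
        "M.span ({r m} \<union> B) = M.span A"
        using M.replacement[of "{r m}" A] A A' rm by auto
      have "Q.dim \<le> card B"
        by (rule dimQ(2)[of B "{m}"]) (use B A' m in \<open>auto simp: Un_commute\<close>)
      then show False using B(3) dim A'(3) by simp
    qed
  next
    \<comment> \<open>Conversely, an m annihilated by lifts of a basis of Q is annihilated by all of
      C, so these lifts separate the elements of M and dim M is at most dim Q.\<close>
    assume *: "\<forall>m\<in>carrier N. (\<forall>c\<in>carrier C. b c m = \<zero>\<^bsub>K\<^esub>) \<longrightarrow> r m = \<zero>\<^bsub>M\<^esub>"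
    define k where "k = inv_into (carrier C) q"
    have k: "k x \<in> carrier C" "q (k x) = x" if "x \<in> carrier Q" for x
      using that q(2) by (auto simp: k_def inv_into_into f_inv_into_f)
    obtain B where B: "finite B" "Q.basis B" using Q.finite_basis_exists fdQ by blast
    then have B': "B \<subseteq> carrier Q" "Q.span B = carrier Q" "Q.dim = card B"
      using Q.dim_basis by (auto simp: Q.basis_def)
    have "r m = \<zero>\<^bsub>M\<^esub>" if m: "m \<in> carrier N" "\<And>x. x \<in> B \<Longrightarrow> b (k x) m = \<zero>\<^bsub>K\<^esub>" for m
    proof -
      have qk: "q ` (k ` B) = B" 
      proof -
        have "q ` k ` B = (\<lambda>x. x) ` B"
          unfolding image_image using B'(1) k(2) by (intro image_cong) auto
        then show ?thesis by simp
      qed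
      have "b c m = \<zero>\<^bsub>K\<^esub>" if "c \<in> carrier C" for c
        by (rule linear_form_zero_by_image[OF q(1) b1[OF m(1)], of "k ` B"])
          (use B' k qk m left that in auto)
      then show ?thesis using * m by blast
    qed
    then have "M.dim \<le> card B"
      using fin_dim_by_forms(2)[OF r B(1), of "\<lambda>x. b (k x)"] b2 k B'(1) by blast
    then show "M.dim = Q.dim" using QM B'(3) by simp
  qed
qed

section \<open>Diassociative algebras and cocycles\<close>

lemma module_hom_iff:
  "f \<in> module_hom K V W \<longleftrightarrow> f \<in> carrier V \<rightarrow> carrier W \<and>
     (\<forall>x\<in>carrier V. \<forall>y\<in>carrier V. f (x \<oplus>\<^bsub>V\<^esub> y) = f x \<oplus>\<^bsub>W\<^esub> f y) \<and>
     (\<forall>c\<in>carrier K. \<forall>x\<in>carrier V. f (c \<odot>\<^bsub>V\<^esub> x) = c \<odot>\<^bsub>W\<^esub> f x)"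
  by (auto simp: module_hom_def)

lemma dia_hom_linear_map: "dia_hom K A B h \<Longrightarrow> linear_map K A B h"
  by (simp add: dia_hom_def)

lemma dia_hom_mult:
  assumes "dia_hom K A B h" "x \<in> carrier A" "y \<in> carrier A"
  shows "h (x \<stileturn>\<^bsub>A\<^esub> y) = h x \<stileturn>\<^bsub>B\<^esub> h y" "h (x \<turnstile>\<^bsub>A\<^esub> y) = h x \<turnstile>\<^bsub>B\<^esub> h y"
  using assms by (auto simp: dia_hom_def)

lemma dia_hom_comp:
  assumes "dia_hom K A B f" "dia_hom K B C g"
  shows "dia_hom K A C (g \<circ> f)"
proof -
  interpret f: linear_map K A B f using assms by (simp add: dia_hom_def)
  show ?thesis
    using assms linear_map_comp by (auto simp: dia_hom_def)
qed

context diassociative_algebra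
begin

lemma dia_bilinear:
  assumes "x \<in> carrier L"
  shows "(\<lambda>y. x \<stileturn> y) \<in> module_hom K L L" "(\<lambda>y. y \<stileturn> x) \<in> module_hom K L L"
    and "(\<lambda>y. x \<turnstile> y) \<in> module_hom K L L" "(\<lambda>y. y \<turnstile> x) \<in> module_hom K L L"
  using ldia_bilinear rdia_bilinear assms by (auto simp: bilinear_map_def)

lemma dia_closed [simp]:
  assumes "x \<in> carrier L" "y \<in> carrier L"
  shows "x \<stileturn> y \<in> carrier L" "x \<turnstile> y \<in> carrier L"
  using dia_bilinear[OF assms(1)] assms by (auto simp: module_hom_iff)

lemma dia_add:
  assumes "x \<in> carrier L" "y \<in> carrier L" "z \<in> carrier L"
  shows "(x \<oplus> y) \<stileturn> z = x \<stileturn> z \<oplus> y \<stileturn> z" "z \<stileturn> (x \<oplus> y) = z \<stileturn> x \<oplus> z \<stileturn> y"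
    and "(x \<oplus> y) \<turnstile> z = x \<turnstile> z \<oplus> y \<turnstile> z" "z \<turnstile> (x \<oplus> y) = z \<turnstile> x \<oplus> z \<turnstile> y"
  using dia_bilinear[OF assms(3)] assms by (auto simp: module_hom_iff)

lemma dia_smult:
  assumes "c \<in> carrier K" "x \<in> carrier L" "z \<in> carrier L"
  shows "(c \<odot> x) \<stileturn> z = c \<odot> (x \<stileturn> z)" "z \<stileturn> (c \<odot> x) = c \<odot> (z \<stileturn> x)"
    and "(c \<odot> x) \<turnstile> z = c \<odot> (x \<turnstile> z)" "z \<turnstile> (c \<odot> x) = c \<odot> (z \<turnstile> x)"
  using dia_bilinear[OF assms(3)] assms by (auto simp: module_hom_iff)

lemma dia_zero [simp]:
  assumes "x \<in> carrier L"
  shows "\<zero> \<stileturn> x = \<zero>" "x \<stileturn> \<zero> = \<zero>" "\<zero> \<turnstile> x = \<zero>" "x \<turnstile> \<zero> = \<zero>"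
  using dia_smult[of "\<zero>\<^bsub>K\<^esub>" "\<zero>" x] assms by simp_all

lemma dia_neg:
  assumes "x \<in> carrier L" "y \<in> carrier L"
  shows "(\<ominus> x) \<stileturn> y = \<ominus> (x \<stileturn> y)" "x \<stileturn> (\<ominus> y) = \<ominus> (x \<stileturn> y)"
    and "(\<ominus> x) \<turnstile> y = \<ominus> (x \<turnstile> y)" "x \<turnstile> (\<ominus> y) = \<ominus> (x \<turnstile> y)"
  using dia_smult[of "\<ominus>\<^bsub>K\<^esub> \<one>\<^bsub>K\<^esub>" x y] dia_smult[of "\<ominus>\<^bsub>K\<^esub> \<one>\<^bsub>K\<^esub>" y x] assms
  by (simp_all add: smult_minus_1)

lemma dia_minus:
  assumes "x \<in> carrier L" "y \<in> carrier L" "z \<in> carrier L"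
  shows "(x \<ominus> y) \<stileturn> z = x \<stileturn> z \<ominus> y \<stileturn> z" "z \<stileturn> (x \<ominus> y) = z \<stileturn> x \<ominus> z \<stileturn> y"
    and "(x \<ominus> y) \<turnstile> z = x \<turnstile> z \<ominus> y \<turnstile> z" "z \<turnstile> (x \<ominus> y) = z \<turnstile> x \<ominus> z \<turnstile> y"
  using assms by (simp_all add: a_minus_def dia_add dia_neg)

end

text \<open>As for vector spaces, identities pass along a surjection that respects all operations.
  It serves for quotients and also for renaming the elements of an algebra along an injective
  map.\<close>

lemma dia_image_structure:
  assumes A: "diassociative_algebra K A" and carrier: "carrier B = q ` carrier A"
    and add: "\<And>x y. x \<in> carrier A \<Longrightarrow> y \<in> carrier A \<Longrightarrow> q x \<oplus>\<^bsub>B\<^esub> q y = q (x \<oplus>\<^bsub>A\<^esub> y)"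
    and smult: "\<And>c x. c \<in> carrier K \<Longrightarrow> x \<in> carrier A \<Longrightarrow> c \<odot>\<^bsub>B\<^esub> q x = q (c \<odot>\<^bsub>A\<^esub> x)"
    and zero: "\<zero>\<^bsub>B\<^esub> = q \<zero>\<^bsub>A\<^esub>"
    and ldia: "\<And>x y. x \<in> carrier A \<Longrightarrow> y \<in> carrier A \<Longrightarrow> q x \<stileturn>\<^bsub>B\<^esub> q y = q (x \<stileturn>\<^bsub>A\<^esub> y)"
    and rdia: "\<And>x y. x \<in> carrier A \<Longrightarrow> y \<in> carrier A \<Longrightarrow> q x \<turnstile>\<^bsub>B\<^esub> q y = q (x \<turnstile>\<^bsub>A\<^esub> y)"
  shows "diassociative_algebra K B" "dia_hom K A B q"
proof -
  interpret A: diassociative_algebra K A by fact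
  have q: "linear_map K A B q"
    by (rule linear_map_image_structure) (use A.vectorspace_axioms assms in auto)
  then have B: "vectorspace K B" by (simp add: linear_map_def)
  show "dia_hom K A B q" using q ldia rdia by (auto simp: dia_hom_def)
  show "diassociative_algebra K B"
  proof (intro diassociative_algebra.intro B diassociative_algebra_axioms.intro)
    show "bilinear_map K B B B (\<lambda>x y. x \<stileturn>\<^bsub>B\<^esub> y)"
      by (auto simp: bilinear_map_def module_hom_iff carrier ldia add smult A.dia_add A.dia_smult)
    show "bilinear_map K B B B (\<lambda>x y. x \<turnstile>\<^bsub>B\<^esub> y)"
      by (auto simp: bilinear_map_def module_hom_iff carrier rdia add smult A.dia_add A.dia_smult)
  qed (auto simp: carrier ldia rdia A.ldia_assoc A.rdia_assoc A.rdia_ldia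
      A.ldia_ldia_rdia[symmetric] A.ldia_rdia_rdia)
qed

section \<open>Quotients of algebras by ideals\<close>

context diassociative_algebra
begin

context
  fixes I assumes I: "dia_ideal K L I"
begin

lemma dia_ideal_subspace: "subspace K I L"
  using I by (simp add: dia_ideal_def)

lemma quot_dia_hom: "diassociative_algebra K (quot_dia L I)" "dia_hom K L (quot_dia L I) (\<lambda>x. I +> x)"
proof -
  note S = dia_ideal_subspace
  note q = quot_space_linear_map[OF S]
  interpret q: linear_map K L "quot_space L I" "\<lambda>x. I +> x" by fact
  have Ip: "x \<stileturn> a \<in> I" "a \<stileturn> x \<in> I" "x \<turnstile> a \<in> I" "a \<turnstile> x \<in> I" if "x \<in> carrier L" "a \<in> I" for x a
    using I that by (auto simp: dia_ideal_def)
  \<comment> \<open>The representatives are changed one at a time, each change moving the product by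
    an element of I. The variable \<open>m\<close> stands for either of the two products.\<close>
  have mult: "(\<Union>x'\<in>I +> x. \<Union>y'\<in>I +> y. I +> m x' y') = I +> m x y"
    if xy: "x \<in> carrier L" "y \<in> carrier L" and m: "m = (\<lambda>x y. x \<stileturn> y) \<or> m = (\<lambda>x y. x \<turnstile> y)"
    for x y m
  proof -
    have mc: "m a b \<in> carrier L" if "a \<in> carrier L" "b \<in> carrier L" for a b
      using m that by auto
    have mI: "m a b \<in> I" "m b a \<in> I" if "a \<in> carrier L" "b \<in> I" for a b
      using m that Ip by auto
    have 1: "(\<Union>y'\<in>I +> y. I +> m x' y') = I +> m x' y" if x': "x' \<in> carrier L" for x'
    proof (rule UN_coset[OF S xy(2)])
      fix y' assume y': "y' \<in> carrier L" "y' \<ominus> y \<in> I"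
      have "m x' y' \<ominus> m x' y = m x' (y' \<ominus> y)" using m x' y' xy by (auto simp: dia_minus)
      then show "I +> m x' y' = I +> m x' y"
        using mc mI x' y' xy by (simp add: coset_eq_iff[OF S])
    qed
    have 2: "(\<Union>x'\<in>I +> x. I +> m x' y) = I +> m x y"
    proof (rule UN_coset[OF S xy(1)])
      fix x' assume x': "x' \<in> carrier L" "x' \<ominus> x \<in> I"
      have "m x' y \<ominus> m x y = m (x' \<ominus> x) y" using m x' xy by (auto simp: dia_minus)
      then show "I +> m x' y = I +> m x y"
        using mc mI x' xy by (simp add: coset_eq_iff[OF S])
    qed
    have "(\<Union>x'\<in>I +> x. \<Union>y'\<in>I +> y. I +> m x' y') = (\<Union>x'\<in>I +> x. I +> m x' y)"
      using 1 coset_mem_iff[OF S xy(1)] by (intro SUP_cong) auto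
    with 2 show ?thesis by simp
  qed
  have "carrier (quot_dia L I) = (\<lambda>x. I +> x) ` carrier L"
    using quot_space_surj[OF S] by (simp add: quot_dia_def quot_space_def)
  moreover have "(I +> x) \<oplus>\<^bsub>quot_dia L I\<^esub> (I +> y) = I +> (x \<oplus> y)" if "x \<in> carrier L" "y \<in> carrier L" for x y
    using q.f_add[OF that] by (simp add: quot_dia_def quot_space_def)
  moreover have "c \<odot>\<^bsub>quot_dia L I\<^esub> (I +> x) = I +> (c \<odot> x)" if "c \<in> carrier K" "x \<in> carrier L" for c x
    using q.f_smult[OF that] by (simp add: quot_dia_def quot_space_def)
  moreover have "\<zero>\<^bsub>quot_dia L I\<^esub> = I +> \<zero>"
    using q.f0_is_0 by (simp add: quot_dia_def quot_space_def)
  moreover have "(I +> x) \<stileturn>\<^bsub>quot_dia L I\<^esub> (I +> y) = I +> (x \<stileturn> y)" if "x \<in> carrier L" "y \<in> carrier L" for x y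
    using mult[OF that, of "\<lambda>x y. x \<stileturn> y"] by (simp add: quot_dia_def)
  moreover have "(I +> x) \<turnstile>\<^bsub>quot_dia L I\<^esub> (I +> y) = I +> (x \<turnstile> y)" if "x \<in> carrier L" "y \<in> carrier L" for x y
    using mult[OF that, of "\<lambda>x y. x \<turnstile> y"] by (simp add: quot_dia_def)
  ultimately show "diassociative_algebra K (quot_dia L I)" "dia_hom K L (quot_dia L I) (\<lambda>x. I +> x)"
    using dia_image_structure[OF diassociative_algebra_axioms, of "quot_dia L I" "\<lambda>x. I +> x"] by blast+
qed

lemma quot_dia_carrier: "carrier (quot_dia L I) = (\<lambda>x. I +> x) ` carrier L"
  using quot_space_surj[OF dia_ideal_subspace] by (simp add: quot_dia_def quot_space_def)

lemma quot_dia_zero_iff: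
  assumes "x \<in> carrier L"
  shows "I +> x = \<zero>\<^bsub>quot_dia L I\<^esub> \<longleftrightarrow> x \<in> I"
  using quot_space_zero_iff[OF dia_ideal_subspace assms] by (simp add: quot_dia_def quot_space_def)

end
end

section \<open>Bilinear forms, cocycles and coboundaries\<close>

lemma bil_space_iff:
  "f \<in> carrier (bil_space K V W) \<longleftrightarrow> f \<in> carrier V \<times> carrier W \<rightarrow>\<^sub>E carrier K \<and>
     (\<forall>x\<in>carrier V. (\<lambda>y. f (x, y)) \<in> linear_forms K W) \<and>
     (\<forall>y\<in>carrier W. (\<lambda>x. f (x, y)) \<in> linear_forms K V)"
  by (auto simp: bil_space_def bilinear_map_def linear_forms_def)

lemma bil_space_vectorspace:
  assumes V: "vectorspace K V" and W: "vectorspace K W"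
  shows "vectorspace K (bil_space K V W)"
proof -
  interpret V: vectorspace K V by fact
  interpret W: vectorspace K W by fact
  let ?S = "carrier V \<times> carrier W"
  let ?F = "V.func_space ?S"
  have "subspace K (carrier (bil_space K V W)) ?F"
  proof (rule subspaceI[OF V.func_space_is_vs])
    show "carrier (bil_space K V W) \<subseteq> carrier ?F" by (simp add: subset_iff bil_space_iff V.func_space_def)
    show "\<zero>\<^bsub>?F\<^esub> \<in> carrier (bil_space K V W)"
      by (auto simp: bil_space_iff V.func_space_def linear_forms_iff)
    show "f \<oplus>\<^bsub>?F\<^esub> g \<in> carrier (bil_space K V W)"
      if "f \<in> carrier (bil_space K V W)" "g \<in> carrier (bil_space K V W)" for f g
      using that by (auto simp: bil_space_iff V.func_space_def linear_forms_iff PiE_iff V.R.a_ac V.R.r_distr)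
    show "c \<odot>\<^bsub>?F\<^esub> f \<in> carrier (bil_space K V W)"
      if "c \<in> carrier K" "f \<in> carrier (bil_space K V W)" for c f
      using that by (auto simp: bil_space_iff V.func_space_def linear_forms_iff PiE_iff V.R.m_ac V.R.r_distr)
  qed
  from V.func_space_is_vs[of ?S] vectorspace.subspace_is_vs[OF _ this]
  show ?thesis by (simp add: bil_space_def)
qed

lemma (in vectorspace) linear_forms_cong:
  assumes "\<And>x. x \<in> carrier V \<Longrightarrow> f x = g x"
  shows "f \<in> linear_forms K V \<longleftrightarrow> g \<in> linear_forms K V"
  using assms by (simp add: linear_forms_iff Pi_iff)

lemma (in vectorspace) linear_forms_add:
  assumes "e \<in> linear_forms K V" "f \<in> linear_forms K V"
  shows "(\<lambda>x. e x \<oplus>\<^bsub>K\<^esub> f x) \<in> linear_forms K V"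
  using linear_form_simps[OF assms(1)] linear_form_simps[OF assms(2)]
  by (auto simp: linear_forms_iff R.a_ac R.r_distr)

lemma (in vectorspace) linear_forms_smult:
  assumes "e \<in> linear_forms K V" "a \<in> carrier K"
  shows "(\<lambda>x. a \<otimes>\<^bsub>K\<^esub> e x) \<in> linear_forms K V"
  using assms(2) linear_form_simps[OF assms(1)] by (auto simp: linear_forms_iff R.m_ac R.r_distr)

lemma (in vectorspace) linear_forms_neg:
  assumes "e \<in> linear_forms K V"
  shows "(\<lambda>x. \<ominus>\<^bsub>K\<^esub> e x) \<in> linear_forms K V"
  using linear_form_simps[OF assms] by (auto simp: linear_forms_iff R.minus_add R.r_minus)

context diassociative_algebra
begin

text \<open>The cocycle conditions on curried functions, without extensionality, so that formulas
  such as \<open>\<lambda>i j. e (i \<stileturn> j)\<close> can be checked directly and cut down to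
  the carrier afterwards.\<close>

definition cocycle where
  "cocycle fl fr \<longleftrightarrow>
     (\<forall>x\<in>carrier L. (\<lambda>y. fl x y) \<in> linear_forms K L \<and> (\<lambda>y. fl y x) \<in> linear_forms K L \<and>
       (\<lambda>y. fr x y) \<in> linear_forms K L \<and> (\<lambda>y. fr y x) \<in> linear_forms K L) \<and>
     (\<forall>i\<in>carrier L. \<forall>j\<in>carrier L. \<forall>k\<in>carrier L.
        fl i (j \<stileturn> k) = fl i (j \<turnstile> k) \<and>
        fl (i \<turnstile> j) k = fr i (j \<stileturn> k) \<and>
        fr (i \<stileturn> j) k = fr (i \<turnstile> j) k \<and>
        fl i (j \<stileturn> k) = fl (i \<stileturn> j) k \<and>
        fr i (j \<turnstile> k) = fr (i \<turnstile> j) k)"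

lemma cocycles_iff:
  "c \<in> cocycles K L \<longleftrightarrow> fst c \<in> extensional (carrier L \<times> carrier L) \<and>
     snd c \<in> extensional (carrier L \<times> carrier L) \<and> cocycle (curry (fst c)) (curry (snd c))"
  by (cases c) (auto simp: cocycles_def cocycle_def bil_space_iff PiE_iff, auto simp: linear_forms_iff)

lemma cocycle_cong:
  assumes "\<And>x y. x \<in> carrier L \<Longrightarrow> y \<in> carrier L \<Longrightarrow> fl x y = gl x y"
    and "\<And>x y. x \<in> carrier L \<Longrightarrow> y \<in> carrier L \<Longrightarrow> fr x y = gr x y"
  shows "cocycle fl fr \<longleftrightarrow> cocycle gl gr"
proof -
  have "(\<lambda>y. fl x y) \<in> linear_forms K L \<longleftrightarrow> (\<lambda>y. gl x y) \<in> linear_forms K L"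
    "(\<lambda>y. fl y x) \<in> linear_forms K L \<longleftrightarrow> (\<lambda>y. gl y x) \<in> linear_forms K L"
    "(\<lambda>y. fr x y) \<in> linear_forms K L \<longleftrightarrow> (\<lambda>y. gr x y) \<in> linear_forms K L"
    "(\<lambda>y. fr y x) \<in> linear_forms K L \<longleftrightarrow> (\<lambda>y. gr y x) \<in> linear_forms K L" if "x \<in> carrier L" for x
    using assms that by (auto intro!: linear_forms_cong)
  then show ?thesis unfolding cocycle_def using assms by simp
qed

lemma cocycles_restrictI:
  assumes "cocycle fl fr"
  shows "(\<lambda>(x, y)\<in>carrier L \<times> carrier L. fl x y, \<lambda>(x, y)\<in>carrier L \<times> carrier L. fr x y) \<in> cocycles K L"
  using assms unfolding cocycles_iff by (simp cong: cocycle_cong)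

lemma cocycle_forms:
  assumes "c \<in> cocycles K L" "x \<in> carrier L"
  shows "(\<lambda>y. fst c (x, y)) \<in> linear_forms K L" "(\<lambda>y. fst c (y, x)) \<in> linear_forms K L"
    and "(\<lambda>y. snd c (x, y)) \<in> linear_forms K L" "(\<lambda>y. snd c (y, x)) \<in> linear_forms K L"
  using assms by (auto simp: cocycles_iff cocycle_def)

lemma cocycle_closed:
  assumes "c \<in> cocycles K L" "x \<in> carrier L" "y \<in> carrier L"
  shows "fst c (x, y) \<in> carrier K" "snd c (x, y) \<in> carrier K"
  using linear_form_simps(1)[OF cocycle_forms(1)[OF assms(1,2)] assms(3)]
    linear_form_simps(1)[OF cocycle_forms(3)[OF assms(1,2)] assms(3)] by auto

lemma cocycle_zero:
  assumes "c \<in> cocycles K L" "x \<in> carrier L"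
  shows "fst c (x, \<zero>) = \<zero>\<^bsub>K\<^esub>" "fst c (\<zero>, x) = \<zero>\<^bsub>K\<^esub>"
    and "snd c (x, \<zero>) = \<zero>\<^bsub>K\<^esub>" "snd c (\<zero>, x) = \<zero>\<^bsub>K\<^esub>"
  using cocycle_forms[OF assms, THEN linear_form_simps(4)] by auto

lemma cocycle_add:
  assumes "c \<in> cocycles K L" "x \<in> carrier L" "y \<in> carrier L" "z \<in> carrier L"
  shows "fst c (x, y \<oplus> z) = fst c (x, y) \<oplus>\<^bsub>K\<^esub> fst c (x, z)"
    and "fst c (y \<oplus> z, x) = fst c (y, x) \<oplus>\<^bsub>K\<^esub> fst c (z, x)"
    and "snd c (x, y \<oplus> z) = snd c (x, y) \<oplus>\<^bsub>K\<^esub> snd c (x, z)"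
    and "snd c (y \<oplus> z, x) = snd c (y, x) \<oplus>\<^bsub>K\<^esub> snd c (z, x)"
  using cocycle_forms[OF assms(1,2), THEN linear_form_simps(2), OF assms(3,4)] by auto

lemma cocycle_smult:
  assumes "c \<in> cocycles K L" "x \<in> carrier L" "a \<in> carrier K" "y \<in> carrier L"
  shows "fst c (x, a \<odot> y) = a \<otimes>\<^bsub>K\<^esub> fst c (x, y)"
    and "fst c (a \<odot> y, x) = a \<otimes>\<^bsub>K\<^esub> fst c (y, x)"
    and "snd c (x, a \<odot> y) = a \<otimes>\<^bsub>K\<^esub> snd c (x, y)"
    and "snd c (a \<odot> y, x) = a \<otimes>\<^bsub>K\<^esub> snd c (y, x)"
  using cocycle_forms[OF assms(1,2), THEN linear_form_simps(3), OF assms(3,4)] by auto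

lemma cocycle_eqs:
  assumes "c \<in> cocycles K L" "i \<in> carrier L" "j \<in> carrier L" "k \<in> carrier L"
  shows "fst c (i, j \<stileturn> k) = fst c (i, j \<turnstile> k)"
    and "fst c (i \<turnstile> j, k) = snd c (i, j \<stileturn> k)"
    and "snd c (i \<stileturn> j, k) = snd c (i \<turnstile> j, k)"
    and "fst c (i, j \<stileturn> k) = fst c (i \<stileturn> j, k)"
    and "snd c (i, j \<turnstile> k) = snd c (i \<turnstile> j, k)"
  using assms unfolding cocycles_iff cocycle_def curry_def by blast+

lemma cocycles_eqI:
  assumes "c \<in> cocycles K L" "d \<in> cocycles K L"
    and "\<And>x y. x \<in> carrier L \<Longrightarrow> y \<in> carrier L \<Longrightarrow> fst c (x, y) = fst d (x, y) \<and> snd c (x, y) = snd d (x, y)"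
  shows "c = d"
  using assms unfolding cocycles_iff
  by (intro prod_eqI extensionalityI[of _ "carrier L \<times> carrier L"]) auto

abbreviation "Z2 \<equiv> cocycle_space K L"

lemma cocycle_space_carrier [simp]: "carrier (Z2) = cocycles K L"
  by (simp add: cocycle_space_def)

lemma cocycle_space_ops:
  assumes "x \<in> carrier L" "y \<in> carrier L"
  shows "fst (c \<oplus>\<^bsub>Z2\<^esub> d) (x, y) = fst c (x, y) \<oplus>\<^bsub>K\<^esub> fst d (x, y)"
    and "snd (c \<oplus>\<^bsub>Z2\<^esub> d) (x, y) = snd c (x, y) \<oplus>\<^bsub>K\<^esub> snd d (x, y)"
    and "fst (a \<odot>\<^bsub>Z2\<^esub> c) (x, y) = a \<otimes>\<^bsub>K\<^esub> fst c (x, y)"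
    and "snd (a \<odot>\<^bsub>Z2\<^esub> c) (x, y) = a \<otimes>\<^bsub>K\<^esub> snd c (x, y)"
    and "fst \<zero>\<^bsub>Z2\<^esub> (x, y) = \<zero>\<^bsub>K\<^esub>"
    and "snd \<zero>\<^bsub>Z2\<^esub> (x, y) = \<zero>\<^bsub>K\<^esub>"
  using assms by (auto simp: cocycle_space_def direct_sum_def bil_space_def R.func_space_def)

lemma cocycle_space_vectorspace: "vectorspace K (Z2)"
proof -
  let ?B = "bil_space K L L"
  note B = bil_space_vectorspace[OF vectorspace_axioms vectorspace_axioms]
  interpret D: vectorspace K "direct_sum ?B ?B" by (rule direct_sum_is_vs[OF B B])
  have "subspace K (cocycles K L) (direct_sum ?B ?B)"
  proof (rule subspaceI[OF D.vectorspace_axioms])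
    show sub: "cocycles K L \<subseteq> carrier (direct_sum ?B ?B)"
      by (auto simp: cocycles_def direct_sum_def)
    have cocyclesI: "c \<in> cocycles K L"
      if "c \<in> carrier (direct_sum ?B ?B)" and "\<And>i j k. i \<in> carrier L \<Longrightarrow> j \<in> carrier L \<Longrightarrow> k \<in> carrier L \<Longrightarrow>
        fst c (i, j \<stileturn> k) = fst c (i, j \<turnstile> k) \<and>
        fst c (i \<turnstile> j, k) = snd c (i, j \<stileturn> k) \<and>
        snd c (i \<stileturn> j, k) = snd c (i \<turnstile> j, k) \<and>
        fst c (i, j \<stileturn> k) = fst c (i \<stileturn> j, k) \<and>
        snd c (i, j \<turnstile> k) = snd c (i \<turnstile> j, k)" for c
    proof -
      have "fst c \<in> carrier ?B" "snd c \<in> carrier ?B" using that(1) by (auto simp: direct_sum_def)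
      then show ?thesis using that(2) unfolding cocycles_def mem_Collect_eq case_prod_beta by blast
    qed
    have eqs: "a \<odot>\<^bsub>direct_sum ?B ?B\<^esub> c = a \<odot>\<^bsub>Z2\<^esub> c"
      "c \<oplus>\<^bsub>direct_sum ?B ?B\<^esub> d = c \<oplus>\<^bsub>Z2\<^esub> d"
      "\<zero>\<^bsub>direct_sum ?B ?B\<^esub> = \<zero>\<^bsub>Z2\<^esub>" for a c d
      by (simp_all add: cocycle_space_def)
    show "\<zero>\<^bsub>direct_sum ?B ?B\<^esub> \<in> cocycles K L"
      by (rule cocyclesI) (use D.M.zero_closed in \<open>simp_all add: eqs cocycle_space_ops\<close>)
    show "c \<oplus>\<^bsub>direct_sum ?B ?B\<^esub> d \<in> cocycles K L" if c: "c \<in> cocycles K L" and d: "d \<in> cocycles K L" for c d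
    proof (rule cocyclesI)
      show "c \<oplus>\<^bsub>direct_sum ?B ?B\<^esub> d \<in> carrier (direct_sum ?B ?B)"
        using c d sub by (intro D.M.a_closed) auto
    qed (unfold eqs, simp add: cocycle_space_ops, insert cocycle_eqs[OF c] cocycle_eqs[OF d], metis)
    show "a \<odot>\<^bsub>direct_sum ?B ?B\<^esub> c \<in> cocycles K L" if "a \<in> carrier K" and c: "c \<in> cocycles K L" for a c
    proof (rule cocyclesI)
      show "a \<odot>\<^bsub>direct_sum ?B ?B\<^esub> c \<in> carrier (direct_sum ?B ?B)"
        using that sub by (intro D.smult_closed) auto
    qed (unfold eqs, simp add: cocycle_space_ops, insert cocycle_eqs[OF c], metis)
  qed
  from D.subspace_is_vs[OF this] show ?thesis by (simp add: cocycle_space_def)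
qed

text \<open>Each cocycle condition is \<open>e\<close> applied to an identity of L.\<close>

lemma coboundary_cocycle:
  assumes e: "e \<in> linear_forms K L"
  shows "cocycle (\<lambda>i j. e (i \<stileturn> j)) (\<lambda>i j. e (i \<turnstile> j))"
  unfolding cocycle_def using linear_form_simps[OF e]
  by (auto simp: linear_forms_iff dia_add dia_smult ldia_assoc rdia_assoc ldia_ldia_rdia rdia_ldia ldia_rdia_rdia)

text \<open>The minus sign of the definition is absorbed by passing from \<open>e\<close> to its
  negative, which is again a linear form.\<close>

lemma coboundaries_iff:
  "c \<in> coboundaries K L \<longleftrightarrow> c \<in> cocycles K L \<and> (\<exists>e\<in>linear_forms K L. \<forall>i\<in>carrier L. \<forall>j\<in>carrier L.
     fst c (i, j) = e (i \<stileturn> j) \<and> snd c (i, j) = e (i \<turnstile> j))"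
proof
  assume "c \<in> coboundaries K L"
  then obtain e where e: "e \<in> linear_forms K L"
    and c: "c = (\<lambda>(i, j)\<in>carrier L \<times> carrier L. \<ominus>\<^bsub>K\<^esub> e (i \<stileturn> j),
      \<lambda>(i, j)\<in>carrier L \<times> carrier L. \<ominus>\<^bsub>K\<^esub> e (i \<turnstile> j))"
    by (auto simp: coboundaries_def)
  note n = linear_forms_neg[OF e]
  show "c \<in> cocycles K L \<and> (\<exists>e\<in>linear_forms K L. \<forall>i\<in>carrier L. \<forall>j\<in>carrier L.
     fst c (i, j) = e (i \<stileturn> j) \<and> snd c (i, j) = e (i \<turnstile> j))"
    using cocycles_restrictI[OF coboundary_cocycle[OF n]] n by (auto simp: c)
next
  assume *: "c \<in> cocycles K L \<and> (\<exists>e\<in>linear_forms K L. \<forall>i\<in>carrier L. \<forall>j\<in>carrier L.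
     fst c (i, j) = e (i \<stileturn> j) \<and> snd c (i, j) = e (i \<turnstile> j))"
  then obtain e where e: "e \<in> linear_forms K L" and
    c: "\<And>i j. i \<in> carrier L \<Longrightarrow> j \<in> carrier L \<Longrightarrow> fst c (i, j) = e (i \<stileturn> j) \<and> snd c (i, j) = e (i \<turnstile> j)"
    by blast
  have "c = (\<lambda>(i, j)\<in>carrier L \<times> carrier L. \<ominus>\<^bsub>K\<^esub> (\<ominus>\<^bsub>K\<^esub> e (i \<stileturn> j)),
      \<lambda>(i, j)\<in>carrier L \<times> carrier L. \<ominus>\<^bsub>K\<^esub> (\<ominus>\<^bsub>K\<^esub> e (i \<turnstile> j)))"
    using * c linear_form_simps(1)[OF e] unfolding cocycles_iff
    by (intro prod_eqI extensionalityI[of _ "carrier L \<times> carrier L"]) auto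
  then show "c \<in> coboundaries K L"
    unfolding coboundaries_def mem_Collect_eq
    by (intro exI[of _ "\<lambda>x. \<ominus>\<^bsub>K\<^esub> e x"] conjI linear_forms_neg e)
qed

lemma coboundaries_subspace: "subspace K (coboundaries K L) (Z2)"
proof -
  interpret Z: vectorspace K "Z2" by (rule cocycle_space_vectorspace)
  show ?thesis
  proof (rule subspaceI[OF Z.vectorspace_axioms])
    show "coboundaries K L \<subseteq> carrier (Z2)" by (auto simp: coboundaries_iff)
    show "\<zero>\<^bsub>Z2\<^esub> \<in> coboundaries K L"
      unfolding coboundaries_iff using Z.M.zero_closed
      by (auto simp: cocycle_space_ops linear_forms_iff intro!: bexI[of _ "\<lambda>_. \<zero>\<^bsub>K\<^esub>"])
    show "c \<oplus>\<^bsub>Z2\<^esub> d \<in> coboundaries K L"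
      if cd: "c \<in> coboundaries K L" "d \<in> coboundaries K L" for c d
    proof -
      obtain e f where e: "e \<in> linear_forms K L" "f \<in> linear_forms K L" and
        "\<forall>i\<in>carrier L. \<forall>j\<in>carrier L. fst c (i, j) = e (i \<stileturn> j) \<and> snd c (i, j) = e (i \<turnstile> j)"
        "\<forall>i\<in>carrier L. \<forall>j\<in>carrier L. fst d (i, j) = f (i \<stileturn> j) \<and> snd d (i, j) = f (i \<turnstile> j)"
        using cd unfolding coboundaries_iff by blast
      moreover have "(\<lambda>x. e x \<oplus>\<^bsub>K\<^esub> f x) \<in> linear_forms K L"
        by (rule linear_forms_add[OF e])
      ultimately show ?thesis
        using cd Z.M.a_closed[of c d] unfolding coboundaries_iff
        by (auto simp: cocycle_space_ops intro!: bexI[of _ "\<lambda>x. e x \<oplus>\<^bsub>K\<^esub> f x"])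
    qed
    show "a \<odot>\<^bsub>Z2\<^esub> c \<in> coboundaries K L"
      if a: "a \<in> carrier K" and c: "c \<in> coboundaries K L" for a c
    proof -
      obtain e where e: "e \<in> linear_forms K L" and
        "\<forall>i\<in>carrier L. \<forall>j\<in>carrier L. fst c (i, j) = e (i \<stileturn> j) \<and> snd c (i, j) = e (i \<turnstile> j)"
        using c unfolding coboundaries_iff by blast
      moreover have "(\<lambda>x. a \<otimes>\<^bsub>K\<^esub> e x) \<in> linear_forms K L"
        by (rule linear_forms_smult[OF e a])
      ultimately show ?thesis
        using a c Z.smult_closed[of a c] unfolding coboundaries_iff
        by (auto simp: cocycle_space_ops intro!: bexI[of _ "\<lambda>x. a \<otimes>\<^bsub>K\<^esub> e x"])
    qed
  qed
qed

end

section \<open>Extensions of an algebra by its ground field\<close>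

text \<open>The extension of L by the field with factor set \<open>c\<close>. Products depend on
  first coordinates only; for a cocycle \<open>c\<close> this makes the copy of the field
  central.\<close>

definition ext_dia ::
  "('k, 'r) ring_scheme \<Rightarrow> ('k, 'a, 'l) dialgebra_scheme \<Rightarrow> ('a \<times> 'a \<Rightarrow> 'k) \<times> ('a \<times> 'a \<Rightarrow> 'k) \<Rightarrow>
   ('k, 'a \<times> 'k) dialgebra" where
  "ext_dia K L c =
     \<lparr>carrier = carrier L \<times> carrier K, mult = (\<lambda>_ _. (\<zero>\<^bsub>L\<^esub>, \<zero>\<^bsub>K\<^esub>)), one = (\<zero>\<^bsub>L\<^esub>, \<zero>\<^bsub>K\<^esub>), zero = (\<zero>\<^bsub>L\<^esub>, \<zero>\<^bsub>K\<^esub>),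
      add = (\<lambda>u v. (fst u \<oplus>\<^bsub>L\<^esub> fst v, snd u \<oplus>\<^bsub>K\<^esub> snd v)),
      smult = (\<lambda>a u. (a \<odot>\<^bsub>L\<^esub> fst u, a \<otimes>\<^bsub>K\<^esub> snd u)),
      ldia = (\<lambda>u v. (fst u \<stileturn>\<^bsub>L\<^esub> fst v, fst c (fst u, fst v))),
      rdia = (\<lambda>u v. (fst u \<turnstile>\<^bsub>L\<^esub> fst v, snd c (fst u, fst v)))\<rparr>"

context diassociative_algebra
begin

text \<open>In each diassociative axiom, the first coordinate is the axiom of L and the second
  coordinate is one of the five cocycle conditions; this is where these conditions come
  from.\<close>

lemma ext_dia:
  assumes c: "c \<in> cocycles K L"
  shows "diassociative_algebra K (ext_dia K L c)"
proof -
  let ?E = "ext_dia K L c" and ?D = "direct_sum L (self_space K)"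
  \<comment> \<open>As a vector space the extension is the direct sum of L and the field, carried
    over by the identity map; only the products are twisted.\<close>
  have "vectorspace K ?D"
    by (intro direct_sum_is_vs vectorspace_axioms self_space_vectorspace field_axioms)
  then have "linear_map K ?D ?E (\<lambda>x. x)"
    by (rule linear_map_image_structure) (auto simp: ext_dia_def direct_sum_def self_space_def)
  then have E: "vectorspace K ?E" by (simp add: linear_map_def)
  note cs = cocycle_closed[OF c] cocycle_add[OF c] cocycle_smult[OF c]
  show ?thesis
  proof (intro diassociative_algebra.intro E diassociative_algebra_axioms.intro)
    show "bilinear_map K ?E ?E ?E (\<lambda>x y. x \<stileturn>\<^bsub>?E\<^esub> y)" "bilinear_map K ?E ?E ?E (\<lambda>x y. x \<turnstile>\<^bsub>?E\<^esub> y)"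
      by (auto simp: bilinear_map_def module_hom_iff ext_dia_def dia_add dia_smult cs)
  qed (auto simp: ext_dia_def ldia_assoc rdia_assoc ldia_ldia_rdia rdia_ldia ldia_rdia_rdia cocycle_eqs[OF c]
      cocycle_eqs(4)[OF c, symmetric])
qed

lemma ext_dia_fst_hom:
  assumes c: "c \<in> cocycles K L"
  shows "dia_hom K (ext_dia K L c) L fst"
  unfolding dia_hom_def
  using diassociative_algebra.axioms(1)[OF ext_dia[OF c]] vectorspace_axioms
  by (auto intro!: linear_mapI simp: module_hom_iff ext_dia_def)

lemma ext_dia_central_extension:
  assumes c: "c \<in> cocycles K L"
  shows "central_extension K (ext_dia K L c) fst L"
  unfolding central_extension_def using ext_dia[OF c] ext_dia_fst_hom[OF c]
  by (auto simp: a_kernel_def kernel_def center_def cocycle_zero[OF c] image_iff)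
    (auto simp: ext_dia_def cocycle_zero[OF c] intro!: bexI[of _ "\<zero>\<^bsub>K\<^esub>"])

end

text \<open>Transport of structure as in \<open>Zstar_antimono\<close>, but with \<open>h\<close>
  injective only on the carrier. The type \<open>'a \<times> 'k\<close> of an extension
  \<open>ext_dia\<close> need not embed into the type over which \<open>Zstar\<close> ranges,
  whereas its carrier does if L has finite dimension.\<close>

lemma Zstar_subset_inj_on:
  fixes h :: "'e \<Rightarrow> 'u" and E :: "('k, 'e) dialgebra"
  assumes ext: "central_extension K E w L" and h: "inj_on h (carrier E)"
  shows "Zstar TYPE('u) K L \<subseteq> w ` center E"
proof
  fix z assume z: "z \<in> Zstar TYPE('u) K L"
  define g where "g = inv_into (carrier E) h"
  have gh [simp]: "g (h x) = x" if "x \<in> carrier E" for x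
    using h that by (simp add: g_def)
  define E' :: "('k, 'u) dialgebra" where "E' =
    \<lparr>carrier = h ` carrier E, mult = (\<lambda>_ _. h \<zero>\<^bsub>E\<^esub>), one = h \<zero>\<^bsub>E\<^esub>, zero = h \<zero>\<^bsub>E\<^esub>,
     add = (\<lambda>a b. h (g a \<oplus>\<^bsub>E\<^esub> g b)), smult = (\<lambda>c a. h (c \<odot>\<^bsub>E\<^esub> g a)),
     ldia = (\<lambda>a b. h (g a \<stileturn>\<^bsub>E\<^esub> g b)), rdia = (\<lambda>a b. h (g a \<turnstile>\<^bsub>E\<^esub> g b))\<rparr>"
  have E: "diassociative_algebra K E" and w: "dia_hom K E L w" and surj: "w ` carrier E = carrier L"
    and ker: "a_kernel E L w \<subseteq> center E"
    using ext by (auto simp: central_extension_def)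
  interpret E: diassociative_algebra K E by (fact E)
  interpret w: linear_map K E L w using w by (simp add: dia_hom_def)
  have E': "diassociative_algebra K E'"
    by (rule dia_image_structure(1)[OF E, of _ h]) (auto simp: E'_def)
  then have "vectorspace K E'" by (simp add: diassociative_algebra_def)
  then have w': "dia_hom K E' L (w \<circ> g)"
    using dia_hom_mult[OF w] w.W.vectorspace_axioms
    by (auto simp: dia_hom_def module_hom_iff E'_def intro!: linear_mapI)
  have eq0: "h x = h \<zero>\<^bsub>E\<^esub> \<longleftrightarrow> x = \<zero>\<^bsub>E\<^esub>" if "x \<in> carrier E" for x
    using h that by (simp add: inj_on_eq_iff)
  have cen: "center E' = h ` center E"
    by (auto simp: center_def E'_def eq0)
  have "central_extension K E' (w \<circ> g) L"
    unfolding central_extension_def cen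
    using E' w' surj ker by (auto simp: E'_def a_kernel_def kernel_def image_image)
  then have "z \<in> (w \<circ> g) ` center E'"
    using z unfolding Zstar_def by blast
  then show "z \<in> w ` center E"
    by (auto simp: cen) (auto simp: center_def)
qed

text \<open>A vector is sent to its coefficients with respect to a finite spanning list. The
  coefficients are chosen, not canonical, yet they recover the vector, which gives
  injectivity.\<close>

lemma (in vectorspace) fin_dim_inj_nat_fun:
  assumes "fin_dim"
  shows "\<exists>h :: 'c \<Rightarrow> nat \<Rightarrow> 'a. inj_on h (carrier V)"
proof -
  obtain S where S: "finite S" "S \<subseteq> carrier V" "span S = carrier V"
    using assms by (auto simp: fin_dim_def)
  obtain e where e: "S = e ` {i::nat. i < card S}"
    using finite_imp_nat_seg_image_inj_on[OF S(1)] by (metis card_image card_Collect_less_nat)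
  have "\<exists>a. lincomb a S = v \<and> a \<in> S \<rightarrow> carrier K" if "v \<in> carrier V" for v
    using finite_in_span[OF S(1,2)] S(3) that by blast
  then obtain a where a: "\<And>v. v \<in> carrier V \<Longrightarrow> lincomb (a v) S = v" "\<And>v. v \<in> carrier V \<Longrightarrow> a v \<in> S \<rightarrow> carrier K"
    by metis
  have "inj_on (\<lambda>v i. a v (e i)) (carrier V)"
  proof
    fix v w assume vw: "v \<in> carrier V" "w \<in> carrier V" and "(\<lambda>i. a v (e i)) = (\<lambda>i. a w (e i))"
    then have "a v x = a w x" if "x \<in> S" for x
    proof -
      obtain i where "x = e i" using \<open>x \<in> S\<close> e by blast
      then show ?thesis using \<open>(\<lambda>i. a v (e i)) = (\<lambda>i. a w (e i))\<close> by (simp add: fun_eq_iff)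
    qed
    then have "lincomb (a v) S = lincomb (a w) S"
      using lincomb_cong[OF refl S(2), of "a v" "a w"] a vw by blast
    then show "v = w" using a vw by simp
  qed
  then show ?thesis by blast
qed

section \<open>Products of subspaces\<close>

context diassociative_algebra
begin

lemma set_add_eq_submodule_sum: "set_add L A B = submodule_sum A B"
  by (auto simp: set_add_def' submodule_sum_def)

lemma lozenge_subspace:
  assumes "X \<subseteq> carrier L" "Y \<subseteq> carrier L"
  shows "subspace K (lozenge K L X Y) L"
  unfolding lozenge_def set_add_eq_submodule_sum using assms
  by (auto intro!: sum_is_subspace span_is_subspace simp: subset_iff)

lemma lozenge_mem:
  assumes X: "X \<subseteq> carrier L" and Y: "Y \<subseteq> carrier L" and "x \<in> X" "y \<in> Y"
  shows "x \<stileturn> y \<in> lozenge K L X Y" "x \<turnstile> y \<in> lozenge K L X Y"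
proof -
  let ?A = "{x \<stileturn> y | x y. x \<in> X \<and> y \<in> Y}" and ?B = "{x \<turnstile> y | x y. x \<in> X \<and> y \<in> Y}"
  have A: "?A \<subseteq> carrier L" and B: "?B \<subseteq> carrier L" using X Y by (auto simp: subset_iff)
  have xy: "x \<stileturn> y \<in> ?A" "x \<turnstile> y \<in> ?B" using assms by blast+
  have "x \<stileturn> y \<oplus> \<zero> \<in> lozenge K L X Y"
    unfolding lozenge_def set_add_def' using span_mem[OF A xy(1)] span_zero[of ?B] by blast
  moreover have "\<zero> \<oplus> x \<turnstile> y \<in> lozenge K L X Y"
    unfolding lozenge_def set_add_def' using span_mem[OF B xy(2)] span_zero[of ?A] by blast
  ultimately show "x \<stileturn> y \<in> lozenge K L X Y" "x \<turnstile> y \<in> lozenge K L X Y"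
    using X Y assms by (simp_all add: subset_iff)
qed

lemma lozenge_least:
  assumes W: "subspace K W L"
    and "\<And>x y. x \<in> X \<Longrightarrow> y \<in> Y \<Longrightarrow> x \<stileturn> y \<in> W" "\<And>x y. x \<in> X \<Longrightarrow> y \<in> Y \<Longrightarrow> x \<turnstile> y \<in> W"
  shows "lozenge K L X Y \<subseteq> W"
proof -
  have "span {x \<stileturn> y | x y. x \<in> X \<and> y \<in> Y} \<subseteq> W" "span {x \<turnstile> y | x y. x \<in> X \<and> y \<in> Y} \<subseteq> W"
    by (intro span_is_subset is_module[OF W]; use assms in blast)+
  then show ?thesis
    unfolding lozenge_def set_add_def' using subspaceD(4)[OF W] by blast
qed

lemma derived_ideal_subspace: "subspace K (derived_ideal K L) L"
  unfolding derived_ideal_def by (rule lozenge_subspace) auto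

lemma derived_ideal_mem:
  "x \<in> carrier L \<Longrightarrow> y \<in> carrier L \<Longrightarrow> x \<stileturn> y \<in> derived_ideal K L"
  "x \<in> carrier L \<Longrightarrow> y \<in> carrier L \<Longrightarrow> x \<turnstile> y \<in> derived_ideal K L"
  unfolding derived_ideal_def by (auto intro: lozenge_mem)

lemma derived_ideal_least:
  assumes "subspace K W L"
    and "\<And>x y. x \<in> carrier L \<Longrightarrow> y \<in> carrier L \<Longrightarrow> x \<stileturn> y \<in> W \<and> x \<turnstile> y \<in> W"
  shows "derived_ideal K L \<subseteq> W"
  unfolding derived_ideal_def using assms by (intro lozenge_least) auto

context
  fixes I assumes I: "I \<subseteq> carrier L"
begin

lemma commutator_part_subspace: "subspace K (commutator_part K L I) L"
  unfolding commutator_part_def set_add_eq_submodule_sum using I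
  by (auto intro!: sum_is_subspace lozenge_subspace)

lemma commutator_part_mem:
  assumes "x \<in> carrier L" "a \<in> I"
  shows "x \<stileturn> a \<in> commutator_part K L I" "x \<turnstile> a \<in> commutator_part K L I"
    and "a \<stileturn> x \<in> commutator_part K L I" "a \<turnstile> x \<in> commutator_part K L I"
proof -
  have aL: "a \<in> carrier L" using assms I by blast
  have l: "lozenge K L (carrier L) I \<subseteq> commutator_part K L I"
  proof
    fix v assume v: "v \<in> lozenge K L (carrier L) I"
    then have "v \<oplus> \<zero> \<in> commutator_part K L I"
      unfolding commutator_part_def set_add_def' using subspaceD(3)[OF lozenge_subspace[OF I order_refl]] by blast
    then show "v \<in> commutator_part K L I" using v subspaceD(2)[OF lozenge_subspace[OF order_refl I]] by auto
  qed
  have r: "lozenge K L I (carrier L) \<subseteq> commutator_part K L I"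
  proof
    fix v assume v: "v \<in> lozenge K L I (carrier L)"
    then have "\<zero> \<oplus> v \<in> commutator_part K L I"
      unfolding commutator_part_def set_add_def' using subspaceD(3)[OF lozenge_subspace[OF order_refl I]] by blast
    then show "v \<in> commutator_part K L I" using v subspaceD(2)[OF lozenge_subspace[OF I order_refl]] by auto
  qed
  show "x \<stileturn> a \<in> commutator_part K L I" "x \<turnstile> a \<in> commutator_part K L I"
    using lozenge_mem[OF order_refl I assms] l by blast+
  show "a \<stileturn> x \<in> commutator_part K L I" "a \<turnstile> x \<in> commutator_part K L I"
    using lozenge_mem[OF I order_refl assms(2,1)] r by blast+
qed

text \<open>Serves as an induction principle: with W the set of elements that have some linear
  property, a claim about all of [L, I] is reduced to single products.\<close>

lemma commutator_part_least:
  assumes W: "subspace K W L"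
    and "\<And>x a. x \<in> carrier L \<Longrightarrow> a \<in> I \<Longrightarrow>
      x \<stileturn> a \<in> W \<and> x \<turnstile> a \<in> W \<and> a \<stileturn> x \<in> W \<and> a \<turnstile> x \<in> W"
  shows "commutator_part K L I \<subseteq> W"
proof -
  have "lozenge K L (carrier L) I \<subseteq> W" "lozenge K L I (carrier L) \<subseteq> W"
    by (intro lozenge_least[OF W]; use assms in blast)+
  then show ?thesis
    unfolding commutator_part_def set_add_def' using subspaceD(4)[OF W] by blast
qed

end
end

section \<open>The free diassociative algebra\<close>

definition dword_basis :: "('k, 'r) ring_scheme \<Rightarrow> 'w \<Rightarrow> 'w \<Rightarrow> 'k" where
  "dword_basis K w = (\<lambda>v. if v = w then \<one>\<^bsub>K\<^esub> else \<zero>\<^bsub>K\<^esub>)"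

context field
begin

section \<open>Linear structure and products of the free algebra\<close>

context
  notes split_paired_All [simp del]
begin

lemma free_dia_carrier:
  "f \<in> carrier (free_dia R X) \<longleftrightarrow> (\<forall>w. f w \<in> carrier R) \<and> finite (support R f) \<and> support R f \<subseteq> dwords X"
  by (auto simp: free_dia_def)

lemma free_dia_ops:
  "f \<oplus>\<^bsub>free_dia R X\<^esub> g = (\<lambda>w. f w \<oplus> g w)" "c \<odot>\<^bsub>free_dia R X\<^esub> f = (\<lambda>w. c \<otimes> f w)"
  "\<zero>\<^bsub>free_dia R X\<^esub> = (\<lambda>_. \<zero>)" "f \<stileturn>\<^bsub>free_dia R X\<^esub> g = convolution R dword_l f g"
  "f \<turnstile>\<^bsub>free_dia R X\<^esub> g = convolution R dword_r f g"
  by (auto simp: free_dia_def)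

lemma support_subsets:
  assumes "\<And>w. f w \<in> carrier R" "\<And>w. g w \<in> carrier R" "c \<in> carrier R"
  shows "support R (\<lambda>w. f w \<oplus> g w) \<subseteq> support R f \<union> support R g" "support R (\<lambda>w. c \<otimes> f w) \<subseteq> support R f"
  using assms by (auto simp: support_def)

lemma free_dia_add_closed:
  assumes "f \<in> carrier (free_dia R X)" "g \<in> carrier (free_dia R X)"
  shows "(\<lambda>w. f w \<oplus> g w) \<in> carrier (free_dia R X)"
proof -
  have f: "f w \<in> carrier R" and g: "g w \<in> carrier R" for w using assms by (auto simp: free_dia_carrier)
  show ?thesis
    using assms support_subsets(1)[of f g \<zero>, OF f g zero_closed]
    by (auto simp: free_dia_carrier intro: finite_subset)
qed

lemma free_dia_smult_closed:
  assumes "f \<in> carrier (free_dia R X)" "c \<in> carrier R"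
  shows "(\<lambda>w. c \<otimes> f w) \<in> carrier (free_dia R X)"
proof -
  have f: "f w \<in> carrier R" for w using assms by (auto simp: free_dia_carrier)
  show ?thesis
    using assms support_subsets(2)[of f f c, OF f f assms(2)]
    by (auto simp: free_dia_carrier intro: finite_subset)
qed

lemma free_dia_vectorspace: "vectorspace R (free_dia R X)"
proof (rule vs_criteria)
  show "\<forall>v\<in>carrier (free_dia R X). \<exists>neg_v\<in>carrier (free_dia R X).
    v \<oplus>\<^bsub>free_dia R X\<^esub> neg_v = \<zero>\<^bsub>free_dia R X\<^esub>"
  proof
    fix v assume v: "v \<in> carrier (free_dia R X)"
    have "v w \<oplus> (\<ominus> \<one>) \<otimes> v w = \<zero>" for w
      using v by (simp add: free_dia_carrier l_minus r_neg)
    then show "\<exists>neg_v\<in>carrier (free_dia R X). v \<oplus>\<^bsub>free_dia R X\<^esub> neg_v = \<zero>\<^bsub>free_dia R X\<^esub>"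
      using free_dia_smult_closed[OF v, of "\<ominus> \<one>"]
      by (intro bexI[of _ "\<lambda>w. (\<ominus> \<one>) \<otimes> v w"]) (simp_all add: free_dia_ops)
  qed
  show "field R" by (rule field_axioms)
  show "\<zero>\<^bsub>free_dia R X\<^esub> \<in> carrier (free_dia R X)" by (auto simp: free_dia_ops free_dia_carrier support_def)
qed (simp_all add: free_dia_ops free_dia_add_closed free_dia_smult_closed, auto simp: free_dia_carrier a_ac m_assoc l_distr r_distr)

lemma dword_basis_mem: "w \<in> dwords X \<Longrightarrow> dword_basis R w \<in> carrier (free_dia R X)"
  by (auto simp: free_dia_carrier dword_basis_def support_def)

lemma support_dword_basis: "support R (dword_basis R w) = {w}"
  by (auto simp: support_def dword_basis_def)

text \<open>Induction over a finite set containing the support, splitting off one coefficient at a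
  time.\<close>

lemma free_dia_span:
  assumes U: "subspace R U (free_dia R X)" and basis: "\<And>w. w \<in> dwords X \<Longrightarrow> dword_basis R w \<in> U"
  shows "carrier (free_dia R X) \<subseteq> U"
proof -
  have *: "f \<in> U" if "finite S" "f \<in> carrier (free_dia R X)" "support R f \<subseteq> S" for S f
    using that
  proof (induction S arbitrary: f)
    case empty
    then have "f = \<zero>\<^bsub>free_dia R X\<^esub>" by (auto simp: support_def free_dia_ops)
    then show ?case using subspaceD(3)[OF U] by simp
  next
    case (insert w S)
    show ?case
    proof (cases "f w = \<zero>")
      case True
      then show ?thesis using insert by (intro insert.IH) (auto simp: support_def)
    next
      case False
      then have w: "w \<in> dwords X" using insert.prems by (auto simp: free_dia_carrier support_def)
      define g where "g = (\<lambda>v. if v = w then \<zero> else f v)"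
      have g: "support R g \<subseteq> support R f" "support R g \<subseteq> S"
        using insert.prems by (auto simp: g_def support_def)
      then have gF: "g \<in> carrier (free_dia R X)"
        using insert.prems(1) by (auto simp: free_dia_carrier g_def intro: finite_subset)
      have fw: "f w \<in> carrier R" using insert.prems by (auto simp: free_dia_carrier)
      have "f = f w \<odot>\<^bsub>free_dia R X\<^esub> dword_basis R w \<oplus>\<^bsub>free_dia R X\<^esub> g"
        using insert.prems(1)
        by (intro ext) (auto simp: free_dia_ops free_dia_carrier dword_basis_def g_def)
      also have "\<dots> \<in> U"
        by (intro subspaceD(4,5)[OF U] fw basis w insert.IH gF g)
      finally show ?thesis .
    qed
  qed
  show ?thesis using * by (auto simp: free_dia_carrier)
qed

lemma free_dia_hom_eq:
  assumes V: "vectorspace R V" and f: "f \<in> module_hom R (free_dia R X) V" and g: "g \<in> module_hom R (free_dia R X) V"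
    and eq: "\<And>w. w \<in> dwords X \<Longrightarrow> f (dword_basis R w) = g (dword_basis R w)"
    and x: "x \<in> carrier (free_dia R X)"
  shows "f x = g x"
proof -
  interpret f: linear_map R "free_dia R X" V f by (intro linear_mapI free_dia_vectorspace V f)
  interpret g: linear_map R "free_dia R X" V g by (intro linear_mapI free_dia_vectorspace V g)
  have "subspace R {x \<in> carrier (free_dia R X). f x = g x} (free_dia R X)"
    by (rule subspaceI[OF free_dia_vectorspace]) auto
  from free_dia_span[OF this] x eq dword_basis_mem show ?thesis by blast
qed

text \<open>The defining sum runs over the supports of the factors, so its index set changes with
  them. Summing over any larger rectangle, with zero for pairs that give another word, lets sums
  with different supports be compared term by term.\<close>

lemma convolution_superset:
  assumes "finite A" "finite B" "support R f \<subseteq> A" "support R g \<subseteq> B"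
    and f: "\<And>w. f w \<in> carrier R" and g: "\<And>w. g w \<in> carrier R"
  shows "convolution R m f g w = (finsum R (\<lambda>(p, q). if m p q = w then f p \<otimes> g q else \<zero>) (A \<times> B))"
  unfolding convolution_def
  by (rule add.finprod_mono_neutral_cong_left) (use assms in \<open>auto simp: support_def split: if_splits\<close>)

lemma convolution_closed: "(\<And>w. f w \<in> carrier R) \<Longrightarrow> (\<And>w. g w \<in> carrier R) \<Longrightarrow> convolution R m f g w \<in> carrier R"
  unfolding convolution_def by (rule finsum_closed) auto

lemma convolution_mem:
  assumes f: "f \<in> carrier (free_dia R X)" and g: "g \<in> carrier (free_dia R X)"
    and m: "\<And>p q. p \<in> dwords X \<Longrightarrow> q \<in> dwords X \<Longrightarrow> m p q \<in> dwords X"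
  shows "convolution R m f g \<in> carrier (free_dia R X)"
proof -
  have "convolution R m f g w = \<zero>" if "w \<notin> case_prod m ` (support R f \<times> support R g)" for w
  proof -
    have "{(p, q) \<in> support R f \<times> support R g. m p q = w} = {}" using that by (auto simp: image_iff)
    then show ?thesis by (simp only: convolution_def finsum_empty)
  qed
  then have sub: "support R (convolution R m f g) \<subseteq> case_prod m ` (support R f \<times> support R g)"
    by (auto simp: support_def)
  have "finite (case_prod m ` (support R f \<times> support R g))"
    using f g by (auto simp: free_dia_carrier)
  then have "finite (support R (convolution R m f g))" using sub finite_subset by blast
  moreover have "support R (convolution R m f g) \<subseteq> dwords X"
  proof
    fix w assume "w \<in> support R (convolution R m f g)"
    with sub have "w \<in> case_prod m ` (support R f \<times> support R g)" by (rule subsetD)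
    then obtain i where i: "w = case_prod m i" "i \<in> support R f \<times> support R g" by (rule imageE)
    obtain p q where "i = (p, q)" by (cases i)
    with i have pq: "p \<in> support R f" "q \<in> support R g" "w = m p q" by simp_all
    then have "p \<in> dwords X" "q \<in> dwords X" using f g unfolding free_dia_carrier by blast+
    then show "w \<in> dwords X" using m pq by simp
  qed
  ultimately show ?thesis
    using f g convolution_closed[of f g] unfolding free_dia_carrier by blast
qed

lemma convolution_add:
  assumes f: "f \<in> carrier (free_dia R X)" and g: "g \<in> carrier (free_dia R X)" and h: "h \<in> carrier (free_dia R X)"
  shows "convolution R m (\<lambda>w. f w \<oplus> g w) h = (\<lambda>w. convolution R m f h w \<oplus> convolution R m g h w)"
    and "convolution R m h (\<lambda>w. f w \<oplus> g w) = (\<lambda>w. convolution R m h f w \<oplus> convolution R m h g w)"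
proof -
  have c: "f w \<in> carrier R" "g w \<in> carrier R" "h w \<in> carrier R" for w
    using assms by (auto simp: free_dia_carrier)
  let ?A = "support R f \<union> support R g" and ?B = "support R h"
  have fin: "finite ?A" "finite ?B" using assms by (auto simp: free_dia_carrier)
  note s = support_subsets(1)[of f g, OF c(1,2) zero_closed]
  show "convolution R m (\<lambda>w. f w \<oplus> g w) h = (\<lambda>w. convolution R m f h w \<oplus> convolution R m g h w)"
  proof
    fix w
    have "convolution R m (\<lambda>w. f w \<oplus> g w) h w =
      finsum R (\<lambda>(p, q). (if m p q = w then f p \<otimes> h q else \<zero>) \<oplus> (if m p q = w then g p \<otimes> h q else \<zero>)) (?A \<times> ?B)"
      by (subst convolution_superset[OF fin]) (use c s in \<open>auto simp: l_distr intro!: add.finprod_cong'\<close>)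
    also have "\<dots> = (finsum R (\<lambda>(p, q). if m p q = w then f p \<otimes> h q else \<zero>) (?A \<times> ?B)) \<oplus>
        (finsum R (\<lambda>(p, q). if m p q = w then g p \<otimes> h q else \<zero>) (?A \<times> ?B))"
      unfolding case_prod_beta by (rule finsum_addf) (use c in auto)
    also have "\<dots> = convolution R m f h w \<oplus> convolution R m g h w"
      by (subst (1 2) convolution_superset[OF fin]) (use c in auto)
    finally show "convolution R m (\<lambda>w. f w \<oplus> g w) h w = convolution R m f h w \<oplus> convolution R m g h w" .
  qed
  show "convolution R m h (\<lambda>w. f w \<oplus> g w) = (\<lambda>w. convolution R m h f w \<oplus> convolution R m h g w)"
  proof
    fix w
    have "convolution R m h (\<lambda>w. f w \<oplus> g w) w =
      finsum R (\<lambda>(p, q). (if m p q = w then h p \<otimes> f q else \<zero>) \<oplus> (if m p q = w then h p \<otimes> g q else \<zero>)) (?B \<times> ?A)"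
      by (subst convolution_superset[OF fin(2,1)]) (use c s in \<open>auto simp: r_distr intro!: add.finprod_cong'\<close>)
    also have "\<dots> = (finsum R (\<lambda>(p, q). if m p q = w then h p \<otimes> f q else \<zero>) (?B \<times> ?A)) \<oplus>
        (finsum R (\<lambda>(p, q). if m p q = w then h p \<otimes> g q else \<zero>) (?B \<times> ?A))"
      unfolding case_prod_beta by (rule finsum_addf) (use c in auto)
    also have "\<dots> = convolution R m h f w \<oplus> convolution R m h g w"
      by (subst (1 2) convolution_superset[OF fin(2,1)]) (use c in auto)
    finally show "convolution R m h (\<lambda>w. f w \<oplus> g w) w = convolution R m h f w \<oplus> convolution R m h g w" .
  qed
qed

lemma convolution_smult:
  assumes f: "f \<in> carrier (free_dia R X)" and h: "h \<in> carrier (free_dia R X)" and a: "a \<in> carrier R"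
  shows "convolution R m (\<lambda>w. a \<otimes> f w) h = (\<lambda>w. a \<otimes> convolution R m f h w)"
    and "convolution R m h (\<lambda>w. a \<otimes> f w) = (\<lambda>w. a \<otimes> convolution R m h f w)"
proof -
  have c: "f w \<in> carrier R" "h w \<in> carrier R" for w
    using assms by (auto simp: free_dia_carrier)
  let ?A = "support R f" and ?B = "support R h"
  have fin: "finite ?A" "finite ?B" using assms by (auto simp: free_dia_carrier)
  note s = support_subsets(2)[of f f, OF c(1) c(1) a]
  show "convolution R m (\<lambda>w. a \<otimes> f w) h = (\<lambda>w. a \<otimes> convolution R m f h w)"
  proof
    fix w
    have "convolution R m (\<lambda>w. a \<otimes> f w) h w =
      (\<Oplus>i\<in>?A \<times> ?B. a \<otimes> (case i of (p, q) \<Rightarrow> if m p q = w then f p \<otimes> h q else \<zero>))"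
      by (subst convolution_superset[OF fin]) (use c s a in \<open>auto simp: m_assoc intro!: add.finprod_cong'\<close>)
    also have "\<dots> = a \<otimes> (finsum R (\<lambda>(p, q). if m p q = w then f p \<otimes> h q else \<zero>) (?A \<times> ?B))"
      by (rule finsum_rdistr[symmetric]) (use c fin a in auto)
    also have "\<dots> = a \<otimes> convolution R m f h w"
      by (subst convolution_superset[OF fin]) (use c in auto)
    finally show "convolution R m (\<lambda>w. a \<otimes> f w) h w = a \<otimes> convolution R m f h w" .
  qed
  show "convolution R m h (\<lambda>w. a \<otimes> f w) = (\<lambda>w. a \<otimes> convolution R m h f w)"
  proof
    fix w
    have "convolution R m h (\<lambda>w. a \<otimes> f w) w =
      (\<Oplus>i\<in>?B \<times> ?A. a \<otimes> (case i of (p, q) \<Rightarrow> if m p q = w then h p \<otimes> f q else \<zero>))"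
      by (subst convolution_superset[OF fin(2,1)]) (use c s a in \<open>auto simp: m_lcomm intro!: add.finprod_cong'\<close>)
    also have "\<dots> = a \<otimes> (finsum R (\<lambda>(p, q). if m p q = w then h p \<otimes> f q else \<zero>) (?B \<times> ?A))"
      by (rule finsum_rdistr[symmetric]) (use c fin a in auto)
    also have "\<dots> = a \<otimes> convolution R m h f w"
      by (subst convolution_superset[OF fin(2,1)]) (use c in auto)
    finally show "convolution R m h (\<lambda>w. a \<otimes> f w) w = a \<otimes> convolution R m h f w" .
  qed
qed

lemma convolution_dword_basis:
  "convolution R m (dword_basis R p) (dword_basis R q) = dword_basis R (m p q)"
proof
  fix w
  have "convolution R m (dword_basis R p) (dword_basis R q) w =
    finsum R (\<lambda>(p', q'). if m p' q' = w then dword_basis R p p' \<otimes> dword_basis R q q' else \<zero>) ({p} \<times> {q})"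
    by (rule convolution_superset) (auto simp: support_dword_basis, auto simp: dword_basis_def)
  then show "convolution R m (dword_basis R p) (dword_basis R q) w = dword_basis R (m p q) w"
    by (auto simp: dword_basis_def finsum_insert)
qed

lemma dword_mem:
  assumes "p \<in> dwords X" "q \<in> dwords X"
  shows "dword_l p q \<in> dwords X" "dword_r p q \<in> dwords X"
  using assms by (cases p; cases q; auto simp: dwords_def)+

lemma free_dia_bilinear:
  "bilinear_map R (free_dia R X) (free_dia R X) (free_dia R X) (\<lambda>x y. x \<stileturn>\<^bsub>free_dia R X\<^esub> y)"
  "bilinear_map R (free_dia R X) (free_dia R X) (free_dia R X) (\<lambda>x y. x \<turnstile>\<^bsub>free_dia R X\<^esub> y)"
  by (auto simp: bilinear_map_def module_hom_iff free_dia_ops convolution_mem dword_mem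
      convolution_add convolution_smult)

lemma free_dia_basis_mult:
  "dword_basis R p \<stileturn>\<^bsub>free_dia R X\<^esub> dword_basis R q = dword_basis R (dword_l p q)"
  "dword_basis R p \<turnstile>\<^bsub>free_dia R X\<^esub> dword_basis R q = dword_basis R (dword_r p q)"
  by (auto simp: free_dia_ops convolution_dword_basis)

text \<open>Linear extension in one argument at a time: words are replaced by arbitrary elements in
  the third, then the second, then the first place. The identities of the free algebra thus become
  identities between words.\<close>

lemma free_dia_trilinear_eq:
  assumes f: "\<And>x y. x \<in> carrier (free_dia R X) \<Longrightarrow> y \<in> carrier (free_dia R X) \<Longrightarrow>
      (\<lambda>z. f x y z) \<in> module_hom R (free_dia R X) (free_dia R X) \<and>
      (\<lambda>z. f x z y) \<in> module_hom R (free_dia R X) (free_dia R X) \<and>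
      (\<lambda>z. f z x y) \<in> module_hom R (free_dia R X) (free_dia R X)"
    and g: "\<And>x y. x \<in> carrier (free_dia R X) \<Longrightarrow> y \<in> carrier (free_dia R X) \<Longrightarrow>
      (\<lambda>z. g x y z) \<in> module_hom R (free_dia R X) (free_dia R X) \<and>
      (\<lambda>z. g x z y) \<in> module_hom R (free_dia R X) (free_dia R X) \<and>
      (\<lambda>z. g z x y) \<in> module_hom R (free_dia R X) (free_dia R X)"
    and eq: "\<And>p q r. p \<in> dwords X \<Longrightarrow> q \<in> dwords X \<Longrightarrow> r \<in> dwords X \<Longrightarrow>
      f (dword_basis R p) (dword_basis R q) (dword_basis R r) = g (dword_basis R p) (dword_basis R q) (dword_basis R r)"
    and x: "x \<in> carrier (free_dia R X)" and y: "y \<in> carrier (free_dia R X)" and z: "z \<in> carrier (free_dia R X)"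
  shows "f x y z = g x y z"
proof -
  note hom_eq = free_dia_hom_eq[OF free_dia_vectorspace[of X]]
  have 1: "f (dword_basis R p) (dword_basis R q) z = g (dword_basis R p) (dword_basis R q) z"
    if "p \<in> dwords X" "q \<in> dwords X" for p q
    by (rule hom_eq[where f = "\<lambda>z. f (dword_basis R p) (dword_basis R q) z"
          and g = "\<lambda>z. g (dword_basis R p) (dword_basis R q) z"])
      (use that f[OF dword_basis_mem[OF that(1)] dword_basis_mem[OF that(2)]]
        g[OF dword_basis_mem[OF that(1)] dword_basis_mem[OF that(2)]] eq z in blast)+
  have 2: "f (dword_basis R p) y z = g (dword_basis R p) y z" if "p \<in> dwords X" for p
    by (rule hom_eq[where f = "\<lambda>y. f (dword_basis R p) y z" and g = "\<lambda>y. g (dword_basis R p) y z"])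
      (use that f[OF dword_basis_mem[OF that] z] g[OF dword_basis_mem[OF that] z] 1 y in blast)+
  show ?thesis
    by (rule hom_eq[where f = "\<lambda>x. f x y z" and g = "\<lambda>x. g x y z"])
      (use f[OF y z] g[OF y z] 2 x in blast)+
qed

text \<open>Both sides concatenate the three words in the same order, and the same letter stays
  distinguished.\<close>

lemma dword_identities:
  "dword_l (dword_l p q) r = dword_l p (dword_l q r)" "dword_r (dword_r p q) r = dword_r p (dword_r q r)"
  "dword_l p (dword_l q r) = dword_l p (dword_r q r)" "dword_l (dword_r p q) r = dword_r p (dword_l q r)"
  "dword_r (dword_l p q) r = dword_r (dword_r p q) r"
  by (cases p; cases q; cases r; simp)+

lemma free_dia_diassociative: "diassociative_algebra R (free_dia R X)"
proof -
  let ?F = "free_dia R X"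
  have trilinear: "(\<lambda>z. m (n x y) z) \<in> module_hom R ?F ?F \<and> (\<lambda>z. m (n x z) y) \<in> module_hom R ?F ?F \<and>
      (\<lambda>z. m (n z x) y) \<in> module_hom R ?F ?F"
    "(\<lambda>z. m x (n y z)) \<in> module_hom R ?F ?F \<and> (\<lambda>z. m x (n z y)) \<in> module_hom R ?F ?F \<and>
      (\<lambda>z. m z (n x y)) \<in> module_hom R ?F ?F"
    if "bilinear_map R ?F ?F ?F m" "bilinear_map R ?F ?F ?F n" "x \<in> carrier ?F" "y \<in> carrier ?F" for m n x y
    using that by (simp_all add: bilinear_map_def module_hom_iff Pi_iff)
  \<comment> \<open>The entries come in pairs, left-nested and then right-nested, for the outer and
    inner products (\<stileturn>, \<stileturn>), (\<stileturn>, \<turnstile>), (\<turnstile>,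
    \<stileturn>), (\<turnstile>, \<turnstile>) in this order.\<close>
  note tri = trilinear[OF free_dia_bilinear(1) free_dia_bilinear(1)] trilinear[OF free_dia_bilinear(1) free_dia_bilinear(2)]
    trilinear[OF free_dia_bilinear(2) free_dia_bilinear(1)] trilinear[OF free_dia_bilinear(2) free_dia_bilinear(2)]
  show ?thesis
  proof (intro diassociative_algebra.intro free_dia_vectorspace diassociative_algebra_axioms.intro free_dia_bilinear)
    fix x y z assume xyz: "x \<in> carrier ?F" "y \<in> carrier ?F" "z \<in> carrier ?F"
    show "(x \<stileturn>\<^bsub>?F\<^esub> y) \<stileturn>\<^bsub>?F\<^esub> z = x \<stileturn>\<^bsub>?F\<^esub> (y \<stileturn>\<^bsub>?F\<^esub> z)"
      by (rule free_dia_trilinear_eq[OF tri(1) tri(2) _ xyz]) (simp_all add: free_dia_basis_mult dword_identities(1))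
    show "(x \<turnstile>\<^bsub>?F\<^esub> y) \<turnstile>\<^bsub>?F\<^esub> z = x \<turnstile>\<^bsub>?F\<^esub> (y \<turnstile>\<^bsub>?F\<^esub> z)"
      by (rule free_dia_trilinear_eq[OF tri(7) tri(8) _ xyz]) (simp_all add: free_dia_basis_mult dword_identities(2))
    show "x \<stileturn>\<^bsub>?F\<^esub> (y \<stileturn>\<^bsub>?F\<^esub> z) = x \<stileturn>\<^bsub>?F\<^esub> (y \<turnstile>\<^bsub>?F\<^esub> z)"
      by (rule free_dia_trilinear_eq[OF tri(2) tri(4) _ xyz]) (simp_all add: free_dia_basis_mult dword_identities(3))
    show "(x \<turnstile>\<^bsub>?F\<^esub> y) \<stileturn>\<^bsub>?F\<^esub> z = x \<turnstile>\<^bsub>?F\<^esub> (y \<stileturn>\<^bsub>?F\<^esub> z)"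
      by (rule free_dia_trilinear_eq[OF tri(3) tri(6) _ xyz]) (simp_all add: free_dia_basis_mult dword_identities(4))
    show "(x \<stileturn>\<^bsub>?F\<^esub> y) \<turnstile>\<^bsub>?F\<^esub> z = (x \<turnstile>\<^bsub>?F\<^esub> y) \<turnstile>\<^bsub>?F\<^esub> z"
      by (rule free_dia_trilinear_eq[OF tri(5) tri(7) _ xyz]) (simp_all add: free_dia_basis_mult dword_identities(5))
  qed
qed

end

end

text \<open>Letters to the left of the distinguished one act by \<turnstile>, letters to its right
  by \<stileturn>, bracketed so that every step multiplies by a single letter.\<close>

definition dword_eval :: "('k, 'e, 'l) dialgebra_scheme \<Rightarrow> ('x \<Rightarrow> 'e) \<Rightarrow> 'x dword \<Rightarrow> 'e" where
  "dword_eval E e = (\<lambda>(u, x, v). foldl (\<lambda>b a. b \<stileturn>\<^bsub>E\<^esub> e a) (foldr (\<lambda>a b. e a \<turnstile>\<^bsub>E\<^esub> b) u (e x)) v)"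

section \<open>The universal property of the free algebra\<close>

context diassociative_algebra
begin

context
  fixes X :: "'x set" and e :: "'x \<Rightarrow> 'a"
  assumes e: "\<And>x. x \<in> X \<Longrightarrow> e x \<in> carrier L"
begin

abbreviation (input) "evl u b \<equiv> foldr (\<lambda>a b. e a \<turnstile> b) u b"
abbreviation (input) "evr b v \<equiv> foldl (\<lambda>b a. b \<stileturn> e a) b v"

lemma evl_closed: "u \<in> lists X \<Longrightarrow> b \<in> carrier L \<Longrightarrow> evl u b \<in> carrier L"
  by (induction u) (auto simp: e)

lemma evr_closed: "v \<in> lists X \<Longrightarrow> b \<in> carrier L \<Longrightarrow> evr b v \<in> carrier L"
  by (induction v arbitrary: b) (auto simp: e)

lemma evr_ldia: "v \<in> lists X \<Longrightarrow> b \<in> carrier L \<Longrightarrow> c \<in> carrier L \<Longrightarrow> evr (b \<stileturn> c) v = b \<stileturn> evr c v"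
  by (induction v arbitrary: c) (auto simp: e ldia_assoc)

lemma evr_rdia: "v \<in> lists X \<Longrightarrow> b \<in> carrier L \<Longrightarrow> c \<in> carrier L \<Longrightarrow> evr (b \<turnstile> c) v = b \<turnstile> evr c v"
  by (induction v arbitrary: c) (auto simp: e rdia_ldia)

lemma evl_rdia: "u \<in> lists X \<Longrightarrow> b \<in> carrier L \<Longrightarrow> c \<in> carrier L \<Longrightarrow> evl u b \<turnstile> c = evl u (b \<turnstile> c)"
  by (induction u) (auto simp: e rdia_assoc evl_closed)

text \<open>To the right of \<stileturn> the two products cannot be told apart: b \<stileturn> (a
  \<turnstile> c) = b \<stileturn> (a \<stileturn> c) = (b \<stileturn> a) \<stileturn> c. So the
  letters of u, which acted on c from the left, become right multiplications of b.\<close>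

lemma ldia_evl: "u \<in> lists X \<Longrightarrow> b \<in> carrier L \<Longrightarrow> c \<in> carrier L \<Longrightarrow> b \<stileturn> evl u c = evr b u \<stileturn> c"
proof (induction u arbitrary: b)
  case (Cons a u)
  have "b \<stileturn> (e a \<turnstile> evl u c) = (b \<stileturn> e a) \<stileturn> evl u c"
    using Cons.prems by (simp add: e evl_closed ldia_assoc ldia_ldia_rdia)
  then show ?case using Cons by (simp add: e)
qed simp

text \<open>The mirror image of the preceding computation: to the left of \<turnstile> the two
  products cannot be told apart, and associativity moves the letters of v over to c.\<close>

lemma evr_rdia_evl: "v \<in> lists X \<Longrightarrow> b \<in> carrier L \<Longrightarrow> c \<in> carrier L \<Longrightarrow> evr b v \<turnstile> c = b \<turnstile> evl v c"
proof (induction v arbitrary: b)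
  case (Cons a v)
  have "(b \<stileturn> e a) \<turnstile> evl v c = b \<turnstile> (e a \<turnstile> evl v c)"
    using Cons.prems by (simp add: e evl_closed ldia_rdia_rdia rdia_assoc)
  then show ?case using Cons by (simp add: e)
qed simp

lemma dword_eval_closed:
  assumes "w \<in> dwords X"
  shows "dword_eval L e w \<in> carrier L"
proof -
  obtain u x v where w: "w = (u, x, v)" by (rule prod_cases3)
  then have "u \<in> lists X" "x \<in> X" "v \<in> lists X" using assms unfolding dwords_def by blast+
  then show ?thesis unfolding w dword_eval_def prod.case by (intro evr_closed evl_closed e)
qed

lemma dword_eval_mult:
  assumes "p \<in> dwords X" "q \<in> dwords X"
  shows "dword_eval L e (dword_l p q) = dword_eval L e p \<stileturn> dword_eval L e q"
    and "dword_eval L e (dword_r p q) = dword_eval L e p \<turnstile> dword_eval L e q"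
proof -
  obtain u x v u' x' v' where pq: "p = (u, x, v)" "q = (u', x', v')" by (metis prod_cases3)
  then have l: "u \<in> lists X" "v \<in> lists X" "u' \<in> lists X" "v' \<in> lists X" "x \<in> X" "x' \<in> X"
    using assms by (auto simp: dwords_def)
  define b where "b = evr (evl u (e x)) v"
  have b: "b \<in> carrier L" using l by (simp add: b_def evr_closed evl_closed e)
  \<comment> \<open>The letters of v' are pulled out, then u' is absorbed into b. The letters now
    stand in the order in which \<open>dword_l\<close> concatenates them.\<close>
  have "b \<stileturn> evr (evl u' (e x')) v' = evr (evr b u' \<stileturn> e x') v'"
    using l b by (simp add: e evl_closed ldia_evl flip: evr_ldia)
  then show "dword_eval L e (dword_l p q) = dword_eval L e p \<stileturn> dword_eval L e q"
    by (simp add: pq dword_eval_def b_def)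
  have "b \<turnstile> evl u' (e x') = evl u (e x \<turnstile> evl v (evl u' (e x')))"
    using l by (simp add: b_def e evl_closed evr_rdia_evl evl_rdia)
  moreover have "b \<turnstile> evr (evl u' (e x')) v' = evr (b \<turnstile> evl u' (e x')) v'"
    using l b by (simp add: e evl_closed evr_rdia)
  ultimately show "dword_eval L e (dword_r p q) = dword_eval L e p \<turnstile> dword_eval L e q"
    by (simp add: pq dword_eval_def b_def)
qed

text \<open>The map is the linear extension of \<open>dword_eval\<close>; by bilinearity its
  multiplicativity is tested on words only, where it is \<open>dword_eval_mult\<close>.\<close>

lemma free_dia_lift:
  "\<exists>P. dia_hom K (free_dia K X) L P \<and> (\<forall>x\<in>X. P (dword_basis K ([], x, [])) = e x)"
proof -
  let ?F = "free_dia K X"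
  interpret F: diassociative_algebra K ?F by (rule free_dia_diassociative)
  define P where "P f = finsum L (\<lambda>w. f w \<odot> dword_eval L e w) (support K f)" for f
  have P_sup: "P f = finsum L (\<lambda>w. f w \<odot> dword_eval L e w) A"
    if "f \<in> carrier ?F" "finite A" "support K f \<subseteq> A" "A \<subseteq> dwords X" for f A
    unfolding P_def
    by (rule M.add.finprod_mono_neutral_cong_left)
      (use that in \<open>auto simp: support_def free_dia_carrier dword_eval_closed subset_iff\<close>)
  have Fc: "f w \<in> carrier K" "finite (support K f)" "support K f \<subseteq> dwords X" if "f \<in> carrier ?F" for f w
    using that unfolding free_dia_carrier by blast+
  have P_closed: "P f \<in> carrier L" if "f \<in> carrier ?F" for f
    unfolding P_def using Fc[OF that] by (intro M.finsum_closed) (auto intro!: smult_closed dword_eval_closed)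
  have P_hom: "P \<in> module_hom K ?F L"
    unfolding module_hom_iff
  proof (intro conjI ballI Pi_I P_closed)
    fix f g assume fg: "f \<in> carrier ?F" "g \<in> carrier ?F"
    let ?A = "support K f \<union> support K g"
    have A: "finite ?A" "?A \<subseteq> dwords X" using Fc fg by auto
    have s: "support K (f \<oplus>\<^bsub>?F\<^esub> g) \<subseteq> ?A"
      using support_subsets(1)[of f g "\<zero>\<^bsub>K\<^esub>"] Fc fg by (simp add: free_dia_ops)
    have "P (f \<oplus>\<^bsub>?F\<^esub> g) = finsum L (\<lambda>w. f w \<odot> dword_eval L e w \<oplus> g w \<odot> dword_eval L e w) ?A"
      unfolding P_sup[OF F.M.a_closed[OF fg] A(1) s A(2)]
      using A Fc(1)[OF fg(1)] Fc(1)[OF fg(2)] dword_eval_closed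
      by (intro M.add.finprod_cong') (auto simp: free_dia_ops smult_l_distr subset_iff)
    also have "\<dots> = P f \<oplus> P g"
      using P_sup[OF fg(1) A(1) _ A(2)] P_sup[OF fg(2) A(1) _ A(2)] A(2) Fc(1)[OF fg(1)] Fc(1)[OF fg(2)] dword_eval_closed
      by (subst M.finsum_addf) (auto simp: subset_iff)
    finally show "P (f \<oplus>\<^bsub>?F\<^esub> g) = P f \<oplus> P g" .
  next
    fix c f assume c: "c \<in> carrier K" and f: "f \<in> carrier ?F"
    have s: "support K (c \<odot>\<^bsub>?F\<^esub> f) \<subseteq> support K f"
      using support_subsets(2)[of f f c] Fc(1)[OF f] c by (simp add: free_dia_ops)
    have "P (c \<odot>\<^bsub>?F\<^esub> f) = finsum L (\<lambda>w. c \<odot> (f w \<odot> dword_eval L e w)) (support K f)"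
      unfolding P_sup[OF F.smult_closed[OF c f] Fc(2)[OF f] s Fc(3)[OF f]]
      using Fc[OF f] c dword_eval_closed
      by (intro M.add.finprod_cong') (auto simp: free_dia_ops smult_assoc1 subset_iff)
    also have "\<dots> = c \<odot> P f"
      unfolding P_def using Fc[OF f] c dword_eval_closed
      by (intro finsum_smult[symmetric]) (auto simp: subset_iff)
    finally show "P (c \<odot>\<^bsub>?F\<^esub> f) = c \<odot> P f" .
  qed
  have P_basis: "P (dword_basis K w) = dword_eval L e w" if "w \<in> dwords X" for w
    using dword_eval_closed[OF that] unfolding P_def support_dword_basis
    by (simp add: dword_basis_def smult_one)
  note hom_eq = free_dia_hom_eq[OF vectorspace_axioms]
  have P_mult: "P (m a b) = n (P a) (P b)"
    if m: "bilinear_map K ?F ?F ?F m" and n: "bilinear_map K L L L n"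
      and eq: "\<And>p q. p \<in> dwords X \<Longrightarrow> q \<in> dwords X \<Longrightarrow>
        P (m (dword_basis K p) (dword_basis K q)) = n (P (dword_basis K p)) (P (dword_basis K q))"
      and ab: "a \<in> carrier ?F" "b \<in> carrier ?F" for m n a b
  proof -
    have hom: "(\<lambda>y. P (m x y)) \<in> module_hom K ?F L" "(\<lambda>y. n (P x) (P y)) \<in> module_hom K ?F L"
      "(\<lambda>y. P (m y x)) \<in> module_hom K ?F L" "(\<lambda>y. n (P y) (P x)) \<in> module_hom K ?F L"
      if "x \<in> carrier ?F" for x
      using m n P_hom that by (auto simp: bilinear_map_def module_hom_iff Pi_iff)
    have 1: "P (m (dword_basis K p) b) = n (P (dword_basis K p)) (P b)" if p: "p \<in> dwords X" for p
      by (rule hom_eq[OF hom(1,2)[OF dword_basis_mem[OF p]] eq[OF p] ab(2)])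
    show ?thesis
      by (rule hom_eq[OF hom(3,4)[OF ab(2)] 1 ab(1)])
  qed
  have basis: "P (dword_basis K q \<stileturn>\<^bsub>?F\<^esub> dword_basis K r) = P (dword_basis K q) \<stileturn> P (dword_basis K r)"
    "P (dword_basis K q \<turnstile>\<^bsub>?F\<^esub> dword_basis K r) = P (dword_basis K q) \<turnstile> P (dword_basis K r)"
    if "q \<in> dwords X" "r \<in> dwords X" for q r
    using dword_mem[OF that] that by (simp_all only: free_dia_basis_mult P_basis dword_eval_mult)
  have "linear_map K ?F L P"
    by (intro linear_mapI F.vectorspace_axioms vectorspace_axioms P_hom)
  then have "dia_hom K ?F L P"
    unfolding dia_hom_def
    using P_mult[OF F.ldia_bilinear ldia_bilinear basis(1)] P_mult[OF F.rdia_bilinear rdia_bilinear basis(2)]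
    by blast
  moreover have "\<forall>x\<in>X. P (dword_basis K ([], x, [])) = e x"
  proof
    fix x assume "x \<in> X"
    then have "([], x, []) \<in> dwords X" by (simp add: dwords_def)
    then show "P (dword_basis K ([], x, [])) = e x" by (simp only: P_basis) (simp add: dword_eval_def)
  qed
  ultimately show ?thesis by blast
qed

end

text \<open>Words are products of generators: letters are first prepended by \<turnstile> and then
  appended by \<stileturn>, as in \<open>dword_eval\<close>.\<close>

lemma free_dia_hom_eqI:
  assumes f: "dia_hom K (free_dia K X) L f" and g: "dia_hom K (free_dia K X) L g"
    and eq: "\<And>x. x \<in> X \<Longrightarrow> f (dword_basis K ([], x, [])) = g (dword_basis K ([], x, []))"
    and a: "a \<in> carrier (free_dia K X)"
  shows "f a = g a"
proof -
  have mem: "dword_basis K (u, x, v) \<in> carrier (free_dia K X)" if "u \<in> lists X" "x \<in> X" "v \<in> lists X" for u x v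
    using that by (intro dword_basis_mem) (simp add: dwords_def del: in_lists_conv_set)
  have gen: "dword_basis K ([], x, []) \<in> carrier (free_dia K X)" if "x \<in> X" for x
    using that by (intro dword_basis_mem) (auto simp: dwords_def)
  have 1: "f (dword_basis K (u, x, [])) = g (dword_basis K (u, x, []))" if "u \<in> lists X" "x \<in> X" for u x
    using that
  proof (induction u)
    case (Cons y u)
    have "dword_basis K (y # u, x, []) = dword_basis K ([], y, []) \<turnstile>\<^bsub>free_dia K X\<^esub> dword_basis K (u, x, [])"
      by (simp add: free_dia_basis_mult)
    moreover have "dword_basis K (u, x, []) \<in> carrier (free_dia K X)"
      using Cons by (intro mem) simp_all
    ultimately show ?case using Cons eq gen dia_hom_mult[OF f] dia_hom_mult[OF g] by auto
  qed (simp add: eq)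
  have 2: "f (dword_basis K (u, x, v)) = g (dword_basis K (u, x, v))"
    if "u \<in> lists X" "x \<in> X" "v \<in> lists X" for u x v
    using that(3)
  proof (induction v rule: rev_induct)
    case (snoc y v)
    have "dword_basis K (u, x, v @ [y]) = dword_basis K (u, x, v) \<stileturn>\<^bsub>free_dia K X\<^esub> dword_basis K ([], y, [])"
      by (simp add: free_dia_basis_mult)
    moreover have "dword_basis K (u, x, v) \<in> carrier (free_dia K X)"
      using snoc.prems that by (intro mem) simp_all
    ultimately show ?case using snoc eq gen dia_hom_mult[OF f] dia_hom_mult[OF g] by auto
  qed (simp add: 1 that)
  have "f \<in> module_hom K (free_dia K X) L" "g \<in> module_hom K (free_dia K X) L"
    using f g by (auto simp: dia_hom_def linear_map_def mod_hom_def mod_hom_axioms_def)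
  from free_dia_hom_eq[OF vectorspace_axioms this _ a] 2 show ?thesis by (auto simp: dwords_def)
qed

end

section \<open>Free presentations\<close>

locale dia_presentation = diassociative_algebra K L for K and L (structure) +
  fixes X :: "'x set" and p
  assumes presentation: "free_presentation K X L p"
begin

abbreviation "F \<equiv> free_dia K X"
abbreviation "R \<equiv> a_kernel F L p"

sublocale F: diassociative_algebra K F
  by (rule free_dia_diassociative)

lemma p_hom: "dia_hom K F L p" and p_surj: "p ` carrier F = carrier L"
  using presentation by (auto simp: free_presentation_def)

sublocale p: linear_map K F L p
  using p_hom by (rule dia_hom_linear_map)

lemma ball_carrier_iff: "(\<forall>x\<in>carrier L. Q x) \<longleftrightarrow> (\<forall>a\<in>carrier F. Q (p a))"
  unfolding p_surj[symmetric] by blast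

lemma kernel_iff: "a \<in> R \<longleftrightarrow> a \<in> carrier F \<and> p a = \<zero>"
  by (auto simp: a_kernel_def kernel_def)

lemma kernel_subspace: "subspace K R F"
  by (rule subspaceI[OF F.vectorspace_axioms]) (auto simp: kernel_iff)

lemma kernel_subset: "R \<subseteq> carrier F"
  by (auto simp: kernel_iff)

text \<open>Free algebras are projective: preimages under \<open>w\<close> of the images of the
  generators are chosen and extended to F. The composite with \<open>w\<close> equals
  \<open>p\<close> because the two agree on generators.\<close>

lemma lift:
  assumes E: "diassociative_algebra K E" and w: "dia_hom K E L w" "w ` carrier E = carrier L"
  shows "\<exists>P. dia_hom K F E P \<and> (\<forall>a\<in>carrier F. w (P a) = p a)"
proof -
  interpret E: diassociative_algebra K E by fact
  have gen: "dword_basis K ([], x, []) \<in> carrier F" if "x \<in> X" for x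
    using that by (intro dword_basis_mem) (auto simp: dwords_def)
  define e where "e x = inv_into (carrier E) w (p (dword_basis K ([], x, [])))" for x
  have e: "e x \<in> carrier E" "w (e x) = p (dword_basis K ([], x, []))" if "x \<in> X" for x
  proof -
    have "p (dword_basis K ([], x, [])) \<in> w ` carrier E" using gen[OF that] w(2) by simp
    then show "e x \<in> carrier E" "w (e x) = p (dword_basis K ([], x, []))"
      by (auto simp: e_def inv_into_into f_inv_into_f)
  qed
  obtain P where P: "dia_hom K F E P" "\<And>x. x \<in> X \<Longrightarrow> P (dword_basis K ([], x, [])) = e x"
    using E.free_dia_lift[of X e] e(1) by blast
  have "(w \<circ> P) a = p a" if "a \<in> carrier F" for a
    by (rule free_dia_hom_eqI[OF dia_hom_comp[OF P(1) w(1)] p_hom _ that]) (use P e in simp)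
  then show ?thesis using P by auto
qed

text \<open>A linear form on \<open>F\<close> represents a cocycle \<open>c\<close> of \<open>L\<close> if \<open>a \<mapsto> (p a, \<phi> a)\<close> is a homomorphism
  from \<open>F\<close> to the extension of \<open>L\<close> determined by \<open>c\<close>.\<close>

definition represents where
  "represents \<phi> c \<longleftrightarrow> \<phi> \<in> linear_forms K F \<and> c \<in> cocycles K L \<and>
     (\<forall>a\<in>carrier F. \<forall>b\<in>carrier F.
        \<phi> (a \<stileturn>\<^bsub>F\<^esub> b) = fst c (p a, p b) \<and> \<phi> (a \<turnstile>\<^bsub>F\<^esub> b) = snd c (p a, p b))"

lemma representsD:
  assumes "represents \<phi> c"
  shows "\<phi> \<in> linear_forms K F" "c \<in> cocycles K L"
    and "a \<in> carrier F \<Longrightarrow> b \<in> carrier F \<Longrightarrow> \<phi> (a \<stileturn>\<^bsub>F\<^esub> b) = fst c (p a, p b)"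
    and "a \<in> carrier F \<Longrightarrow> b \<in> carrier F \<Longrightarrow> \<phi> (a \<turnstile>\<^bsub>F\<^esub> b) = snd c (p a, p b)"
  using assms by (auto simp: represents_def)

lemma cocycle_represented:
  assumes c: "c \<in> cocycles K L"
  shows "\<exists>\<phi>. represents \<phi> c"
proof -
  let ?E = "ext_dia K L c"
  interpret E: diassociative_algebra K ?E by (rule ext_dia[OF c])
  have "fst ` carrier ?E = carrier L"
    using ext_dia_central_extension[OF c] by (simp add: central_extension_def)
  then obtain P where P: "dia_hom K F ?E P" "\<And>a. a \<in> carrier F \<Longrightarrow> fst (P a) = p a"
    using lift[OF E.diassociative_algebra_axioms ext_dia_fst_hom[OF c]] by blast
  interpret P: linear_map K F ?E P using P(1) by (rule dia_hom_linear_map)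
  have PE: "P a \<in> carrier L \<times> carrier K" if "a \<in> carrier F" for a
    using P.f_im[OF that] by (simp add: ext_dia_def)
  have "(\<lambda>a. snd (P a)) \<in> linear_forms K F"
    unfolding linear_forms_iff
  proof (intro conjI ballI Pi_I)
    show "snd (P a) \<in> carrier K" if "a \<in> carrier F" for a using PE[OF that] by auto
    show "snd (P (a \<oplus>\<^bsub>F\<^esub> b)) = snd (P a) \<oplus>\<^bsub>K\<^esub> snd (P b)" if "a \<in> carrier F" "b \<in> carrier F" for a b
      using P.f_add[OF that] by (simp add: ext_dia_def)
    show "snd (P (k \<odot>\<^bsub>F\<^esub> a)) = k \<otimes>\<^bsub>K\<^esub> snd (P a)" if "k \<in> carrier K" "a \<in> carrier F" for k a
      using P.f_smult[OF that] by (simp add: ext_dia_def)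
  qed
  then have "represents (\<lambda>a. snd (P a)) c"
    using c P(2) dia_hom_mult[OF P(1)] by (auto simp: represents_def ext_dia_def)
  then show ?thesis by blast
qed

lemma represents_commutator_part:
  assumes "represents \<phi> c" "m \<in> commutator_part K F R"
  shows "\<phi> m = \<zero>\<^bsub>K\<^esub>"
proof -
  note r = representsD[OF assms(1)]
  note \<phi> = F.linear_form_simps[OF r(1)]
  have "commutator_part K F R \<subseteq> {m \<in> carrier F. \<phi> m = \<zero>\<^bsub>K\<^esub>}"
  proof (rule F.commutator_part_least[OF kernel_subset])
    show "subspace K {m \<in> carrier F. \<phi> m = \<zero>\<^bsub>K\<^esub>} F"
      by (rule subspaceI[OF F.vectorspace_axioms]) (auto simp: \<phi>)
  qed (auto simp: kernel_iff r(3,4) cocycle_zero[OF r(2)])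
  then show ?thesis using assms(2) by blast
qed

text \<open>A set-theoretic section \<open>g\<close> of \<open>p\<close> defines c (x, y) as the
  value of \<phi> on the product of \<open>g x\<close> and \<open>g y\<close>. Since \<phi> kills
  [F, R], other preimages give the same value, so bilinearity and the cocycle conditions are
  inherited from F.\<close>

lemma form_represents:
  assumes \<phi>: "\<phi> \<in> linear_forms K F" and 0: "\<And>m. m \<in> commutator_part K F R \<Longrightarrow> \<phi> m = \<zero>\<^bsub>K\<^esub>"
  shows "\<exists>c. represents \<phi> c"
proof -
  note \<phi>s = F.linear_form_simps[OF \<phi>]
  define g where "g = inv_into (carrier F) p"
  have g: "g x \<in> carrier F" "p (g x) = x" if "x \<in> carrier L" for x
    using p_surj that by (auto simp: g_def inv_into_into f_inv_into_f)
  \<comment> \<open>Uses a b - a' b' = (a - a') b + a' (b - b') for both products; both summands lie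
    in [F, R].\<close>
  have well: "\<phi> (a \<stileturn>\<^bsub>F\<^esub> b) = \<phi> (a' \<stileturn>\<^bsub>F\<^esub> b') \<and> \<phi> (a \<turnstile>\<^bsub>F\<^esub> b) = \<phi> (a' \<turnstile>\<^bsub>F\<^esub> b')"
    if ab: "a \<in> carrier F" "b \<in> carrier F" "a' \<in> carrier F" "b' \<in> carrier F" "p a = p a'" "p b = p b'" for a b a' b'
  proof -
    have R: "a \<ominus>\<^bsub>F\<^esub> a' \<in> R" "b \<ominus>\<^bsub>F\<^esub> b' \<in> R" using ab by (auto simp: kernel_iff)
    note m = F.commutator_part_mem[OF kernel_subset]
    have "\<phi> ((a \<ominus>\<^bsub>F\<^esub> a') \<stileturn>\<^bsub>F\<^esub> b) = \<zero>\<^bsub>K\<^esub>" "\<phi> (a' \<stileturn>\<^bsub>F\<^esub> (b \<ominus>\<^bsub>F\<^esub> b')) = \<zero>\<^bsub>K\<^esub>"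
      "\<phi> ((a \<ominus>\<^bsub>F\<^esub> a') \<turnstile>\<^bsub>F\<^esub> b) = \<zero>\<^bsub>K\<^esub>" "\<phi> (a' \<turnstile>\<^bsub>F\<^esub> (b \<ominus>\<^bsub>F\<^esub> b')) = \<zero>\<^bsub>K\<^esub>"
      using 0 m[OF ab(2) R(1)] m[OF ab(3) R(2)] by auto
    then show ?thesis using ab by (simp add: F.dia_minus \<phi>s)
  qed
  define fl fr where "fl x y = \<phi> (g x \<stileturn>\<^bsub>F\<^esub> g y)" and "fr x y = \<phi> (g x \<turnstile>\<^bsub>F\<^esub> g y)" for x y
  have f: "fl (p a) (p b) = \<phi> (a \<stileturn>\<^bsub>F\<^esub> b)" "fr (p a) (p b) = \<phi> (a \<turnstile>\<^bsub>F\<^esub> b)"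
    if "a \<in> carrier F" "b \<in> carrier F" for a b
    using well[of "g (p a)" "g (p b)" a b] g that by (auto simp: fl_def fr_def)
  have lin: "(\<lambda>y. fl x y) \<in> linear_forms K L \<and> (\<lambda>y. fl y x) \<in> linear_forms K L \<and>
       (\<lambda>y. fr x y) \<in> linear_forms K L \<and> (\<lambda>y. fr y x) \<in> linear_forms K L" if x: "x \<in> carrier L" for x
  proof -
    obtain a where a: "a \<in> carrier F" "x = p a" using x p_surj by blast
    have add: "fl (p a) (p b \<oplus> p d) = fl (p a) (p b) \<oplus>\<^bsub>K\<^esub> fl (p a) (p d)"
      "fl (p b \<oplus> p d) (p a) = fl (p b) (p a) \<oplus>\<^bsub>K\<^esub> fl (p d) (p a)"
      "fr (p a) (p b \<oplus> p d) = fr (p a) (p b) \<oplus>\<^bsub>K\<^esub> fr (p a) (p d)"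
      "fr (p b \<oplus> p d) (p a) = fr (p b) (p a) \<oplus>\<^bsub>K\<^esub> fr (p d) (p a)"
      if "b \<in> carrier F" "d \<in> carrier F" for b d
      using a(1) that by (simp_all add: f F.dia_add \<phi>s flip: p.f_add)
    have smult: "fl (p a) (k \<odot> p b) = k \<otimes>\<^bsub>K\<^esub> fl (p a) (p b)"
      "fl (k \<odot> p b) (p a) = k \<otimes>\<^bsub>K\<^esub> fl (p b) (p a)"
      "fr (p a) (k \<odot> p b) = k \<otimes>\<^bsub>K\<^esub> fr (p a) (p b)"
      "fr (k \<odot> p b) (p a) = k \<otimes>\<^bsub>K\<^esub> fr (p b) (p a)"
      if "k \<in> carrier K" "b \<in> carrier F" for k b
      using a(1) that by (simp_all add: f F.dia_smult \<phi>s flip: p.f_smult)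
    have closed: "fl (p a) (p b) \<in> carrier K" "fl (p b) (p a) \<in> carrier K"
      "fr (p a) (p b) \<in> carrier K" "fr (p b) (p a) \<in> carrier K" if "b \<in> carrier F" for b
      using a(1) that by (simp_all add: f \<phi>s)
    show ?thesis
      unfolding linear_forms_iff a(2) Pi_iff ball_carrier_iff
      by (intro conjI ballI add smult closed)
  qed
  have "cocycle fl fr"
    unfolding cocycle_def
  proof (intro conjI)
    show "\<forall>i\<in>carrier L. \<forall>j\<in>carrier L. \<forall>k\<in>carrier L.
        fl i (j \<stileturn> k) = fl i (j \<turnstile> k) \<and>
        fl (i \<turnstile> j) k = fr i (j \<stileturn> k) \<and>
        fr (i \<stileturn> j) k = fr (i \<turnstile> j) k \<and>
        fl i (j \<stileturn> k) = fl (i \<stileturn> j) k \<and>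
        fr i (j \<turnstile> k) = fr (i \<turnstile> j) k"
      unfolding ball_carrier_iff
      by (simp add: f F.ldia_assoc F.rdia_assoc F.rdia_ldia F.ldia_rdia_rdia
          flip: dia_hom_mult[OF p_hom] F.ldia_ldia_rdia)
  qed (use lin in blast)
  from cocycles_restrictI[OF this] have "represents \<phi>
      (\<lambda>(x, y)\<in>carrier L \<times> carrier L. fl x y, \<lambda>(x, y)\<in>carrier L \<times> carrier L. fr x y)"
    using \<phi> f by (simp add: represents_def)
  then show ?thesis by blast
qed

text \<open>The cocycle prescribes the form on products, and these span F'. Outside F' a
  representing form is arbitrary.\<close>

lemma represents_unique:
  assumes "represents \<phi> c" "represents \<psi> c" "m \<in> derived_ideal K F"
  shows "\<phi> m = \<psi> m"
proof -
  note r = representsD[OF assms(1)] and r' = representsD[OF assms(2)]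
  have "derived_ideal K F \<subseteq> {m \<in> carrier F. \<phi> m = \<psi> m}"
  proof (rule F.derived_ideal_least)
    show "subspace K {m \<in> carrier F. \<phi> m = \<psi> m} F"
      by (rule subspaceI[OF F.vectorspace_axioms])
        (auto simp: F.linear_form_simps[OF r(1)] F.linear_form_simps[OF r'(1)])
  qed (auto simp: r r')
  then show ?thesis using assms(3) by blast
qed

text \<open>By \<open>represents_unique\<close> the choice affects values outside F' only, so the
  induced pairing of cocycles with F' is canonical.\<close>

definition form where "form c = (SOME \<phi>. represents \<phi> c)"

lemma form: "c \<in> cocycles K L \<Longrightarrow> represents (form c) c"
  unfolding form_def using cocycle_represented by (rule someI_ex)

text \<open>Although \<open>form c\<close> is chosen separately for each c, its value on F' is
  linear in c: sums and multiples of representing forms represent the sums and multiples of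
  cocycles, and uniqueness applies.\<close>

lemma form_linear:
  assumes m: "m \<in> derived_ideal K F"
  shows "(\<lambda>c. form c m) \<in> linear_forms K (Z2)"
proof -
  interpret Z: vectorspace K "Z2" by (rule cocycle_space_vectorspace)
  have mF: "m \<in> carrier F" using m subspaceD(2)[OF F.derived_ideal_subspace] by blast
  have closed: "form c a \<in> carrier K" if "c \<in> cocycles K L" "a \<in> carrier F" for c a
    using F.linear_form_simps(1)[OF representsD(1)[OF form]] that by blast
  show ?thesis
    unfolding linear_forms_iff
  proof (intro conjI ballI Pi_I)
    fix c assume c: "c \<in> carrier (Z2)"
    then show "form c m \<in> carrier K" using closed mF by simp
    note fc = form[of c] and rc = F.linear_form_simps[OF representsD(1)[OF form[of c]]]
    show "form (k \<odot>\<^bsub>Z2\<^esub> c) m = k \<otimes>\<^bsub>K\<^esub> form c m" if k: "k \<in> carrier K" for k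
    proof (rule represents_unique[OF form _ m])
      show "k \<odot>\<^bsub>Z2\<^esub> c \<in> cocycles K L" using Z.smult_closed[OF k c] by simp
      then show "represents (\<lambda>m. k \<otimes>\<^bsub>K\<^esub> form c m) (k \<odot>\<^bsub>Z2\<^esub> c)"
        using c k rc representsD[OF fc]
        by (auto simp: represents_def linear_forms_iff cocycle_space_ops R.m_ac R.r_distr)
    qed
    fix d assume d: "d \<in> carrier (Z2)"
    note fd = form[of d] and rd = F.linear_form_simps[OF representsD(1)[OF form[of d]]]
    show "form (c \<oplus>\<^bsub>Z2\<^esub> d) m = form c m \<oplus>\<^bsub>K\<^esub> form d m"
    proof (rule represents_unique[OF form _ m])
      show "c \<oplus>\<^bsub>Z2\<^esub> d \<in> cocycles K L" using Z.M.a_closed[OF c d] by simp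
      then show "represents (\<lambda>m. form c m \<oplus>\<^bsub>K\<^esub> form d m) (c \<oplus>\<^bsub>Z2\<^esub> d)"
        using c d rc representsD[OF fc] rd representsD[OF fd]
        by (auto simp: represents_def linear_forms_iff cocycle_space_ops R.a_ac R.r_distr)
    qed
  qed
qed

lemma commutator_part_iff:
  assumes m: "m \<in> carrier F"
  shows "m \<in> commutator_part K F R \<longleftrightarrow> (\<forall>\<phi> c. represents \<phi> c \<longrightarrow> \<phi> m = \<zero>\<^bsub>K\<^esub>)"
proof
  show "m \<in> commutator_part K F R" if "\<forall>\<phi> c. represents \<phi> c \<longrightarrow> \<phi> m = \<zero>\<^bsub>K\<^esub>"
  proof (rule ccontr)
    assume "m \<notin> commutator_part K F R"
    then obtain \<phi> where \<phi>: "\<phi> \<in> linear_forms K F" "\<phi> m \<noteq> \<zero>\<^bsub>K\<^esub>"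
      "\<forall>x\<in>commutator_part K F R. \<phi> x = \<zero>\<^bsub>K\<^esub>"
      using F.separating_linear_form[OF F.commutator_part_subspace[OF kernel_subset] m] by blast
    then show False using form_represents[OF \<phi>(1)] that by blast
  qed
qed (use represents_commutator_part in blast)

text \<open>For m in F' the value of a representing form depends on the cocycle alone, so one form
  per cocycle tests membership.\<close>

lemma commutator_part_derived_iff:
  assumes m: "m \<in> derived_ideal K F"
  shows "m \<in> commutator_part K F R \<longleftrightarrow> (\<forall>c\<in>cocycles K L. form c m = \<zero>\<^bsub>K\<^esub>)"
proof -
  have "m \<in> carrier F" using m subspaceD(2)[OF F.derived_ideal_subspace] by blast
  show ?thesis
  proof
    assume "\<forall>c\<in>cocycles K L. form c m = \<zero>\<^bsub>K\<^esub>"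
    then have "\<phi> m = \<zero>\<^bsub>K\<^esub>" if "represents \<phi> c" for \<phi> c
      using represents_unique[OF that form[OF representsD(2)[OF that]] m] representsD(2)[OF that] by simp
    then show "m \<in> commutator_part K F R"
      unfolding commutator_part_iff[OF \<open>m \<in> carrier F\<close>] by blast
  next
    assume "m \<in> commutator_part K F R"
    then show "\<forall>c\<in>cocycles K L. form c m = \<zero>\<^bsub>K\<^esub>"
      using represents_commutator_part form by blast
  qed
qed

text \<open>The form \<phi> itself need not vanish on R, so it cannot simply descend to L. It is
  replaced by a form that agrees with it on F' and vanishes on R, which exists because \<phi> is
  zero on F' \<inter> R. Applied to the form of a cocycle of L/Z, this decides whether the inflated
  cocycle is a coboundary of L.\<close>

lemma form_factors_iff:
  assumes \<phi>: "\<phi> \<in> linear_forms K F"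
  shows "(\<forall>m\<in>derived_ideal K F \<inter> R. \<phi> m = \<zero>\<^bsub>K\<^esub>) \<longleftrightarrow>
    (\<exists>\<psi>\<in>linear_forms K L. \<forall>a\<in>carrier F. \<forall>b\<in>carrier F.
       \<phi> (a \<stileturn>\<^bsub>F\<^esub> b) = \<psi> (p a \<stileturn> p b) \<and> \<phi> (a \<turnstile>\<^bsub>F\<^esub> b) = \<psi> (p a \<turnstile> p b))"
proof
  assume 0: "\<forall>m\<in>derived_ideal K F \<inter> R. \<phi> m = \<zero>\<^bsub>K\<^esub>"
  have "\<phi> \<in> linear_forms K (F\<lparr>carrier := derived_ideal K F\<rparr>)"
    using \<phi> subspaceD(2)[OF F.derived_ideal_subspace] by (auto simp: linear_forms_iff subset_iff)
  then obtain \<chi> where \<chi>: "\<chi> \<in> linear_forms K F" "\<And>m. m \<in> derived_ideal K F \<Longrightarrow> \<chi> m = \<phi> m"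
    "\<And>m. m \<in> R \<Longrightarrow> \<chi> m = \<zero>\<^bsub>K\<^esub>"
    using F.linear_form_extension[OF F.derived_ideal_subspace kernel_subspace] 0 by blast
  note \<chi>s = F.linear_form_simps[OF \<chi>(1)]
  define g where "g = inv_into (carrier F) p"
  have g: "g x \<in> carrier F" "p (g x) = x" if "x \<in> carrier L" for x
    using p_surj that by (auto simp: g_def inv_into_into f_inv_into_f)
  have f: "\<chi> (g (p a)) = \<chi> a" if "a \<in> carrier F" for a
  proof -
    have "g (p a) \<ominus>\<^bsub>F\<^esub> a \<in> R" using g that by (auto simp: kernel_iff)
    then have "\<chi> (g (p a) \<ominus>\<^bsub>F\<^esub> a) = \<zero>\<^bsub>K\<^esub>" by (rule \<chi>(3))
    then show ?thesis using g that by (simp add: \<chi>s)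
  qed
  have "(\<lambda>x. \<chi> (g x)) \<in> linear_forms K L"
    unfolding linear_forms_iff Pi_iff ball_carrier_iff
    by (simp add: f \<chi>s flip: p.f_add p.f_smult)
  moreover have *: "\<phi> (a \<stileturn>\<^bsub>F\<^esub> b) = \<chi> (g (p a \<stileturn> p b)) \<and> \<phi> (a \<turnstile>\<^bsub>F\<^esub> b) = \<chi> (g (p a \<turnstile> p b))"
    if "a \<in> carrier F" "b \<in> carrier F" for a b
    using that \<chi>(2) F.derived_ideal_mem by (simp add: f flip: dia_hom_mult[OF p_hom])
  ultimately show "\<exists>\<psi>\<in>linear_forms K L. \<forall>a\<in>carrier F. \<forall>b\<in>carrier F.
       \<phi> (a \<stileturn>\<^bsub>F\<^esub> b) = \<psi> (p a \<stileturn> p b) \<and> \<phi> (a \<turnstile>\<^bsub>F\<^esub> b) = \<psi> (p a \<turnstile> p b)"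
    by (intro bexI[of _ "\<lambda>x. \<chi> (g x)"] ballI *)
next
  assume "\<exists>\<psi>\<in>linear_forms K L. \<forall>a\<in>carrier F. \<forall>b\<in>carrier F.
       \<phi> (a \<stileturn>\<^bsub>F\<^esub> b) = \<psi> (p a \<stileturn> p b) \<and> \<phi> (a \<turnstile>\<^bsub>F\<^esub> b) = \<psi> (p a \<turnstile> p b)"
  then obtain \<psi> where \<psi>: "\<psi> \<in> linear_forms K L" "\<And>a b. a \<in> carrier F \<Longrightarrow> b \<in> carrier F \<Longrightarrow>
       \<phi> (a \<stileturn>\<^bsub>F\<^esub> b) = \<psi> (p a \<stileturn> p b) \<and> \<phi> (a \<turnstile>\<^bsub>F\<^esub> b) = \<psi> (p a \<turnstile> p b)" by blast
  have "derived_ideal K F \<subseteq> {m \<in> carrier F. \<phi> m = \<psi> (p m)}"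
  proof (rule F.derived_ideal_least)
    show "subspace K {m \<in> carrier F. \<phi> m = \<psi> (p m)} F"
      by (rule subspaceI[OF F.vectorspace_axioms])
        (auto simp: F.linear_form_simps[OF \<phi>] linear_form_simps[OF \<psi>(1)])
  qed (auto simp: \<psi> dia_hom_mult[OF p_hom])
  then show "\<forall>m\<in>derived_ideal K F \<inter> R. \<phi> m = \<zero>\<^bsub>K\<^esub>"
    by (auto simp: kernel_iff linear_form_simps[OF \<psi>(1)])
qed

end

section \<open>The multiplier\<close>

lemma (in vectorspace) linear_forms_eq_on_span:
  assumes f: "f \<in> linear_forms K V" and g: "g \<in> linear_forms K V"
    and S: "S \<subseteq> carrier V" "span S = carrier V" "\<And>x. x \<in> S \<Longrightarrow> f x = g x"
    and x: "x \<in> carrier V"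
  shows "f x = g x"
proof -
  have "subspace K {x \<in> carrier V. f x = g x} V"
    by (rule subspaceI[OF vectorspace_axioms]) (auto simp: linear_form_simps[OF f] linear_form_simps[OF g])
  then have "span S \<subseteq> {x \<in> carrier V. f x = g x}"
    using S by (intro span_is_subset is_module) auto
  then show ?thesis using S x by blast
qed

lemma (in vectorspace) subspace_inter:
  assumes "subspace K U V" "subspace K W V"
  shows "subspace K (U \<inter> W) V"
  by (rule subspaceI[OF vectorspace_axioms])
    (use subspaceD[OF assms(1)] subspaceD[OF assms(2)] in auto)

text \<open>A cocycle is determined by its values on pairs from a finite spanning set B of L. These
  evaluations are finitely many linear forms that separate cocycles, so
  \<open>finite_forms_span\<close> supplies the spanning set.\<close>

lemma (in diassociative_algebra) cocycles_finite_span: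
  assumes "fin_dim"
  shows "\<exists>S. finite S \<and> S \<subseteq> cocycles K L \<and> LinearCombinations.module.span K (Z2) S = cocycles K L"
proof -
  interpret Z: vectorspace K "Z2" by (rule cocycle_space_vectorspace)
  obtain B where B: "finite B" "B \<subseteq> carrier L" "span B = carrier L"
    using assms by (auto simp: fin_dim_def)
  define ev where "ev i c = (case i of (x, y, l) \<Rightarrow> if l then fst c (x, y) else snd c (x, y))"
    for i :: "'a \<times> 'a \<times> bool" and c :: "('a \<times> 'a \<Rightarrow> 'k) \<times> ('a \<times> 'a \<Rightarrow> 'k)"
  let ?I = "B \<times> B \<times> (UNIV :: bool set)"
  have "ev i \<in> linear_forms K (Z2)" if "i \<in> ?I" for i
  proof -
    obtain x y l where i: "i = (x, y, l)" by (rule prod_cases3)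
    with that B(2) have xy: "x \<in> carrier L" "y \<in> carrier L" by auto
    show ?thesis
      unfolding linear_forms_iff
      by (intro conjI ballI Pi_I) (simp_all add: ev_def i xy cocycle_closed cocycle_space_ops)
  qed
  then obtain S where S: "finite S" "S \<subseteq> cocycles K L"
    and span: "\<And>c. c \<in> cocycles K L \<Longrightarrow> \<exists>d\<in>Z.span S. \<forall>i\<in>?I. ev i d = ev i c"
    using Z.finite_forms_span[of ?I ev] B(1) by auto
  have SZ: "Z.span S \<subseteq> cocycles K L"
    using Z.span_is_subset2[of S] S(2) by simp
  have "c \<in> Z.span S" if c: "c \<in> cocycles K L" for c
  proof -
    obtain d where d: "d \<in> Z.span S" "\<And>i. i \<in> ?I \<Longrightarrow> ev i d = ev i c" using span[OF c] by blast
    have dZ: "d \<in> cocycles K L" using d(1) SZ by blast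
    have BB: "fst d (x, y) = fst c (x, y)" "snd d (x, y) = snd c (x, y)" if "x \<in> B" "y \<in> B" for x y
      using d(2)[of "(x, y, True)"] d(2)[of "(x, y, False)"] that by (simp_all add: ev_def)
    \<comment> \<open>Agreement on pairs from B spreads to all of L one argument at a time,
      beginning with the second.\<close>
    have BL: "fst d (x, y) = fst c (x, y)" "snd d (x, y) = snd c (x, y)" if x: "x \<in> B" and y: "y \<in> carrier L" for x y
    proof -
      have xL: "x \<in> carrier L" using x B(2) by blast
      show "fst d (x, y) = fst c (x, y)"
        by (rule linear_forms_eq_on_span[OF cocycle_forms(1)[OF dZ xL] cocycle_forms(1)[OF c xL] B(2,3) BB(1)[OF x] y])
      show "snd d (x, y) = snd c (x, y)"
        by (rule linear_forms_eq_on_span[OF cocycle_forms(3)[OF dZ xL] cocycle_forms(3)[OF c xL] B(2,3) BB(2)[OF x] y])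
    qed
    have "d = c"
    proof (rule cocycles_eqI[OF dZ c], rule conjI)
      fix x y assume x: "x \<in> carrier L" and y: "y \<in> carrier L"
      show "fst d (x, y) = fst c (x, y)"
        by (rule linear_forms_eq_on_span[OF cocycle_forms(2)[OF dZ y] cocycle_forms(2)[OF c y] B(2,3) BL(1)[OF _ y] x])
      show "snd d (x, y) = snd c (x, y)"
        by (rule linear_forms_eq_on_span[OF cocycle_forms(4)[OF dZ y] cocycle_forms(4)[OF c y] B(2,3) BL(2)[OF _ y] x])
    qed
    then show ?thesis using d(1) by simp
  qed
  then show ?thesis using S SZ by blast
qed

section \<open>The multiplier as a quotient of F' \<inter> R\<close>

context dia_presentation
begin

abbreviation "FR \<equiv> F\<lparr>carrier := derived_ideal K F \<inter> R\<rparr>"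

lemma FR_vectorspace: "vectorspace K FR"
  by (rule F.subspace_is_vs[OF F.subspace_inter[OF F.derived_ideal_subspace kernel_subspace]])

lemma commutator_part_subset: "commutator_part K F R \<subseteq> derived_ideal K F \<inter> R"
proof -
  have "commutator_part K F R \<subseteq> derived_ideal K F"
    by (rule F.commutator_part_least[OF kernel_subset F.derived_ideal_subspace])
      (use kernel_subset F.derived_ideal_mem in blast)
  moreover have "commutator_part K F R \<subseteq> R"
    by (rule F.commutator_part_least[OF kernel_subset kernel_subspace])
      (auto simp: kernel_iff dia_hom_mult[OF p_hom])
  ultimately show ?thesis by blast
qed

lemma commutator_part_subspace_FR: "subspace K (commutator_part K F R) FR"
  using commutator_part_subset subspaceD[OF F.commutator_part_subspace[OF kernel_subset]]
  by (intro subspaceI[OF FR_vectorspace]) auto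

lemma coset_FR: "W +>\<^bsub>FR\<^esub> x = W +>\<^bsub>F\<^esub> x"
  by (simp add: a_r_coset_def')

lemma multiplier_linear_map:
  "linear_map K FR (multiplier K F R) (\<lambda>m. commutator_part K F R +>\<^bsub>F\<^esub> m)"
  using vectorspace.quot_space_linear_map[OF FR_vectorspace commutator_part_subspace_FR]
  by (simp add: multiplier_def coset_FR)

lemma multiplier_carrier:
  "(\<lambda>m. commutator_part K F R +>\<^bsub>F\<^esub> m) ` carrier FR = carrier (multiplier K F R)"
  using vectorspace.quot_space_surj[OF FR_vectorspace commutator_part_subspace_FR]
  by (simp add: multiplier_def coset_FR)

lemma multiplier_zero_iff:
  assumes "m \<in> derived_ideal K F \<inter> R"
  shows "commutator_part K F R +>\<^bsub>F\<^esub> m = \<zero>\<^bsub>multiplier K F R\<^esub> \<longleftrightarrow> m \<in> commutator_part K F R"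
  using vectorspace.quot_space_zero_iff[OF FR_vectorspace commutator_part_subspace_FR, of m] assms
  by (simp add: multiplier_def coset_FR)

text \<open>Finitely many cocycles that span all of them already detect [F, R] inside F' \<inter> R,
  so their forms separate the points of the quotient. The space F' \<inter> R itself may have
  infinite dimension.\<close>

lemma multiplier_fin_dim:
  assumes "fin_dim"
  shows "vectorspace.fin_dim K (multiplier K F R)"
proof -
  interpret Z: vectorspace K "Z2" by (rule cocycle_space_vectorspace)
  obtain S where S: "finite S" "S \<subseteq> cocycles K L" "Z.span S = cocycles K L"
    using cocycles_finite_span[OF assms] by blast
  show ?thesis
  proof (rule fin_dim_by_forms(1)[OF multiplier_linear_map multiplier_carrier S(1), of form])
    show "form c \<in> linear_forms K FR" if "c \<in> S" for c
    proof -
      have "form c \<in> linear_forms K F" using representsD(1)[OF form] S(2) that by blast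
      then show ?thesis
        using subspaceD(2)[OF F.derived_ideal_subspace] by (auto simp: linear_forms_iff subset_iff)
    qed
    fix m assume m: "m \<in> carrier FR" and 0: "\<And>c. c \<in> S \<Longrightarrow> form c m = \<zero>\<^bsub>K\<^esub>"
    have "(\<lambda>_. \<zero>\<^bsub>K\<^esub>) \<in> linear_forms K (Z2)" by (auto simp: linear_forms_iff)
    then have "form c m = \<zero>\<^bsub>K\<^esub>" if "c \<in> cocycles K L" for c
      using Z.linear_forms_eq_on_span[OF form_linear, of m "\<lambda>_. \<zero>\<^bsub>K\<^esub>" S c] S(2,3) m 0 that by simp
    then show "commutator_part K F R +>\<^bsub>F\<^esub> m = \<zero>\<^bsub>multiplier K F R\<^esub>"
      using m multiplier_zero_iff commutator_part_derived_iff by simp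
  qed
qed

end

section \<open>Central ideals\<close>

locale central_presentation = dia_presentation K L X p for K :: "('k, 'r) ring_scheme" and L :: "('k, 'a, 'l) dialgebra_scheme" (structure)
    and X :: "'x set" and p +
  fixes Z
  assumes central: "central_ideal K L Z"
begin

lemma Z_ideal: "dia_ideal K L Z"
  using central by (simp add: central_ideal_def)

lemma Z_subspace: "subspace K Z L"
  by (rule dia_ideal_subspace[OF Z_ideal])

lemma Z_mult:
  assumes "z \<in> Z" "x \<in> carrier L"
  shows "z \<in> carrier L" "z \<stileturn> x = \<zero>" "x \<stileturn> z = \<zero>" "z \<turnstile> x = \<zero>" "x \<turnstile> z = \<zero>"
  using central assms by (auto simp: central_ideal_def center_def)

abbreviation "Q \<equiv> quot_dia L Z"
abbreviation "T \<equiv> {a \<in> carrier F. p a \<in> Z}"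

text \<open>The generators of L also present L/Z, with T in place of R. A second interpretation of
  the locale makes the dictionary between forms and cocycles available for L/Z over the same
  F.\<close>

lemma quot_presentation: "dia_presentation K Q X (\<lambda>a. Z +> p a)"
proof -
  interpret Q: diassociative_algebra K Q by (rule quot_dia_hom[OF Z_ideal])
  have "(\<lambda>a. Z +> p a) ` carrier F = carrier Q"
    unfolding quot_dia_carrier[OF Z_ideal] p_surj[symmetric] by (simp add: image_image)
  then show ?thesis
    using dia_hom_comp[OF p_hom quot_dia_hom(2)[OF Z_ideal]] Q.diassociative_algebra_axioms
    by (auto simp: dia_presentation_def dia_presentation_axioms_def free_presentation_def comp_def)
qed

sublocale Q: dia_presentation K Q X "\<lambda>a. Z +> p a"
  by (rule quot_presentation)

lemma quot_kernel: "a_kernel F Q (\<lambda>a. Z +> p a) = T"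
  by (auto simp: Q.kernel_iff quot_dia_zero_iff[OF Z_ideal])

lemma T_subset: "T \<subseteq> carrier F" by auto

lemma commutator_part_mono: "commutator_part K F R \<subseteq> commutator_part K F T"
  by (rule F.commutator_part_least[OF kernel_subset F.commutator_part_subspace[OF T_subset]])
    (use F.commutator_part_mem[OF T_subset] subspaceD(3)[OF Z_subspace] in \<open>auto simp: kernel_iff\<close>)

text \<open>Here centrality of Z enters: \<open>p\<close> maps a product of T with F to a product
  with an element of Z, which is 0.\<close>

lemma commutator_part_T_subset: "commutator_part K F T \<subseteq> derived_ideal K F \<inter> R"
proof -
  have "commutator_part K F T \<subseteq> derived_ideal K F"
    using Q.commutator_part_subset by (simp add: quot_kernel)
  moreover have "commutator_part K F T \<subseteq> R"
    by (rule F.commutator_part_least[OF T_subset kernel_subspace])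
      (auto simp: kernel_iff dia_hom_mult[OF p_hom] Z_mult)
  ultimately show ?thesis by blast
qed

text \<open>The kernel of \<open>beta\<close> is [F, T] / [F, R], because [F, T] is contained in F'
  \<inter> R.\<close>

lemma beta_inj_iff:
  "inj_on (beta K F T) (carrier (multiplier K F R)) \<longleftrightarrow> commutator_part K F T \<subseteq> commutator_part K F R"
proof -
  let ?CR = "commutator_part K F R" and ?CT = "commutator_part K F T"
  note CR = F.commutator_part_subspace[OF kernel_subset] and CT = F.commutator_part_subspace[OF T_subset]
  have DF: "derived_ideal K F \<subseteq> carrier F" by (rule subspaceD(2)[OF F.derived_ideal_subspace])
  have beta: "beta K F T (?CR +>\<^bsub>F\<^esub> m) = ?CT +>\<^bsub>F\<^esub> m" if "m \<in> carrier F" for m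
    unfolding beta_def
  proof (rule F.UN_coset[OF CR that])
    show "?CT +>\<^bsub>F\<^esub> y = ?CT +>\<^bsub>F\<^esub> m" if "y \<in> carrier F" "y \<ominus>\<^bsub>F\<^esub> m \<in> ?CR" for y
      using that \<open>m \<in> carrier F\<close> commutator_part_mono by (simp add: F.coset_eq_iff[OF CT] subset_iff)
  qed
  have N: "vectorspace K FR" by (rule FR_vectorspace)
  show ?thesis
  proof
    assume inj: "inj_on (beta K F T) (carrier (multiplier K F R))"
    show "?CT \<subseteq> ?CR"
    proof
      fix m assume m: "m \<in> ?CT"
      then have mN: "m \<in> derived_ideal K F \<inter> R" and mF: "m \<in> carrier F"
        using commutator_part_T_subset DF by auto
      have zN: "\<zero>\<^bsub>F\<^esub> \<in> derived_ideal K F \<inter> R"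
        using subspaceD(3)[OF F.derived_ideal_subspace] subspaceD(3)[OF kernel_subspace] by blast
      have mem: "?CR +>\<^bsub>F\<^esub> n \<in> carrier (multiplier K F R)" if "n \<in> derived_ideal K F \<inter> R" for n
        using that unfolding multiplier_carrier[symmetric] by (intro imageI) simp
      have "m \<ominus>\<^bsub>F\<^esub> \<zero>\<^bsub>F\<^esub> \<in> ?CT"
        using F.subspace_minus_closed(2)[OF CT m] subspaceD(3)[OF CT] by blast
      then have "beta K F T (?CR +>\<^bsub>F\<^esub> m) = beta K F T (?CR +>\<^bsub>F\<^esub> \<zero>\<^bsub>F\<^esub>)"
        using mF by (simp add: beta F.coset_eq_iff[OF CT])
      then have "?CR +>\<^bsub>F\<^esub> m = ?CR +>\<^bsub>F\<^esub> \<zero>\<^bsub>F\<^esub>"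
        by (rule inj_onD[OF inj _ mem[OF mN] mem[OF zN]])
      then have "m \<ominus>\<^bsub>F\<^esub> \<zero>\<^bsub>F\<^esub> \<in> ?CR" using mF by (simp add: F.coset_eq_iff[OF CR])
      moreover have "\<ominus>\<^bsub>F\<^esub> \<zero>\<^bsub>F\<^esub> = \<zero>\<^bsub>F\<^esub>" using F.M.r_neg[of "\<zero>\<^bsub>F\<^esub>"] by simp
      ultimately show "m \<in> ?CR" using mF by (simp add: a_minus_def)
    qed
  next
    assume sub: "?CT \<subseteq> ?CR"
    show "inj_on (beta K F T) (carrier (multiplier K F R))"
      unfolding multiplier_carrier[symmetric]
    proof (rule inj_onI, clarify)
      fix m n assume "m \<in> carrier FR" "n \<in> carrier FR"
        and eq: "beta K F T (?CR +>\<^bsub>F\<^esub> m) = beta K F T (?CR +>\<^bsub>F\<^esub> n)"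
      then have mn: "m \<in> carrier F" "n \<in> carrier F" using DF by auto
      then show "?CR +>\<^bsub>F\<^esub> m = ?CR +>\<^bsub>F\<^esub> n"
        using eq sub by (auto simp: beta F.coset_eq_iff[OF CT] F.coset_eq_iff[OF CR] subset_iff)
    qed
  qed
qed

definition trivial_on_Z where
  "trivial_on_Z c \<longleftrightarrow> (\<forall>x\<in>carrier L. \<forall>z\<in>Z. fst c (x, z) = \<zero>\<^bsub>K\<^esub> \<and> fst c (z, x) = \<zero>\<^bsub>K\<^esub> \<and>
     snd c (x, z) = \<zero>\<^bsub>K\<^esub> \<and> snd c (z, x) = \<zero>\<^bsub>K\<^esub>)"

text \<open>If \<phi> represents c, the values of c with one argument in Z are the values of \<phi>
  on the products that generate [F, T]. So all cocycles are trivial on Z exactly if all representing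
  forms vanish on [F, T], and the common zeros of these forms are [F, R].\<close>

lemma trivial_iff_commutator_part:
  "(\<forall>c\<in>cocycles K L. trivial_on_Z c) \<longleftrightarrow> commutator_part K F T \<subseteq> commutator_part K F R"
proof
  assume triv: "\<forall>c\<in>cocycles K L. trivial_on_Z c"
  show "commutator_part K F T \<subseteq> commutator_part K F R"
  proof (rule F.commutator_part_least[OF T_subset F.commutator_part_subspace[OF kernel_subset]])
    fix a t assume at: "a \<in> carrier F" "t \<in> T"
    have "\<phi> (a \<stileturn>\<^bsub>F\<^esub> t) = \<zero>\<^bsub>K\<^esub> \<and> \<phi> (a \<turnstile>\<^bsub>F\<^esub> t) = \<zero>\<^bsub>K\<^esub> \<and> \<phi> (t \<stileturn>\<^bsub>F\<^esub> a) = \<zero>\<^bsub>K\<^esub> \<and> \<phi> (t \<turnstile>\<^bsub>F\<^esub> a) = \<zero>\<^bsub>K\<^esub>"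
      if "represents \<phi> c" for \<phi> c
      using representsD[OF that] triv at by (auto simp: trivial_on_Z_def)
    moreover have "m \<in> commutator_part K F R"
      if "m \<in> carrier F" "\<And>\<phi> c. represents \<phi> c \<Longrightarrow> \<phi> m = \<zero>\<^bsub>K\<^esub>" for m
      using commutator_part_iff that by blast
    ultimately show "a \<stileturn>\<^bsub>F\<^esub> t \<in> commutator_part K F R \<and> a \<turnstile>\<^bsub>F\<^esub> t \<in> commutator_part K F R \<and>
      t \<stileturn>\<^bsub>F\<^esub> a \<in> commutator_part K F R \<and> t \<turnstile>\<^bsub>F\<^esub> a \<in> commutator_part K F R"
      using at F.dia_closed[of a t] F.dia_closed[of t a] by blast
  qed
next
  assume sub: "commutator_part K F T \<subseteq> commutator_part K F R"
  show "\<forall>c\<in>cocycles K L. trivial_on_Z c"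
    unfolding trivial_on_Z_def
  proof (intro ballI)
    fix c x z assume c: "c \<in> cocycles K L" and "x \<in> carrier L" "z \<in> Z"
    then obtain a t where at: "a \<in> carrier F" "t \<in> T" "x = p a" "z = p t"
      using p_surj Z_mult(1) by (metis (no_types, lifting) imageE mem_Collect_eq)
    note r = form[OF c]
    have 0: "form c m = \<zero>\<^bsub>K\<^esub>" if "m \<in> commutator_part K F T" for m
      using represents_commutator_part[OF r] sub that by blast
    show "fst c (x, z) = \<zero>\<^bsub>K\<^esub> \<and> fst c (z, x) = \<zero>\<^bsub>K\<^esub> \<and> snd c (x, z) = \<zero>\<^bsub>K\<^esub> \<and> snd c (z, x) = \<zero>\<^bsub>K\<^esub>"
      using 0[OF F.commutator_part_mem(1)[OF T_subset at(1,2)]] 0[OF F.commutator_part_mem(2)[OF T_subset at(1,2)]]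
        0[OF F.commutator_part_mem(3)[OF T_subset at(1,2)]] 0[OF F.commutator_part_mem(4)[OF T_subset at(1,2)]]
        representsD(3,4)[OF r] at by simp
  qed
qed

text \<open>A lift P of \<open>p\<close> to a central extension E maps R into the central kernel of
  \<open>w\<close>, so it kills [F, R] and hence [F, T]. Thus P t annihilates the image of P, and E
  is the sum of this image and the kernel of \<open>w\<close>; so P t is a central preimage of z.
  The argument works for extensions on any type.\<close>

lemma Zstar_if_commutator_part:
  assumes sub: "commutator_part K F T \<subseteq> commutator_part K F R"
  shows "Z \<subseteq> Zstar TYPE('u) K L"
proof
  fix z assume z: "z \<in> Z"
  then obtain t where t: "t \<in> T" "z = p t"
    using p_surj Z_mult(1)[OF z] M.zero_closed by (metis (no_types, lifting) imageE mem_Collect_eq)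
  have "z \<in> w ` center E" if ext: "central_extension K E w L" for E :: "('k, 'u) dialgebra" and w
  proof -
    have E: "diassociative_algebra K E" and w: "dia_hom K E L w" "w ` carrier E = carrier L"
      and ker: "a_kernel E L w \<subseteq> center E"
      using ext by (auto simp: central_extension_def)
    interpret E: diassociative_algebra K E by fact
    interpret w: linear_map K E L w using w(1) by (rule dia_hom_linear_map)
    obtain P where P: "dia_hom K F E P" "\<And>a. a \<in> carrier F \<Longrightarrow> w (P a) = p a"
      using lift[OF E w] by blast
    interpret P: linear_map K F E P using P(1) by (rule dia_hom_linear_map)
    have ker0: "x \<stileturn>\<^bsub>E\<^esub> y = \<zero>\<^bsub>E\<^esub>" "y \<stileturn>\<^bsub>E\<^esub> x = \<zero>\<^bsub>E\<^esub>" "x \<turnstile>\<^bsub>E\<^esub> y = \<zero>\<^bsub>E\<^esub>" "y \<turnstile>\<^bsub>E\<^esub> x = \<zero>\<^bsub>E\<^esub>"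
      if "x \<in> carrier E" "w x = \<zero>" "y \<in> carrier E" for x y
      using ker that by (auto simp: a_kernel_def kernel_def center_def)
    have "commutator_part K F R \<subseteq> {m \<in> carrier F. P m = \<zero>\<^bsub>E\<^esub>}"
    proof (rule F.commutator_part_least[OF kernel_subset])
      show "subspace K {m \<in> carrier F. P m = \<zero>\<^bsub>E\<^esub>} F"
        by (rule subspaceI[OF F.vectorspace_axioms]) auto
    qed (auto simp: kernel_iff dia_hom_mult[OF P(1)] P(2) ker0)
    then have P0: "P m = \<zero>\<^bsub>E\<^esub>" if "m \<in> commutator_part K F T" for m using sub that by blast
    have tF: "t \<in> carrier F" using t by simp
    have "P t \<in> center E"
      unfolding center_def
    proof (intro CollectI conjI ballI)
      show "P t \<in> carrier E" using tF by simp
      fix y assume y: "y \<in> carrier E"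
      then have "w y \<in> p ` carrier F" using p_surj by simp
      then obtain a where a: "a \<in> carrier F" "w y = p a" by blast
      define k where "k = y \<ominus>\<^bsub>E\<^esub> P a"
      have k: "k \<in> carrier E" "w k = \<zero>" using y a P(2) by (simp_all add: k_def)
      have yk: "y = k \<oplus>\<^bsub>E\<^esub> P a" using y a by (simp add: k_def a_minus_def E.M.a_assoc E.M.l_neg)
      note m = F.commutator_part_mem[OF T_subset a(1) t(1), THEN P0]
      have PtE: "P t \<in> carrier E" "P a \<in> carrier E" using tF a by simp_all
      show "P t \<stileturn>\<^bsub>E\<^esub> y = \<zero>\<^bsub>E\<^esub>" "y \<stileturn>\<^bsub>E\<^esub> P t = \<zero>\<^bsub>E\<^esub>" "P t \<turnstile>\<^bsub>E\<^esub> y = \<zero>\<^bsub>E\<^esub>" "y \<turnstile>\<^bsub>E\<^esub> P t = \<zero>\<^bsub>E\<^esub>"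
        using m k tF a(1) PtE by (simp_all add: yk E.dia_add ker0 dia_hom_mult[OF P(1)])
    qed
    moreover have "z = w (P t)" using P(2)[OF tF] t(2) by simp
    ultimately show ?thesis by blast
  qed
  then show "z \<in> Zstar TYPE('u) K L" using Z_mult(1)[OF z] M.zero_closed by (auto simp: Zstar_def)
qed

lemma trivial_if_Zstar:
  assumes fd: "fin_dim" and Z: "Z \<subseteq> Zstar TYPE((nat \<Rightarrow> 'k) + 'e) K L" and c: "c \<in> cocycles K L"
  shows "trivial_on_Z c"
proof -
  obtain g :: "'a \<Rightarrow> nat \<Rightarrow> 'k" where g: "inj_on g (carrier L)"
    using fin_dim_inj_nat_fun[OF fd] by blast
  \<comment> \<open>The code of (x, k) stores k at position 0 and the coordinates of x shifted by
    one, inside the left summand.\<close>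
  define h :: "'a \<times> 'k \<Rightarrow> (nat \<Rightarrow> 'k) + 'e" where
    "h = (\<lambda>(x, k). Inl (\<lambda>i. case i of 0 \<Rightarrow> k | Suc j \<Rightarrow> g x j))"
  have "inj_on h (carrier (ext_dia K L c))"
  proof (rule inj_onI, clarify)
    fix x k y l assume *: "(x, k) \<in> carrier (ext_dia K L c)" "(y, l) \<in> carrier (ext_dia K L c)" "h (x, k) = h (y, l)"
    then have eq: "(case i of 0 \<Rightarrow> k | Suc j \<Rightarrow> g x j) = (case i of 0 \<Rightarrow> l | Suc j \<Rightarrow> g y j)" for i
      by (auto simp: h_def dest: fun_cong)
    have "k = l" using eq[of 0] by simp
    moreover have "g x = g y" using eq[of "Suc _"] by auto
    ultimately show "x = y \<and> k = l" using * g by (auto simp: ext_dia_def inj_on_eq_iff)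
  qed
  from Zstar_subset_inj_on[OF ext_dia_central_extension[OF c] this]
  have sub: "Z \<subseteq> fst ` center (ext_dia K L c)" using Z by blast
  show ?thesis
    unfolding trivial_on_Z_def
  proof (intro ballI)
    fix x z assume x: "x \<in> carrier L" and "z \<in> Z"
    \<comment> \<open>The coordinate k of the central preimage does not enter the products, so
      testing against (x, 0) leaves exactly the values of the cocycle.\<close>
    then obtain k where k: "(z, k) \<in> center (ext_dia K L c)" using sub by auto
    have "(x, \<zero>\<^bsub>K\<^esub>) \<in> carrier (ext_dia K L c)" using x by (simp add: ext_dia_def)
    with k show "fst c (x, z) = \<zero>\<^bsub>K\<^esub> \<and> fst c (z, x) = \<zero>\<^bsub>K\<^esub> \<and> snd c (x, z) = \<zero>\<^bsub>K\<^esub> \<and> snd c (z, x) = \<zero>\<^bsub>K\<^esub>"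
      unfolding center_def by (fastforce simp: ext_dia_def)
  qed
qed

end

lemma (in linear_map) image_subspace:
  assumes U: "subspace K U V"
  shows "subspace K (T ` U) W"
proof (rule subspaceI[OF W.vectorspace_axioms])
  note UV = subspaceD(2)[OF U, THEN subsetD]
  show "T ` U \<subseteq> carrier W" using UV by auto
  show "\<zero>\<^bsub>W\<^esub> \<in> T ` U" by (rule image_eqI[OF _ subspaceD(3)[OF U]]) simp
  show "v \<oplus>\<^bsub>W\<^esub> w \<in> T ` U" if vw: "v \<in> T ` U" "w \<in> T ` U" for v w
  proof -
    obtain x y where xy: "x \<in> U" "y \<in> U" "v = T x" "w = T y" using vw by blast
    then have "v \<oplus>\<^bsub>W\<^esub> w = T (x \<oplus>\<^bsub>V\<^esub> y)" using UV by simp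
    then show ?thesis using subspaceD(4)[OF U xy(1,2)] by blast
  qed
  show "c \<odot>\<^bsub>W\<^esub> v \<in> T ` U" if c: "c \<in> carrier K" and v: "v \<in> T ` U" for c v
  proof -
    obtain x where x: "x \<in> U" "v = T x" using v by blast
    then have "c \<odot>\<^bsub>W\<^esub> v = T (c \<odot>\<^bsub>V\<^esub> x)" using UV c by simp
    then show ?thesis using subspaceD(5)[OF U c x(1)] by blast
  qed
qed

lemma restrict_eq_iff: "restrict f S = restrict g S \<longleftrightarrow> (\<forall>x\<in>S. f x = g x)"
  by (metis restrict_apply' restrict_ext)

section \<open>The map delta\<close>

context central_presentation
begin

text \<open>The cocycle conditions move the product next to z, as from c (x y, z) to c (x, y z), and
  a product with the central z is 0. This makes the values on Z independent of the representative
  modulo L'.\<close>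

lemma cocycle_derived_central:
  assumes c: "c \<in> cocycles K L" and l: "l \<in> derived_ideal K L" and z: "z \<in> Z"
  shows "fst c (l, z) = \<zero>\<^bsub>K\<^esub>" "fst c (z, l) = \<zero>\<^bsub>K\<^esub>" "snd c (l, z) = \<zero>\<^bsub>K\<^esub>" "snd c (z, l) = \<zero>\<^bsub>K\<^esub>"
proof -
  have zL: "z \<in> carrier L" using subspaceD(2)[OF Z_subspace] z by blast
  let ?W = "{l \<in> carrier L. fst c (l, z) = \<zero>\<^bsub>K\<^esub> \<and> fst c (z, l) = \<zero>\<^bsub>K\<^esub> \<and> snd c (l, z) = \<zero>\<^bsub>K\<^esub> \<and> snd c (z, l) = \<zero>\<^bsub>K\<^esub>}"
  have "derived_ideal K L \<subseteq> ?W"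
  proof (rule derived_ideal_least)
    show "subspace K ?W L"
      by (rule subspaceI[OF vectorspace_axioms])
        (auto simp: cocycle_zero[OF c zL] cocycle_add[OF c zL] cocycle_smult[OF c zL])
    fix x y assume x: "x \<in> carrier L" and y: "y \<in> carrier L"
    note e1 = cocycle_eqs[OF c x y zL] and e2 = cocycle_eqs[OF c zL x y]
    note zm = Z_mult[OF z x] Z_mult[OF z y]
    have "fst c (x \<stileturn> y, z) = \<zero>\<^bsub>K\<^esub>" using e1(4) zm cocycle_zero[OF c x] by simp
    moreover have "fst c (x \<turnstile> y, z) = \<zero>\<^bsub>K\<^esub>" using e1(2) zm cocycle_zero[OF c x] by simp
    moreover have r: "snd c (x \<turnstile> y, z) = \<zero>\<^bsub>K\<^esub>" using e1(5) zm cocycle_zero[OF c x] by simp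
    \<comment> \<open>No condition moves this product directly; it is first exchanged for the
      product with \<turnstile>.\<close>
    moreover have "snd c (x \<stileturn> y, z) = \<zero>\<^bsub>K\<^esub>" using e1(3) r by simp
    moreover have l: "fst c (z, x \<stileturn> y) = \<zero>\<^bsub>K\<^esub>" using e2(4) zm cocycle_zero[OF c y] by simp
    moreover have "fst c (z, x \<turnstile> y) = \<zero>\<^bsub>K\<^esub>" using e2(1) l by simp
    moreover have "snd c (z, x \<turnstile> y) = \<zero>\<^bsub>K\<^esub>" using e2(5) zm cocycle_zero[OF c y] by simp
    moreover have "snd c (z, x \<stileturn> y) = \<zero>\<^bsub>K\<^esub>" using e2(2) zm cocycle_zero[OF c y] by simp
    ultimately show "x \<stileturn> y \<in> ?W \<and> x \<turnstile> y \<in> ?W" using x y by simp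
  qed
  then show "fst c (l, z) = \<zero>\<^bsub>K\<^esub>" "fst c (z, l) = \<zero>\<^bsub>K\<^esub>" "snd c (l, z) = \<zero>\<^bsub>K\<^esub>" "snd c (z, l) = \<zero>\<^bsub>K\<^esub>"
    using l by blast+
qed

text \<open>With one argument in Z a coboundary is a linear form evaluated at a zero product, and a
  change of x within its coset is harmless by \<open>cocycle_derived_central\<close>. So every set
  under \<open>the_elem\<close> is a singleton.\<close>

lemma delta_values:
  assumes c: "c \<in> cocycles K L" and x: "x \<in> carrier L" and z: "z \<in> Z"
    and C: "C = coboundaries K L +>\<^bsub>Z2\<^esub> c" and P: "P = derived_ideal K L +> x"
  shows "{fst c' (x', z) | c' x'. c' \<in> C \<and> x' \<in> P} = {fst c (x, z)}"
    and "{fst c' (z, x') | c' x'. c' \<in> C \<and> x' \<in> P} = {fst c (z, x)}"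
    and "{snd c' (x', z) | c' x'. c' \<in> C \<and> x' \<in> P} = {snd c (x, z)}"
    and "{snd c' (z, x') | c' x'. c' \<in> C \<and> x' \<in> P} = {snd c (z, x)}"
proof -
  interpret S: vectorspace K "Z2" by (rule cocycle_space_vectorspace)
  have zL: "z \<in> carrier L" using subspaceD(2)[OF Z_subspace] z by blast
  have cC: "c \<in> C" unfolding C using c by (intro S.coset_self[OF coboundaries_subspace]) simp
  have xP: "x \<in> P" unfolding P using x by (intro coset_self[OF derived_ideal_subspace])
  have "fst c' (x', z) = fst c (x, z) \<and> fst c' (z, x') = fst c (z, x) \<and>
      snd c' (x', z) = snd c (x, z) \<and> snd c' (z, x') = snd c (z, x)"
    if c'C: "c' \<in> C" and x'P: "x' \<in> P" for c' x'
  proof -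
    obtain b where b: "b \<in> coboundaries K L" "c' = b \<oplus>\<^bsub>Z2\<^esub> c"
      using c'C unfolding C a_r_coset_def' by blast
    obtain l where l: "l \<in> derived_ideal K L" "x' = l \<oplus> x"
      using x'P unfolding P a_r_coset_def' by blast
    have lL: "l \<in> carrier L" using l subspaceD(2)[OF derived_ideal_subspace] by blast
    then have x': "x' \<in> carrier L" using l x by simp
    obtain e where e: "e \<in> linear_forms K L" "\<And>i j. i \<in> carrier L \<Longrightarrow> j \<in> carrier L \<Longrightarrow>
      fst b (i, j) = e (i \<stileturn> j) \<and> snd b (i, j) = e (i \<turnstile> j)"
      using b(1) unfolding coboundaries_iff by blast
    have "fst b (x', z) = \<zero>\<^bsub>K\<^esub>" "fst b (z, x') = \<zero>\<^bsub>K\<^esub>" "snd b (x', z) = \<zero>\<^bsub>K\<^esub>" "snd b (z, x') = \<zero>\<^bsub>K\<^esub>"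
      using e(2)[OF x' zL] e(2)[OF zL x'] Z_mult[OF z x'] linear_form_simps(4)[OF e(1)] by simp_all
    moreover have "fst c (x', z) = fst c (x, z)" "fst c (z, x') = fst c (z, x)"
      "snd c (x', z) = snd c (x, z)" "snd c (z, x') = snd c (z, x)"
      using cocycle_add[OF c zL lL x] cocycle_derived_central[OF c l(1) z]
        cocycle_closed[OF c x zL] cocycle_closed[OF c zL x] by (simp_all add: l(2))
    ultimately show ?thesis
      using cocycle_closed[OF c x zL] cocycle_closed[OF c zL x] x' zL
      by (simp add: b(2) cocycle_space_ops)
  qed
  note * = this
  show "{fst c' (x', z) | c' x'. c' \<in> C \<and> x' \<in> P} = {fst c (x, z)}"
    "{fst c' (z, x') | c' x'. c' \<in> C \<and> x' \<in> P} = {fst c (z, x)}"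
    "{snd c' (x', z) | c' x'. c' \<in> C \<and> x' \<in> P} = {snd c (x, z)}"
    "{snd c' (z, x') | c' x'. c' \<in> C \<and> x' \<in> P} = {snd c (z, x)}"
    using cC xP * by blast+
qed

lemma delta_zero_iff:
  assumes c: "c \<in> cocycles K L"
  shows "delta K L Z (coboundaries K L +>\<^bsub>Z2\<^esub> c) = \<zero>\<^bsub>delta_codomain K L Z\<^esub> \<longleftrightarrow> trivial_on_Z c"
proof -
  have A: "carrier (quot_space L (derived_ideal K L)) = (\<lambda>x. derived_ideal K L +> x) ` carrier L"
    using quot_space_surj[OF derived_ideal_subspace] by simp
  note v = delta_values[OF c _ _ refl refl]
  have zero: "\<zero>\<^bsub>delta_codomain K L Z\<^esub> =
    (let A = carrier (quot_space L (derived_ideal K L)) in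
      ((\<lambda>_\<in>A \<times> Z. \<zero>\<^bsub>K\<^esub>, \<lambda>_\<in>Z \<times> A. \<zero>\<^bsub>K\<^esub>), (\<lambda>_\<in>A \<times> Z. \<zero>\<^bsub>K\<^esub>, \<lambda>_\<in>Z \<times> A. \<zero>\<^bsub>K\<^esub>)))"
    by (simp add: delta_codomain_def Let_def direct_sum_def bil_space_def R.func_space_def)
  show ?thesis
    unfolding zero delta_def Let_def prod.inject restrict_eq_iff A trivial_on_Z_def
    by (auto simp: v simp del: split_paired_Ex)
qed

lemma H2_carrier: "carrier (H2 K L) = (\<lambda>c. coboundaries K L +>\<^bsub>Z2\<^esub> c) ` cocycles K L"
  using vectorspace.quot_space_surj[OF cocycle_space_vectorspace coboundaries_subspace]
  by (simp add: H2_def)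

lemma delta_trivial_iff:
  "(\<forall>C\<in>carrier (H2 K L). delta K L Z C = \<zero>\<^bsub>delta_codomain K L Z\<^esub>) \<longleftrightarrow> (\<forall>c\<in>cocycles K L. trivial_on_Z c)"
  unfolding H2_carrier by (simp add: delta_zero_iff)

text \<open>\<open>pulls_back c \<psi>\<close>: the inflation of the cocycle \<open>c\<close> of \<open>L/Z\<close> to \<open>L\<close> is the coboundary of \<open>-\<psi>\<close>.\<close>

definition pulls_back where
  "pulls_back c \<psi> \<longleftrightarrow> (\<forall>x\<in>carrier L. \<forall>y\<in>carrier L.
     fst c (Z +> x, Z +> y) = \<psi> (x \<stileturn> y) \<and> snd c (Z +> x, Z +> y) = \<psi> (x \<turnstile> y))"

text \<open>Stands in for the image of the transgression on the level of cocycles, without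
  mentioning a section; \<open>transgression_image\<close> justifies this.\<close>

definition "inflation_kernel = {c \<in> cocycles K Q. \<exists>\<psi>\<in>linear_forms K L. pulls_back c \<psi>}"

lemma coset_in_Q: "x \<in> carrier L \<Longrightarrow> Z +> x \<in> carrier Q"
  by (simp add: quot_dia_carrier[OF Z_ideal])

text \<open>Products in L depend only on the cosets of the factors modulo the central Z. In terms of
  F: \<psi> composed with \<open>p\<close> vanishes on R, which contains [F, T], so it represents a
  cocycle of L/Z.\<close>

lemma pulls_back_exists:
  assumes \<psi>: "\<psi> \<in> linear_forms K L"
  shows "\<exists>c\<in>cocycles K Q. pulls_back c \<psi>"
proof -
  note \<psi>s = linear_form_simps[OF \<psi>]
  have "(\<lambda>a. \<psi> (p a)) \<in> linear_forms K F"
    by (auto simp: linear_forms_iff \<psi>s)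
  moreover have "\<psi> (p m) = \<zero>\<^bsub>K\<^esub>" if "m \<in> commutator_part K F (a_kernel F Q (\<lambda>a. Z +> p a))" for m
  proof -
    have "m \<in> R" using that commutator_part_T_subset unfolding quot_kernel by blast
    then show ?thesis by (simp add: kernel_iff \<psi>s(4))
  qed
  ultimately obtain c where c: "Q.represents (\<lambda>a. \<psi> (p a)) c"
    using Q.form_represents by blast
  have "pulls_back c \<psi>"
    unfolding pulls_back_def ball_carrier_iff
    using Q.representsD(3,4)[OF c] by (simp add: dia_hom_mult[OF p_hom])
  then show ?thesis using Q.representsD(2)[OF c] by blast
qed

lemma inflation_kernel_subspace: "subspace K inflation_kernel (Q.Z2)"
proof -
  interpret S: vectorspace K "Q.Z2" by (rule Q.cocycle_space_vectorspace)
  show ?thesis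
  proof (rule subspaceI[OF S.vectorspace_axioms])
    show "inflation_kernel \<subseteq> carrier (Q.Z2)"
      by (auto simp: inflation_kernel_def Q.cocycle_space_carrier)
    have "pulls_back \<zero>\<^bsub>Q.Z2\<^esub> (\<lambda>_. \<zero>\<^bsub>K\<^esub>)"
      by (simp add: pulls_back_def Q.cocycle_space_ops coset_in_Q)
    moreover have "(\<lambda>_. \<zero>\<^bsub>K\<^esub>) \<in> linear_forms K L" by (auto simp: linear_forms_iff)
    ultimately show "\<zero>\<^bsub>Q.Z2\<^esub> \<in> inflation_kernel"
      using S.M.zero_closed unfolding inflation_kernel_def Q.cocycle_space_carrier by blast
    show "c \<oplus>\<^bsub>Q.Z2\<^esub> d \<in> inflation_kernel"
      if cd: "c \<in> inflation_kernel" "d \<in> inflation_kernel" for c d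
    proof -
      obtain e f where e: "e \<in> linear_forms K L" "pulls_back c e" and f: "f \<in> linear_forms K L" "pulls_back d f"
        using cd by (auto simp: inflation_kernel_def)
      have "pulls_back (c \<oplus>\<^bsub>Q.Z2\<^esub> d) (\<lambda>x. e x \<oplus>\<^bsub>K\<^esub> f x)"
        using e(2) f(2) by (simp add: pulls_back_def Q.cocycle_space_ops coset_in_Q)
      moreover have "(\<lambda>x. e x \<oplus>\<^bsub>K\<^esub> f x) \<in> linear_forms K L"
        by (rule linear_forms_add[OF e(1) f(1)])
      ultimately show ?thesis
        using cd S.M.a_closed[of c d] unfolding inflation_kernel_def Q.cocycle_space_carrier by blast
    qed
    show "a \<odot>\<^bsub>Q.Z2\<^esub> c \<in> inflation_kernel"
      if a: "a \<in> carrier K" and c: "c \<in> inflation_kernel" for a c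
    proof -
      obtain e where e: "e \<in> linear_forms K L" "pulls_back c e"
        using c by (auto simp: inflation_kernel_def)
      have "pulls_back (a \<odot>\<^bsub>Q.Z2\<^esub> c) (\<lambda>x. a \<otimes>\<^bsub>K\<^esub> e x)"
        using e(2) by (simp add: pulls_back_def Q.cocycle_space_ops coset_in_Q)
      moreover have "(\<lambda>x. a \<otimes>\<^bsub>K\<^esub> e x) \<in> linear_forms K L"
        by (rule linear_forms_smult[OF e(1) a])
      ultimately show ?thesis
        using a c S.smult_closed[of a c] unfolding inflation_kernel_def Q.cocycle_space_carrier by blast
    qed
  qed
qed

lemma coboundaries_inflation_kernel: "coboundaries K Q \<subseteq> inflation_kernel"
proof
  fix c assume c: "c \<in> coboundaries K Q"
  then obtain e where e: "e \<in> linear_forms K Q" "\<And>i j. i \<in> carrier Q \<Longrightarrow> j \<in> carrier Q \<Longrightarrow>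
    fst c (i, j) = e (i \<stileturn>\<^bsub>Q\<^esub> j) \<and> snd c (i, j) = e (i \<turnstile>\<^bsub>Q\<^esub> j)"
    unfolding Q.coboundaries_iff by blast
  note qm = dia_hom_mult[OF quot_dia_hom(2)[OF Z_ideal]]
  interpret q: linear_map K L Q "\<lambda>x. Z +> x"
    by (rule dia_hom_linear_map[OF quot_dia_hom(2)[OF Z_ideal]])
  have "(\<lambda>x. e (Z +> x)) \<in> linear_forms K L"
    using Q.linear_form_simps[OF e(1)] by (auto simp: linear_forms_iff coset_in_Q)
  moreover have "pulls_back c (\<lambda>x. e (Z +> x))"
    using e(2) by (simp add: pulls_back_def coset_in_Q qm)
  ultimately show "c \<in> inflation_kernel"
    using c unfolding inflation_kernel_def Q.coboundaries_iff by blast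
qed

section \<open>Transgression along a linear section\<close>

context
  fixes s
  assumes s: "linear_section K L Z s"
begin

lemma section_map: "linear_map K Q L s"
  using s by (simp add: linear_section_def)

lemma section_closed: "P \<in> carrier Q \<Longrightarrow> s P \<in> carrier L"
  using mod_hom.f_im[OF linear_map.axioms(3)[OF section_map]] .

lemma section_minus: "x \<in> carrier L \<Longrightarrow> s (Z +> x) \<ominus> x \<in> Z"
  using s coset_in_Q[of x] coset_mem_iff[OF Z_subspace, of x] by (auto simp: linear_section_def)

lemma coset_section:
  assumes "P \<in> carrier Q"
  shows "Z +> s P = P"
proof -
  obtain x where x: "x \<in> carrier L" "P = Z +> x" using assms by (auto simp: quot_dia_carrier[OF Z_ideal])
  then show ?thesis
    using section_minus[OF x(1)] section_closed[OF assms] by (simp add: coset_eq_iff[OF Z_subspace])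
qed

abbreviation "transgression_cocycle \<chi> \<equiv>
  (\<lambda>(P, P')\<in>carrier Q \<times> carrier Q. \<chi> ((s P \<stileturn> s P') \<ominus> s (P \<stileturn>\<^bsub>Q\<^esub> P')),
   \<lambda>(P, P')\<in>carrier Q \<times> carrier Q. \<chi> ((s P \<turnstile> s P') \<ominus> s (P \<turnstile>\<^bsub>Q\<^esub> P')))"

lemma pulls_back_section:
  assumes "pulls_back c \<psi>" "P \<in> carrier Q" "P' \<in> carrier Q"
  shows "fst c (P, P') = \<psi> (s P \<stileturn> s P')" "snd c (P, P') = \<psi> (s P \<turnstile> s P')"
  using assms section_closed coset_section unfolding pulls_back_def by metis+

text \<open>Subtracting \<open>s (Z +> x)\<close> from x is the projection of L onto Z along the
  image of the section, so \<psi> extends \<chi> by zero on that image. On a product of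
  \<open>s P\<close> and \<open>s P'\<close>, whose coset is the product of P and P', it takes the
  value that defines the transgression.\<close>

lemma transgression_cocycle_pulls_back:
  assumes \<chi>: "\<chi> \<in> linear_forms K (L\<lparr>carrier := Z\<rparr>)"
  shows "transgression_cocycle \<chi> \<in> inflation_kernel"
proof -
  interpret s: linear_map K Q L s by (rule section_map)
  interpret q: linear_map K L Q "\<lambda>x. Z +> x"
    by (rule dia_hom_linear_map[OF quot_dia_hom(2)[OF Z_ideal]])
  note qm = dia_hom_mult[OF quot_dia_hom(2)[OF Z_ideal]]
  have \<chi>s: "\<And>x. x \<in> Z \<Longrightarrow> \<chi> x \<in> carrier K" "\<And>x y. x \<in> Z \<Longrightarrow> y \<in> Z \<Longrightarrow> \<chi> (x \<oplus> y) = \<chi> x \<oplus>\<^bsub>K\<^esub> \<chi> y"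
    "\<And>c x. c \<in> carrier K \<Longrightarrow> x \<in> Z \<Longrightarrow> \<chi> (c \<odot> x) = c \<otimes>\<^bsub>K\<^esub> \<chi> x"
    using \<chi> by (auto simp: linear_forms_iff)
  define \<psi> where "\<psi> x = \<chi> (x \<ominus> s (Z +> x))" for x
  have d: "x \<ominus> s (Z +> x) \<in> Z" if "x \<in> carrier L" for x
  proof -
    have "\<ominus> (s (Z +> x) \<ominus> x) \<in> Z"
      using subspace_minus_closed(1)[OF Z_subspace] section_minus[OF that] by blast
    moreover have "\<ominus> (s (Z +> x) \<ominus> x) = x \<ominus> s (Z +> x)"
      using that section_closed[OF coset_in_Q[OF that]] by (simp add: a_minus_def M.minus_add M.a_comm)
    ultimately show ?thesis by simp
  qed
  have "\<psi> \<in> linear_forms K L"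
    unfolding linear_forms_iff
  proof (intro conjI ballI Pi_I)
    fix x assume x: "x \<in> carrier L"
    note sx = section_closed[OF coset_in_Q[OF x]]
    show "\<psi> x \<in> carrier K" using \<chi>s(1)[OF d[OF x]] by (simp add: \<psi>_def)
    have "c \<odot> x \<ominus> s (Z +> (c \<odot> x)) = c \<odot> (x \<ominus> s (Z +> x))" if "c \<in> carrier K" for c
      using x sx that coset_in_Q by (simp add: a_minus_def smult_r_distr smult_r_minus)
    then show "\<psi> (c \<odot> x) = c \<otimes>\<^bsub>K\<^esub> \<psi> x" if "c \<in> carrier K" for c
      using \<chi>s(3)[OF that d[OF x]] that by (simp add: \<psi>_def)
    fix y assume y: "y \<in> carrier L"
    note sy = section_closed[OF coset_in_Q[OF y]]
    have "(x \<oplus> y) \<ominus> s (Z +> (x \<oplus> y)) = (x \<ominus> s (Z +> x)) \<oplus> (y \<ominus> s (Z +> y))"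
      using x y sx sy coset_in_Q by (simp add: a_minus_def M.minus_add M.a_ac)
    then show "\<psi> (x \<oplus> y) = \<psi> x \<oplus>\<^bsub>K\<^esub> \<psi> y"
      using \<chi>s(2)[OF d[OF x] d[OF y]] by (simp add: \<psi>_def)
  qed
  then obtain c where c: "c \<in> cocycles K Q" "pulls_back c \<psi>" using pulls_back_exists by blast
  have "fst c (P, P') = \<chi> (s P \<stileturn> s P' \<ominus> s (P \<stileturn>\<^bsub>Q\<^esub> P'))"
    "snd c (P, P') = \<chi> (s P \<turnstile> s P' \<ominus> s (P \<turnstile>\<^bsub>Q\<^esub> P'))"
    if "P \<in> carrier Q" "P' \<in> carrier Q" for P P'
    using pulls_back_section[OF c(2) that] qm[OF section_closed[OF that(1)] section_closed[OF that(2)]] that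
    by (simp_all add: \<psi>_def coset_section)
  then have "transgression_cocycle \<chi> = c"
    using c(1) unfolding Q.cocycles_iff
    by (intro prod_eqI extensionalityI[of _ "carrier Q \<times> carrier Q"]) auto
  then show ?thesis
    using c \<open>\<psi> \<in> linear_forms K L\<close> unfolding inflation_kernel_def by blast
qed

text \<open>On representatives from the section, d is \<psi> evaluated at the product of
  \<open>s P\<close> and \<open>s P'\<close>. It exceeds the transgression cocycle of \<psi> by
  \<psi> applied to \<open>s\<close> of the product of P and P', which is the coboundary of a form
  on L/Z.\<close>

lemma inflation_kernel_transgression:
  assumes d: "d \<in> cocycles K Q" and \<psi>: "\<psi> \<in> linear_forms K L" "pulls_back d \<psi>"
  shows "coboundaries K Q +>\<^bsub>Q.Z2\<^esub> d = transgression K L Z s \<psi>"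
    and "\<psi> \<in> linear_forms K (L\<lparr>carrier := Z\<rparr>)"
proof -
  interpret S: vectorspace K "Q.Z2" by (rule Q.cocycle_space_vectorspace)
  interpret s: linear_map K Q L s by (rule section_map)
  note \<psi>s = linear_form_simps[OF \<psi>(1)]
  show \<psi>Z: "\<psi> \<in> linear_forms K (L\<lparr>carrier := Z\<rparr>)"
    using \<psi>(1) subspaceD(2)[OF Z_subspace] by (auto simp: linear_forms_iff subset_iff)
  let ?t = "transgression_cocycle \<psi>"
  have t: "?t \<in> cocycles K Q"
    using transgression_cocycle_pulls_back[OF \<psi>Z] by (simp add: inflation_kernel_def)
  have e: "(\<lambda>P. \<psi> (s P)) \<in> linear_forms K Q"
    by (auto simp: linear_forms_iff \<psi>s)
  define b where "b = (\<lambda>(P, P')\<in>carrier Q \<times> carrier Q. \<psi> (s (P \<stileturn>\<^bsub>Q\<^esub> P')),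
    \<lambda>(P, P')\<in>carrier Q \<times> carrier Q. \<psi> (s (P \<turnstile>\<^bsub>Q\<^esub> P')))"
  have bZ: "b \<in> cocycles K Q"
    unfolding b_def by (rule Q.cocycles_restrictI[OF Q.coboundary_cocycle[OF e]])
  then have b: "b \<in> coboundaries K Q"
    unfolding Q.coboundaries_iff by (auto simp: b_def intro!: bexI[OF _ e])
  have sub: "x = y \<oplus>\<^bsub>K\<^esub> (x \<ominus>\<^bsub>K\<^esub> y)" if "x \<in> carrier K" "y \<in> carrier K" for x y
    using that by algebra
  have "d = b \<oplus>\<^bsub>Q.Z2\<^esub> ?t"
  proof (rule Q.cocycles_eqI[OF d])
    show "b \<oplus>\<^bsub>Q.Z2\<^esub> ?t \<in> cocycles K Q"
      using S.M.a_closed[of b ?t] bZ t by (simp add: Q.cocycle_space_carrier)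
    fix P P' assume P: "P \<in> carrier Q" "P' \<in> carrier Q"
    have c: "s P \<stileturn> s P' \<in> carrier L" "s P \<turnstile> s P' \<in> carrier L"
      "s (P \<stileturn>\<^bsub>Q\<^esub> P') \<in> carrier L" "s (P \<turnstile>\<^bsub>Q\<^esub> P') \<in> carrier L"
      using P section_closed by simp_all
    have t_val: "fst ?t (P, P') = \<psi> (s P \<stileturn> s P') \<ominus>\<^bsub>K\<^esub> \<psi> (s (P \<stileturn>\<^bsub>Q\<^esub> P'))"
      "snd ?t (P, P') = \<psi> (s P \<turnstile> s P') \<ominus>\<^bsub>K\<^esub> \<psi> (s (P \<turnstile>\<^bsub>Q\<^esub> P'))"
      using P c by (simp_all add: \<psi>s(6))
    have b_val: "fst b (P, P') = \<psi> (s (P \<stileturn>\<^bsub>Q\<^esub> P'))" "snd b (P, P') = \<psi> (s (P \<turnstile>\<^bsub>Q\<^esub> P'))"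
      using P by (simp_all add: b_def)
    show "fst d (P, P') = fst (b \<oplus>\<^bsub>Q.Z2\<^esub> ?t) (P, P') \<and>
      snd d (P, P') = snd (b \<oplus>\<^bsub>Q.Z2\<^esub> ?t) (P, P')"
      unfolding Q.cocycle_space_ops(1,2)[OF P] t_val b_val pulls_back_section[OF \<psi>(2) P]
      by (intro conjI sub \<psi>s(1) c)
  qed
  moreover have "(x \<oplus>\<^bsub>Q.Z2\<^esub> y) \<ominus>\<^bsub>Q.Z2\<^esub> y = x"
    if "x \<in> carrier (Q.Z2)" "y \<in> carrier (Q.Z2)" for x y
    using that by (simp add: a_minus_def S.M.a_assoc S.M.r_neg del: Q.cocycle_space_carrier)
  ultimately have "d \<ominus>\<^bsub>Q.Z2\<^esub> ?t = b"
    using bZ t by (simp only: Q.cocycle_space_carrier)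
  then have "coboundaries K Q +>\<^bsub>Q.Z2\<^esub> d = coboundaries K Q +>\<^bsub>Q.Z2\<^esub> ?t"
    using S.coset_eq_iff[OF Q.coboundaries_subspace, of d ?t] b d t by (simp add: Q.cocycle_space_carrier)
  then show "coboundaries K Q +>\<^bsub>Q.Z2\<^esub> d = transgression K L Z s \<psi>"
    by (simp add: transgression_def Let_def)
qed

text \<open>The right side does not mention the section, so every section yields the same
  image.\<close>

lemma transgression_image:
  "transgression K L Z s ` linear_forms K (L\<lparr>carrier := Z\<rparr>) =
    (\<lambda>c. coboundaries K Q +>\<^bsub>Q.Z2\<^esub> c) ` inflation_kernel"
proof
  show "transgression K L Z s ` linear_forms K (L\<lparr>carrier := Z\<rparr>) \<subseteq>
    (\<lambda>c. coboundaries K Q +>\<^bsub>Q.Z2\<^esub> c) ` inflation_kernel"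
    using transgression_cocycle_pulls_back by (auto simp: transgression_def Let_def)
  show "(\<lambda>c. coboundaries K Q +>\<^bsub>Q.Z2\<^esub> c) ` inflation_kernel \<subseteq>
    transgression K L Z s ` linear_forms K (L\<lparr>carrier := Z\<rparr>)"
  proof (rule image_subsetI)
    fix c assume "c \<in> inflation_kernel"
    then obtain \<psi> where "c \<in> cocycles K Q" "\<psi> \<in> linear_forms K L" "pulls_back c \<psi>"
      by (auto simp: inflation_kernel_def)
    from inflation_kernel_transgression[OF this]
    show "coboundaries K Q +>\<^bsub>Q.Z2\<^esub> c \<in> transgression K L Z s ` linear_forms K (L\<lparr>carrier := Z\<rparr>)"
      by blast
  qed
qed

lemma multiplier_isomorphic_iff:
  assumes fd: "fin_dim"
  shows "vs_isomorphic K (multiplier K F R)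
      (quot_space (H2 K Q) (transgression K L Z s ` linear_forms K (L\<lparr>carrier := Z\<rparr>))) \<longleftrightarrow>
    commutator_part K F T \<subseteq> commutator_part K F R"
proof -
  interpret S: vectorspace K "Q.Z2" by (rule Q.cocycle_space_vectorspace)
  let ?B = "\<lambda>c. coboundaries K Q +>\<^bsub>Q.Z2\<^esub> c"
  let ?U = "?B ` inflation_kernel"
  have B: "linear_map K (Q.Z2) (H2 K Q) ?B" "?B ` cocycles K Q = carrier (H2 K Q)"
    using S.quot_space_linear_map[OF Q.coboundaries_subspace] S.quot_space_surj[OF Q.coboundaries_subspace]
    by (simp_all add: H2_def Q.cocycle_space_carrier)
  interpret H: vectorspace K "H2 K Q" using B(1) by (simp add: linear_map_def)
  interpret B: linear_map K "Q.Z2" "H2 K Q" ?B by (rule B(1))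
  have U: "subspace K ?U (H2 K Q)" by (rule B.image_subspace[OF inflation_kernel_subspace])
  \<comment> \<open>The two successive quotients, by coboundaries and by the image of the
    transgression, are treated as one map on cocycles.\<close>
  define q where "q = (\<lambda>c. ?U +>\<^bsub>H2 K Q\<^esub> ?B c)"
  have q: "linear_map K (Q.Z2) (quot_space (H2 K Q) ?U) q"
    using linear_map_comp[OF B(1) H.quot_space_linear_map[OF U]] by (simp add: q_def comp_def)
  have q_surj: "q ` carrier (Q.Z2) = carrier (quot_space (H2 K Q) ?U)"
    using H.quot_space_surj[OF U] unfolding B(2)[symmetric] by (simp add: q_def image_image Q.cocycle_space_carrier)
  have q0: "q c = \<zero>\<^bsub>quot_space (H2 K Q) ?U\<^esub> \<longleftrightarrow> c \<in> inflation_kernel" if c: "c \<in> cocycles K Q" for c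
  proof -
    have "q c = \<zero>\<^bsub>quot_space (H2 K Q) ?U\<^esub> \<longleftrightarrow> ?B c \<in> ?U"
      unfolding q_def by (rule H.quot_space_zero_iff[OF U]) (use B(2) c in blast)
    also have "\<dots> \<longleftrightarrow> c \<in> inflation_kernel"
    proof
      \<comment> \<open>The preimage of the image is no larger than \<open>inflation_kernel\<close>,
        because coboundaries already belong to it.\<close>
      assume "?B c \<in> ?U"
      then obtain d where d: "d \<in> inflation_kernel" "?B c = ?B d" by blast
      have dZ: "d \<in> cocycles K Q" using d(1) by (simp add: inflation_kernel_def)
      have "c \<ominus>\<^bsub>Q.Z2\<^esub> d \<in> coboundaries K Q"
        using d(2) c dZ S.coset_eq_iff[OF Q.coboundaries_subspace, of c d] by (simp add: Q.cocycle_space_carrier)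
      then have "(c \<ominus>\<^bsub>Q.Z2\<^esub> d) \<oplus>\<^bsub>Q.Z2\<^esub> d \<in> inflation_kernel"
        using subspaceD(4)[OF inflation_kernel_subspace _ d(1)] coboundaries_inflation_kernel by blast
      then show "c \<in> inflation_kernel"
        using c dZ unfolding Q.cocycle_space_carrier[symmetric]
        by (simp add: a_minus_def S.M.a_assoc S.M.l_neg del: Q.cocycle_space_carrier)
    qed blast
    finally show ?thesis .
  qed
  have DF: "derived_ideal K F \<subseteq> carrier F" by (rule subspaceD(2)[OF F.derived_ideal_subspace])
  have "vs_isomorphic K (multiplier K F R) (quot_space (H2 K Q) ?U) \<longleftrightarrow>
    (\<forall>m\<in>carrier FR. (\<forall>c\<in>carrier (Q.Z2). Q.form c m = \<zero>\<^bsub>K\<^esub>) \<longrightarrow>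
       commutator_part K F R +>\<^bsub>F\<^esub> m = \<zero>\<^bsub>multiplier K F R\<^esub>)"
  proof (rule pairing_isomorphic_iff[OF q q_surj multiplier_linear_map multiplier_carrier])
    show "(\<lambda>c. Q.form c m) \<in> linear_forms K (Q.Z2)" if "m \<in> carrier FR" for m
      using that by (intro Q.form_linear) simp
    show "Q.form c \<in> linear_forms K FR" if "c \<in> carrier (Q.Z2)" for c
    proof -
      have "Q.form c \<in> linear_forms K F"
        using Q.representsD(1)[OF Q.form] that by (simp add: Q.cocycle_space_carrier)
      then show ?thesis using DF by (auto simp: linear_forms_iff subset_iff)
    qed
    show "q c = \<zero>\<^bsub>quot_space (H2 K Q) ?U\<^esub> \<longleftrightarrow> (\<forall>m\<in>carrier FR. Q.form c m = \<zero>\<^bsub>K\<^esub>)"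
      if "c \<in> carrier (Q.Z2)" for c
    proof -
      have c: "c \<in> cocycles K Q" using that by (simp add: Q.cocycle_space_carrier)
      note r = Q.representsD[OF Q.form[OF c]]
      \<comment> \<open>Read on representatives in F, \<open>pulls_back\<close> is the factorization
        condition of \<open>form_factors_iff\<close>, which identifies the left kernel.\<close>
      have "pulls_back c \<psi> \<longleftrightarrow> (\<forall>a\<in>carrier F. \<forall>b\<in>carrier F.
          Q.form c (a \<stileturn>\<^bsub>F\<^esub> b) = \<psi> (p a \<stileturn> p b) \<and> Q.form c (a \<turnstile>\<^bsub>F\<^esub> b) = \<psi> (p a \<turnstile> p b))" for \<psi>
        unfolding pulls_back_def ball_carrier_iff by (simp add: r(3,4))
      then show ?thesis
        using form_factors_iff[OF r(1)] q0[OF c] c by (simp add: inflation_kernel_def)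
    qed
    show "Q.form c m = \<zero>\<^bsub>K\<^esub>"
      if "c \<in> carrier (Q.Z2)" "m \<in> carrier FR"
        "commutator_part K F R +>\<^bsub>F\<^esub> m = \<zero>\<^bsub>multiplier K F R\<^esub>" for c m
    proof -
      have "m \<in> commutator_part K F T"
        using that(2,3) multiplier_zero_iff commutator_part_mono by auto
      then show ?thesis
        using Q.represents_commutator_part[OF Q.form] that(1) by (simp add: quot_kernel Q.cocycle_space_carrier)
    qed
    show "vectorspace.fin_dim K (multiplier K F R)" by (rule multiplier_fin_dim[OF fd])
  qed
  \<comment> \<open>The membership test for the presentation of L/Z identifies the right kernel as
    [F, T].\<close>
  also have "\<dots> \<longleftrightarrow> (\<forall>m\<in>derived_ideal K F \<inter> R. m \<in> commutator_part K F T \<longrightarrow> m \<in> commutator_part K F R)"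
    using Q.commutator_part_derived_iff multiplier_zero_iff
    by (simp add: quot_kernel Q.cocycle_space_carrier)
  also have "\<dots> \<longleftrightarrow> commutator_part K F T \<subseteq> commutator_part K F R"
    using commutator_part_T_subset by blast
  finally show ?thesis unfolding transgression_image .
qed

end

end

theorem theorem4p9:
  fixes K :: "('k, 'r) ring_scheme"
    and L :: "('k, 'a, 'l) dialgebra_scheme"
    and Z :: "'a set"
    and X :: "'x set"
    and p :: "('x dword \<Rightarrow> 'k) \<Rightarrow> 'a"
    and s :: "'a set \<Rightarrow> 'a"
  defines "F \<equiv> free_dia K X"
  defines "R \<equiv> a_kernel F L p"
    and "T \<equiv> {f \<in> carrier F. p f \<in> Z}"
  assumes "diassociative_algebra K L"
    and "vectorspace.fin_dim K L"
    and "central_ideal K L Z"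
    and "free_presentation K X L p"
    and "linear_section K L Z s"
  shows
    "((\<forall>C\<in>carrier (H2 K L). delta K L Z C = \<zero>\<^bsub>delta_codomain K L Z\<^esub>) \<longleftrightarrow>
        inj_on (beta K F T) (carrier (multiplier K F R))) \<and>
     (inj_on (beta K F T) (carrier (multiplier K F R)) \<longleftrightarrow>
        vs_isomorphic K (multiplier K F R)
          (quot_space (H2 K (quot_dia L Z))
             (transgression K L Z s ` linear_forms K (L\<lparr>carrier := Z\<rparr>)))) \<and>
     (vs_isomorphic K (multiplier K F R)
          (quot_space (H2 K (quot_dia L Z))
             (transgression K L Z s ` linear_forms K (L\<lparr>carrier := Z\<rparr>))) \<longleftrightarrow>
        Z \<subseteq> Zstar TYPE((nat \<Rightarrow> 'k) + 'e) K L)"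
proof -
  interpret central_presentation K L X p Z
    using assms(4,6,7)
    by (simp add: central_presentation_def central_presentation_axioms_def dia_presentation_def dia_presentation_axioms_def)
  \<comment> \<open>Only this direction depends on the type given to \<open>Zstar\<close>, which has
    to hold the extension of each cocycle.\<close>
  have "commutator_part K F T \<subseteq> commutator_part K F R"
    if "Z \<subseteq> Zstar TYPE((nat \<Rightarrow> 'k) + 'e) K L"
    using trivial_if_Zstar[OF assms(5) that] trivial_iff_commutator_part
    unfolding F_def R_def T_def by blast
  moreover have "Z \<subseteq> Zstar TYPE((nat \<Rightarrow> 'k) + 'e) K L"
    if "commutator_part K F T \<subseteq> commutator_part K F R"
    using Zstar_if_commutator_part that unfolding F_def R_def T_def by blast
  ultimately show ?thesis
    using delta_trivial_iff trivial_iff_commutator_part beta_inj_iff multiplier_isomorphic_iff[OF assms(8,5)]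
    unfolding F_def R_def T_def by blast
qed

end
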